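(* Let $X=(X_t)_{t\in[0,T]}$ be a cadlag, zero-mean, square integrable process, continuous in $L^2(\Omega)$, with $X_0=0$, having a covariance measure $\mu$ which is non-atomic. Then: (i) $\langle\cdot,\cdot\rangle_{\mathcal H}$ is a semiscalar product on $L_\mu$. (ii) The linear map $\Phi:BV([0,T])\to L^2(\Omega)$, $\Phi(\varphi)=\int_0^T\varphi\,d^-X$, can be continuously extended to $L_\mu$ equipped with the seminorm $\|\cdot\|_{\mathcal H}$. Moreover the extension (still denoted $\Phi$) satisfies $\|\varphi\|_{\mathcal H}^2=E\big(\Phi(\varphi)^2\big)$ for every $\varphi\in L_\mu$.
   Context: Fix $T>0$. Let $R(s,t)=\mathrm{Cov}(X_s,X_t)$. For $I=]a_1,b_1]\times]a_2,b_2]\subset[0,T]^2$ put $\Delta_IR=R(b_1,b_2)+R(a_1,a_2)-R(a_1,b_2)-R(b_1,a_2)$. $X$ has covariance measure $\mu$ if $I\mapsto\Delta_IR$ extends to a signed ($\sigma$-finite) measure $\mu$ on $\mathcal{B}([0,T]^2)$; thus $\mu([0,s]\times[0,t])=R(s,t)$. $BV([0,T])$ is the space of real functions of bounded variation on $[0,T]$. $X$ is extended to $\mathbb{R}$ by continuity (constantly outside $[0,T]$) and the forward integral $\int_0^T\varphi\,d^-X$ is the limit in probability (for $\varphi\in BV([0,T])$, the limit in $L^2(\Omega)$) as $\varepsilon\to0$ of $\int_0^T\varphi(s)\frac{X_{s+\varepsilon}-X_s}{\varepsilon}ds$. $L_\mu$ is the vector space of Borel functions $\varphi:[0,T]\to\mathbb{R}$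 with $\int_{[0,T]^2}|\varphi(u)||\varphi(v)|\,d|\mu|(u,v)<\infty$. For $\varphi,\phi\in L_\mu$, $\langle\varphi,\phi\rangle_{\mathcal H}=\int_{[0,T]^2}\varphi(u)\phi(v)\,d\mu(u,v)$ and $\|\varphi\|^2_{\mathcal H}=\langle\varphi,\varphi\rangle_{\mathcal H}$. "Semiscalar product" means a symmetric bilinear form with $\langle\varphi,\varphi\rangle\ge0$, where $\langle\varphi,\varphi\rangle=0$ need not imply $\varphi=0$.
   Formalization: That L_μ is a vector space is assumed explicitly: it fails for some covariance measures (φ, ψ in L_μ need not give ∫|φ(u)ψ(v)|d|μ| < ∞), and then ⟨φ,ψ⟩ and a linear extension to L_μ are undefined. *)

theory Defs
  imports "HOL-Probability.Probability"
begin

section \<open>Signed measures\<close>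

text \<open>A signed measure is a countably additive real-valued set function on the \<sigma>-algebra of
  a measure space \<open>N\<close>; only \<open>space N\<close> and \<open>sets N\<close> matter, never the measure carried by \<open>N\<close>.
  Real values lose nothing below: a signed measure that is finite on the whole space (here
  \<open>\<mu>([0,T]\<^sup>2) = R(T,T)\<close>) is finite on every measurable set.\<close>

definition signed_measure :: "'b measure \<Rightarrow> ('b set \<Rightarrow> real) \<Rightarrow> bool" where
  "signed_measure N \<mu> \<longleftrightarrow> \<mu> {} = 0 \<and>
     (\<forall>A :: nat \<Rightarrow> 'b set. range A \<subseteq> sets N \<longrightarrow> disjoint_family A \<longrightarrow>
        (\<lambda>n. \<mu> (A n)) sums \<mu> (\<Union>n. A n))"

text \<open>The Jordan decomposition \<open>\<mu>\<^sup>+(A) = sup {\<mu>(B) | B \<subseteq> A}\<close>, \<open>\<mu>\<^sup>-(A) = sup {-\<mu>(B) | B \<subseteq> A}\<close> and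
  \<open>|\<mu>| = \<mu>\<^sup>+ + \<mu>\<^sup>-\<close>.  The map \<open>ennreal\<close> sends negative reals to 0, which is harmless as
  \<open>B = {}\<close> already contributes the value 0 to each supremum.\<close>

definition pos_variation :: "'b measure \<Rightarrow> ('b set \<Rightarrow> real) \<Rightarrow> 'b measure" where
  "pos_variation N \<mu> = measure_of (space N) (sets N)
     (\<lambda>A. SUP B\<in>{B \<in> sets N. B \<subseteq> A}. ennreal (\<mu> B))"

definition neg_variation :: "'b measure \<Rightarrow> ('b set \<Rightarrow> real) \<Rightarrow> 'b measure" where
  "neg_variation N \<mu> = pos_variation N (\<lambda>A. - \<mu> A)"

definition total_variation :: "'b measure \<Rightarrow> ('b set \<Rightarrow> real) \<Rightarrow> 'b measure" where
  "total_variation N \<mu> = measure_of (space N) (sets N)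
     (\<lambda>A. emeasure (pos_variation N \<mu>) A + emeasure (neg_variation N \<mu>) A)"

definition signed_integral :: "'b measure \<Rightarrow> ('b set \<Rightarrow> real) \<Rightarrow> ('b \<Rightarrow> real) \<Rightarrow> real" where
  "signed_integral N \<mu> f =
     (\<integral>x. f x \<partial>pos_variation N \<mu>) - (\<integral>x. f x \<partial>neg_variation N \<mu>)"

definition non_atomic :: "'b measure \<Rightarrow> ('b set \<Rightarrow> real) \<Rightarrow> bool" where
  "non_atomic N \<mu> \<longleftrightarrow>
     (\<forall>A\<in>sets N. emeasure (total_variation N \<mu>) A > 0 \<longrightarrow>
        (\<exists>B\<in>sets N. B \<subseteq> A \<and> 0 < emeasure (total_variation N \<mu>) B \<and>
           emeasure (total_variation N \<mu>) B < emeasure (total_variation N \<mu>) A))"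

section \<open>Square integrable random variables\<close>

text \<open>Elements of \<open>L\<^sup>2(\<Omega>)\<close> are represented by functions; equality in \<open>L\<^sup>2(\<Omega>)\<close> is equality almost
  everywhere.\<close>

definition L2_space :: "'a measure \<Rightarrow> ('a \<Rightarrow> real) set" where
  "L2_space M = {Y \<in> borel_measurable M. integrable M (\<lambda>\<omega>. (Y \<omega>)\<^sup>2)}"

definition L2_norm :: "'a measure \<Rightarrow> ('a \<Rightarrow> real) \<Rightarrow> real" where
  "L2_norm M Y = sqrt (\<integral>\<omega>. (Y \<omega>)\<^sup>2 \<partial>M)"

definition tendsto_L2 ::
    "'a measure \<Rightarrow> ('i \<Rightarrow> 'a \<Rightarrow> real) \<Rightarrow> ('a \<Rightarrow> real) \<Rightarrow> 'i filter \<Rightarrow> bool" where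
  "tendsto_L2 M Z Y F \<longleftrightarrow> Y \<in> L2_space M \<and> (\<forall>\<^sub>F i in F. Z i \<in> L2_space M) \<and>
     ((\<lambda>i. L2_norm M (\<lambda>\<omega>. Z i \<omega> - Y \<omega>)) \<longlongrightarrow> 0) F"

section \<open>Processes on the interval from 0 to T\<close>

text \<open>A process indexed by \<open>[0,T]\<close> is a function \<open>X :: real \<Rightarrow> 'a \<Rightarrow> real\<close> whose values at times
  outside \<open>[0,T]\<close> are ignored.\<close>

definition cadlag_process :: "'a measure \<Rightarrow> real \<Rightarrow> (real \<Rightarrow> 'a \<Rightarrow> real) \<Rightarrow> bool" where
  "cadlag_process M T X \<longleftrightarrow> (\<forall>\<omega>\<in>space M.
     (\<forall>t\<in>{0..<T}. ((\<lambda>s. X s \<omega>) \<longlongrightarrow> X t \<omega>) (at_right t)) \<and>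
     (\<forall>t\<in>{0<..T}. \<exists>l. ((\<lambda>s. X s \<omega>) \<longlongrightarrow> l) (at_left t)))"

definition L2_continuous :: "'a measure \<Rightarrow> real \<Rightarrow> (real \<Rightarrow> 'a \<Rightarrow> real) \<Rightarrow> bool" where
  "L2_continuous M T X \<longleftrightarrow> (\<forall>t\<in>{0..T}. tendsto_L2 M X (X t) (at t within {0..T}))"

definition covariance :: "'a measure \<Rightarrow> ('a \<Rightarrow> real) \<Rightarrow> ('a \<Rightarrow> real) \<Rightarrow> real" where
  "covariance M Y Z =
     (\<integral>\<omega>. (Y \<omega> - (\<integral>\<omega>'. Y \<omega>' \<partial>M)) * (Z \<omega> - (\<integral>\<omega>'. Z \<omega>' \<partial>M)) \<partial>M)"

definition planar_increment ::
    "(real \<Rightarrow> real \<Rightarrow> real) \<Rightarrow> real \<Rightarrow> real \<Rightarrow> real \<Rightarrow> real \<Rightarrow> real" where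
  "planar_increment R a1 b1 a2 b2 = R b1 b2 + R a1 a2 - R a1 b2 - R b1 a2"

abbreviation borel_square :: "real \<Rightarrow> (real \<times> real) measure" where
  "borel_square T \<equiv> restrict_space borel ({0..T} \<times> {0..T})"

text \<open>Half-open rectangles inside \<open>[0,T]\<^sup>2\<close> do not meet the coordinate axes, so the rectangle
  condition alone leaves \<open>\<mu>\<close> undetermined there; the last condition is the normalization
  \<open>\<mu>([0,s]\<times>[0,t]) = R(s,t)\<close>.\<close>

definition has_covariance_measure ::
    "'a measure \<Rightarrow> real \<Rightarrow> (real \<Rightarrow> 'a \<Rightarrow> real) \<Rightarrow> ((real \<times> real) set \<Rightarrow> real) \<Rightarrow> bool" where
  "has_covariance_measure M T X \<mu> \<longleftrightarrow>
     signed_measure (borel_square T) \<mu> \<and>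
     (\<forall>a1 b1 a2 b2. 0 \<le> a1 \<longrightarrow> a1 \<le> b1 \<longrightarrow> b1 \<le> T \<longrightarrow> 0 \<le> a2 \<longrightarrow> a2 \<le> b2 \<longrightarrow> b2 \<le> T \<longrightarrow>
        \<mu> ({a1<..b1} \<times> {a2<..b2}) =
          planar_increment (\<lambda>s t. covariance M (X s) (X t)) a1 b1 a2 b2) \<and>
     (\<forall>s\<in>{0..T}. \<forall>t\<in>{0..T}. \<mu> ({0..s} \<times> {0..t}) = covariance M (X s) (X t))"

section \<open>Forward integral\<close>

definition extend_process :: "real \<Rightarrow> (real \<Rightarrow> 'a \<Rightarrow> real) \<Rightarrow> real \<Rightarrow> 'a \<Rightarrow> real" where
  "extend_process T X t = X (max 0 (min t T))"

definition forward_approx ::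
    "real \<Rightarrow> (real \<Rightarrow> 'a \<Rightarrow> real) \<Rightarrow> (real \<Rightarrow> real) \<Rightarrow> real \<Rightarrow> 'a \<Rightarrow> real" where
  "forward_approx T X \<phi> \<epsilon> \<omega> =
     (LINT s:{0..T}|lborel.
        \<phi> s * ((extend_process T X (s + \<epsilon>) \<omega> - extend_process T X s \<omega>) / \<epsilon>))"

text \<open>\<open>Y\<close> is a version of the forward integral of \<open>\<phi>\<close> against \<open>X\<close>, as a limit in \<open>L\<^sup>2(\<Omega>)\<close>; as
  usual for the forward integral, \<open>\<epsilon>\<close> tends to 0 through positive values.\<close>

definition has_forward_integral ::
    "'a measure \<Rightarrow> real \<Rightarrow> (real \<Rightarrow> 'a \<Rightarrow> real) \<Rightarrow> (real \<Rightarrow> real) \<Rightarrow> ('a \<Rightarrow> real) \<Rightarrow> bool" where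
  "has_forward_integral M T X \<phi> Y \<longleftrightarrow> tendsto_L2 M (forward_approx T X \<phi>) Y (at_right 0)"

section \<open>Spaces of integrands\<close>

text \<open>Functions on \<open>[0,T]\<close> are represented by total functions whose values outside \<open>[0,T]\<close> are
  ignored.\<close>

definition BV :: "real \<Rightarrow> (real \<Rightarrow> real) set" where
  "BV T = {\<phi>. \<exists>C. \<forall>n. \<forall>t :: nat \<Rightarrow> real.
     mono_on {..n} t \<and> t ` {..n} \<subseteq> {0..T} \<longrightarrow> (\<Sum>i<n. \<bar>\<phi> (t (Suc i)) - \<phi> (t i)\<bar>) \<le> C}"

definition L_mu :: "real \<Rightarrow> ((real \<times> real) set \<Rightarrow> real) \<Rightarrow> (real \<Rightarrow> real) set" where
  "L_mu T \<mu> = {\<phi> \<in> borel_measurable (restrict_space borel {0..T}).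
     (\<integral>\<^sup>+(u, v). ennreal (\<bar>\<phi> u\<bar> * \<bar>\<phi> v\<bar>) \<partial>total_variation (borel_square T) \<mu>) < \<infinity>}"

definition H_inner ::
    "real \<Rightarrow> ((real \<times> real) set \<Rightarrow> real) \<Rightarrow> (real \<Rightarrow> real) \<Rightarrow> (real \<Rightarrow> real) \<Rightarrow> real" where
  "H_inner T \<mu> \<phi> \<psi> = signed_integral (borel_square T) \<mu> (\<lambda>(u, v). \<phi> u * \<psi> v)"

definition H_norm :: "real \<Rightarrow> ((real \<times> real) set \<Rightarrow> real) \<Rightarrow> (real \<Rightarrow> real) \<Rightarrow> real" where
  "H_norm T \<mu> \<phi> = sqrt (H_inner T \<mu> \<phi> \<phi>)"

definition is_function_space :: "(real \<Rightarrow> real) set \<Rightarrow> bool" where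
  "is_function_space V \<longleftrightarrow> (\<lambda>_. 0) \<in> V \<and>
     (\<forall>\<phi>\<in>V. \<forall>\<psi>\<in>V. (\<lambda>u. \<phi> u + \<psi> u) \<in> V) \<and> (\<forall>c. \<forall>\<phi>\<in>V. (\<lambda>u. c * \<phi> u) \<in> V)"

text \<open>Linearity in the second argument follows from symmetry.\<close>

definition semiscalar_product ::
    "(real \<Rightarrow> real) set \<Rightarrow> ((real \<Rightarrow> real) \<Rightarrow> (real \<Rightarrow> real) \<Rightarrow> real) \<Rightarrow> bool" where
  "semiscalar_product V B \<longleftrightarrow>
     (\<forall>\<phi>\<in>V. \<forall>\<psi>\<in>V. B \<phi> \<psi> = B \<psi> \<phi>) \<and>
     (\<forall>\<phi>\<in>V. \<forall>\<psi>\<in>V. \<forall>\<eta>\<in>V. \<forall>a b. B (\<lambda>u. a * \<phi> u + b * \<psi> u) \<eta> = a * B \<phi> \<eta> + b * B \<psi> \<eta>) \<and>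
     (\<forall>\<phi>\<in>V. 0 \<le> B \<phi> \<phi>)"

definition L2_linear_on ::
    "'a measure \<Rightarrow> (real \<Rightarrow> real) set \<Rightarrow> ((real \<Rightarrow> real) \<Rightarrow> 'a \<Rightarrow> real) \<Rightarrow> bool" where
  "L2_linear_on M V \<Psi> \<longleftrightarrow> (\<forall>\<phi>\<in>V. \<forall>\<psi>\<in>V. \<forall>a b.
     AE \<omega> in M. \<Psi> (\<lambda>u. a * \<phi> u + b * \<psi> u) \<omega> = a * \<Psi> \<phi> \<omega> + b * \<Psi> \<psi> \<omega>)"

definition L2_continuous_on ::
    "'a measure \<Rightarrow> (real \<Rightarrow> real) set \<Rightarrow> ((real \<Rightarrow> real) \<Rightarrow> real) \<Rightarrow>
      ((real \<Rightarrow> real) \<Rightarrow> 'a \<Rightarrow> real) \<Rightarrow> bool" where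
  "L2_continuous_on M V p \<Psi> \<longleftrightarrow> (\<forall>\<phi>\<in>V. \<forall>e>0. \<exists>d>0. \<forall>\<psi>\<in>V.
     p (\<lambda>u. \<psi> u - \<phi> u) < d \<longrightarrow> L2_norm M (\<lambda>\<omega>. \<Psi> \<psi> \<omega> - \<Psi> \<phi> \<omega>) < e)"

text \<open>\<open>\<Psi>\<close> is a continuous linear extension to \<open>L\<^sub>\<mu>\<close> of the forward integral \<open>\<Phi>\<close> on \<open>BV([0,T])\<close>.  The
  third condition contains the existence of the forward integral of every \<open>\<phi> \<in> BV([0,T])\<close>.\<close>

definition continuous_extension ::
    "'a measure \<Rightarrow> real \<Rightarrow> (real \<Rightarrow> 'a \<Rightarrow> real) \<Rightarrow> ((real \<times> real) set \<Rightarrow> real) \<Rightarrow>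
      ((real \<Rightarrow> real) \<Rightarrow> 'a \<Rightarrow> real) \<Rightarrow> bool" where
  "continuous_extension M T X \<mu> \<Psi> \<longleftrightarrow>
     (\<forall>\<phi>\<in>L_mu T \<mu>. \<Psi> \<phi> \<in> L2_space M) \<and>
     L2_linear_on M (L_mu T \<mu>) \<Psi> \<and>
     (\<forall>\<phi>\<in>BV T. has_forward_integral M T X \<phi> (\<Psi> \<phi>)) \<and>
     L2_continuous_on M (L_mu T \<mu>) (H_norm T \<mu>) \<Psi>"

end

theory Submission
  imports Defs
begin

text \<open>On the span of the indicators of the intervals \<open>[0,t]\<close>, the form \<open>\<langle>\<cdot>,\<cdot>\<rangle>\<^sub>H\<close> is the \<open>L\<^sup>2(\<Omega>)\<close>
  inner product under \<open>1\<^bsub>[0,t]\<^esub> \<mapsto> X\<^sub>t\<close>, because \<open>\<mu>([0,s]\<times>[0,t]) = E(X\<^sub>s X\<^sub>t)\<close>.  This span is dense in the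
  bounded Borel functions for the \<open>L\<^sup>2\<close>-norm of the marginals of \<open>|\<mu>|\<close>, and bounded functions are dense in
  \<open>L\<^sub>\<mu>\<close> by truncation, so symmetry, positivity and the isometry pass to \<open>L\<^sub>\<mu>\<close>.  For \<open>\<phi>\<close> of bounded
  variation, Fubini identifies the \<open>\<epsilon>\<close>-approximation of the forward integral with the image under the isometry
  of the average of \<open>\<phi>\<close> over \<open>[u-\<epsilon>,u[\<close>.  That average tends to \<open>\<phi>(u-)\<close>, which differs from \<open>\<phi>(u)\<close> at countably
  many points only; and \<open>|\<mu>|\<close> does not charge the lines through them, since by \<open>L\<^sup>2\<close>-continuity the indicator
  of a point has norm 0 and the Cauchy-Schwarz inequality applies.\<close>

section \<open>Jordan decomposition of signed measures\<close>

text \<open>The obstacle is that \<open>H_inner\<close> comes without a continuity estimate of its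
  own: Cauchy-Schwarz for it presupposes the positivity that is to be proved, while |\<mu>| need not
  be positive semidefinite at all. Positivity has to be imported from second moments through an
  auxiliary norm, and only then does \<open>H_norm\<close> become usable. The isometry is handled as
  a relation between integrands and random variables (\<open>elem\<close>, then its closure
  \<open>represents\<close>), because a step function has many presentations and a random variable
  is determined only up to null sets. A forward approximation is not known beforehand to be a limit
  of combinations of the X_t; its second moment is found by testing it first against each X_t and
  then against itself. That |\<mu>| vanishes on a line is more than \<mu> vanishing there, because
  mass may cancel: all measurable subsets of the line have to be treated. Finally, the norm identity
  is claimed for every continuous extension, so that existence must be complemented by
  uniqueness.\<close>

lemma signed_measure_empty: "signed_measure N \<mu> \<Longrightarrow> \<mu> {} = 0"
  by (simp add: signed_measure_def)

lemma signed_measure_sums: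
  fixes A :: "nat \<Rightarrow> 'b set"
  shows "signed_measure N \<mu> \<Longrightarrow> (\<And>n. A n \<in> sets N) \<Longrightarrow> disjoint_family A \<Longrightarrow> (\<lambda>n. \<mu> (A n)) sums \<mu> (\<Union>n. A n)"
  by (auto simp: signed_measure_def)

lemma signed_measure_uminus: "signed_measure N \<mu> \<Longrightarrow> signed_measure N (\<lambda>A. - \<mu> A)"
  by (auto simp: signed_measure_def intro: sums_minus)

lemma signed_measure_Un:
  assumes "signed_measure N \<mu>" "A \<in> sets N" "B \<in> sets N" "A \<inter> B = {}"
  shows "\<mu> (A \<union> B) = \<mu> A + \<mu> B"
proof -
  have "(\<lambda>n. \<mu> (binaryset A B n)) sums \<mu> (\<Union>n. binaryset A B n)"
    using assms by (intro signed_measure_sums) (auto simp: binaryset_def disjoint_family_on_def)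
  then have "(\<lambda>n. \<mu> (binaryset A B n)) sums \<mu> (A \<union> B)"
    by (simp add: UN_binaryset_eq)
  moreover have "(\<lambda>n. \<mu> (binaryset A B n)) sums (\<mu> A + \<mu> B)"
    using signed_measure_empty[OF assms(1)] by (intro binaryset_sums) auto
  ultimately show ?thesis
    by (rule sums_unique2)
qed

lemma signed_measure_Diff:
  assumes "signed_measure N \<mu>" "A \<in> sets N" "B \<in> sets N" "B \<subseteq> A"
  shows "\<mu> (A - B) = \<mu> A - \<mu> B"
  using signed_measure_Un[OF assms(1), of B "A - B"] assms by (auto simp: Un_absorb1)

text \<open>Greedy exhaustion: each pick captures at least half of the best value still available,
  capped at 1; the captured values are summable, hence tend to 0, so nothing of positive value
  remains. The class \<open>\<C>\<close> is a parameter because the Hahn decomposition uses the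
  construction twice: with all measurable sets for \<mu>, and with the negative sets for
  -\<mu>.\<close>

lemma signed_measure_greedy:
  fixes \<nu> :: "'b set \<Rightarrow> real"
  assumes sm: "signed_measure N \<nu>" and \<C>: "\<C> \<subseteq> sets N" "{} \<in> \<C>"
  obtains B :: "nat \<Rightarrow> 'b set" where
    "\<And>n. B n \<in> \<C>" "\<And>n. B n \<subseteq> D" "disjoint_family B" "\<And>n. \<nu> (B n) \<ge> 0"
    "\<And>C. C \<in> \<C> \<Longrightarrow> C \<subseteq> D - (\<Union>n. B n) \<Longrightarrow> \<nu> C \<le> 0"
proof -
  \<comment> \<open>The values of \<nu> are not yet known to be bounded; the cap at 1 makes the
    supremum finite.\<close>
  have ex: "\<exists>B. B \<in> \<C> \<and> B \<subseteq> E \<and> (\<forall>C\<in>\<C>. C \<subseteq> E \<longrightarrow> min 1 (\<nu> C) \<le> 2 * \<nu> B)" for E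
  proof -
    define S where "S = (\<lambda>C. min 1 (\<nu> C)) ` {C \<in> \<C>. C \<subseteq> E}"
    have S0: "0 \<in> S" "bdd_above S"
      using \<C>(2) signed_measure_empty[OF sm] unfolding S_def
      by (auto intro!: bdd_aboveI[where M=1] rev_image_eqI[of "{}"])
    then have "0 \<le> Sup S" by (rule cSup_upper)
    show ?thesis
    proof (cases "Sup S = 0")
      case True
      then have "min 1 (\<nu> C) \<le> 0" if "C \<in> \<C>" "C \<subseteq> E" for C
        using cSup_upper[of "min 1 (\<nu> C)" S] S0(2) that by (auto simp: S_def)
      then show ?thesis
        using \<C>(2) signed_measure_empty[OF sm] by (intro exI[of _ "{}"]) auto
    next
      case False
      with \<open>0 \<le> Sup S\<close> have "Sup S / 2 < Sup S" by simp
      then obtain y where y: "y \<in> S" "Sup S / 2 < y"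
        using S0 less_cSup_iff[of S "Sup S / 2"] by auto
      then obtain B where B: "B \<in> \<C>" "B \<subseteq> E" "y = min 1 (\<nu> B)"
        by (auto simp: S_def)
      have "min 1 (\<nu> C) \<le> 2 * \<nu> B" if "C \<in> \<C>" "C \<subseteq> E" for C
      proof -
        have "min 1 (\<nu> C) \<le> Sup S"
          using that S0(2) by (intro cSup_upper) (auto simp: S_def)
        then show ?thesis using y B by linarith
      qed
      then show ?thesis using B by blast
    qed
  qed
  then obtain pick where pick: "\<And>E. pick E \<in> \<C>" "\<And>E. pick E \<subseteq> E"
      "\<And>E C. C \<in> \<C> \<Longrightarrow> C \<subseteq> E \<Longrightarrow> min 1 (\<nu> C) \<le> 2 * \<nu> (pick E)"
    by metis
  define R where "R = rec_nat D (\<lambda>_ E. E - pick E)"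
  define B where "B n = pick (R n)" for n
  have RS: "R (Suc n) = R n - B n" and R0: "R 0 = D" for n
    by (auto simp: R_def B_def)
  have dec: "R n \<subseteq> R m" if "m \<le> n" for m n
    using that by (induction n rule: dec_induct) (auto simp: RS)
  have BR: "B n \<subseteq> R n" for n by (simp add: B_def pick)
  have disj: "disjoint_family B"
    unfolding disjoint_family_on_def
  proof (intro ballI impI)
    fix m n :: nat assume "m \<noteq> n"
    have *: "B m \<inter> B n = {}" if "m < n" for m n
      using BR[of n] dec[of "Suc m" n] that RS[of m] by auto
    show "B m \<inter> B n = {}"
      using *[of m n] *[of n m] \<open>m \<noteq> n\<close> by (cases m n rule: linorder_cases) auto
  qed
  have nn: "\<nu> (B n) \<ge> 0" for n
    using pick(3)[of "{}" "R n"] \<C>(2) signed_measure_empty[OF sm] by (simp add: B_def)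
  have BC: "B n \<in> \<C>" for n by (simp add: B_def pick)
  have "(\<lambda>n. \<nu> (B n)) sums \<nu> (\<Union>n. B n)"
    using BC \<C> disj by (intro signed_measure_sums[OF sm]) auto
  \<comment> \<open>\<nu> is real valued, so the series over the disjoint picks converges and its
    terms vanish.\<close>
  then have lim: "(\<lambda>n. 2 * \<nu> (B n)) \<longlonglongrightarrow> 2 * 0"
    by (intro tendsto_mult tendsto_const summable_LIMSEQ_zero) (auto simp: sums_iff)
  have "\<nu> C \<le> 0" if C: "C \<in> \<C>" "C \<subseteq> D - (\<Union>n. B n)" for C
  proof -
    have "C \<subseteq> R n" for n
    proof (induction n)
      case 0
      then show ?case using C by (auto simp: R0)
    next
      case (Suc n)
      then show ?case using C by (auto simp: RS)
    qed
    then have "min 1 (\<nu> C) \<le> 2 * \<nu> (B n)" for n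
      using pick(3) C by (auto simp: B_def)
    then have "min 1 (\<nu> C) \<le> 0"
      using LIMSEQ_le_const[OF lim, of "min 1 (\<nu> C)"] by auto
    then show ?thesis by linarith
  qed
  moreover have "B n \<subseteq> D" for n
    using BR[of n] dec[of 0 n] by (auto simp: R0)
  ultimately show ?thesis
    using that BC disj nn by blast
qed

text \<open>Greedily remove from \<open>D\<close> pieces of nonnegative value: what is left has no
  subset of positive value, and its own value can only have dropped.\<close>

lemma signed_measure_negative_subset:
  assumes sm: "signed_measure N \<mu>" and D: "D \<in> sets N"
  obtains A where "A \<in> sets N" "A \<subseteq> D" "\<mu> A \<le> \<mu> D" "\<And>B. B \<in> sets N \<Longrightarrow> B \<subseteq> A \<Longrightarrow> \<mu> B \<le> 0"
proof -
  obtain B :: "nat \<Rightarrow> 'a set" where B: "\<And>n. B n \<in> sets N" "\<And>n. B n \<subseteq> D" "disjoint_family B"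
    "\<And>n. \<mu> (B n) \<ge> 0" "\<And>C. C \<in> sets N \<Longrightarrow> C \<subseteq> D - (\<Union>n. B n) \<Longrightarrow> \<mu> C \<le> 0"
    using signed_measure_greedy[OF sm, of "sets N" D] by auto
  have s: "(\<lambda>n. \<mu> (B n)) sums \<mu> (\<Union>n. B n)"
    using B by (intro signed_measure_sums[OF sm]) auto
  then have "0 \<le> \<mu> (\<Union>n. B n)"
    using B(4) by (metis sums_iff suminf_nonneg)
  moreover have "\<mu> (D - (\<Union>n. B n)) = \<mu> D - \<mu> (\<Union>n. B n)"
    using B D by (intro signed_measure_Diff[OF sm]) auto
  ultimately show ?thesis
    using B D by (intro that[of "D - (\<Union>n. B n)"]) auto
qed

text \<open>\<open>P\<close> is the complement of a greedily exhausted sequence of negative sets. A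
  subset of \<open>P\<close> with negative value would contain a negative set with at most that
  value, which the exhaustion rules out.\<close>

theorem Hahn_decomposition_signed_measure:
  assumes sm: "signed_measure N \<mu>"
  obtains P where "P \<in> sets N" "\<And>A. A \<in> sets N \<Longrightarrow> A \<subseteq> P \<Longrightarrow> \<mu> A \<ge> 0"
    "\<And>A. A \<in> sets N \<Longrightarrow> A \<inter> P = {} \<Longrightarrow> \<mu> A \<le> 0"
proof -
  define \<C> where "\<C> = {A \<in> sets N. \<forall>B\<in>sets N. B \<subseteq> A \<longrightarrow> \<mu> B \<le> 0}"
  have "{} \<in> \<C>"
    using signed_measure_empty[OF sm] by (auto simp: \<C>_def)
  then obtain B :: "nat \<Rightarrow> 'a set" where B: "\<And>n. B n \<in> \<C>" "\<And>n. B n \<subseteq> space N" "disjoint_family B"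
    "\<And>C. C \<in> \<C> \<Longrightarrow> C \<subseteq> space N - (\<Union>n. B n) \<Longrightarrow> - \<mu> C \<le> 0"
    using signed_measure_greedy[OF signed_measure_uminus[OF sm], of \<C> "space N"]
    by (metis (no_types, lifting) \<C>_def mem_Collect_eq subsetI)
  have BN: "B n \<in> sets N" for n using B(1) by (auto simp: \<C>_def)
  define P where "P = space N - (\<Union>n. B n)"
  show ?thesis
  proof (rule that[of P])
    show "P \<in> sets N" using BN by (auto simp: P_def)
    fix A assume A: "A \<in> sets N"
    show "\<mu> A \<ge> 0" if "A \<subseteq> P"
    proof -
      obtain A' where A': "A' \<in> sets N" "A' \<subseteq> A" "\<mu> A' \<le> \<mu> A"
          "\<And>B. B \<in> sets N \<Longrightarrow> B \<subseteq> A' \<Longrightarrow> \<mu> B \<le> 0"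
        using signed_measure_negative_subset[OF sm A] by blast
      then have "A' \<in> \<C>" by (auto simp: \<C>_def)
      moreover have "A' \<subseteq> space N - (\<Union>n. B n)" using A'(2) that by (auto simp: P_def)
      ultimately have "- \<mu> A' \<le> 0" by (rule B(4))
      then show ?thesis using A'(3) by linarith
    qed
    show "\<mu> A \<le> 0" if "A \<inter> P = {}"
    proof -
      have "A \<subseteq> (\<Union>n. B n)" using that sets.sets_into_space[OF A] by (auto simp: P_def)
      then have "(\<Union>n. A \<inter> B n) = A" by auto
      moreover have "disjoint_family (\<lambda>n. A \<inter> B n)"
        using B(3) unfolding disjoint_family_on_def by blast
      ultimately have "(\<lambda>n. \<mu> (A \<inter> B n)) sums \<mu> A"
        using signed_measure_sums[OF sm, of "\<lambda>n. A \<inter> B n"] A BN by auto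
      moreover have "\<mu> (A \<inter> B n) \<le> 0" for n
        using B(1)[of n] A BN[of n] by (auto simp: \<C>_def)
      ultimately show ?thesis
        using sums_le[OF _ _ sums_zero, of "\<lambda>n. \<mu> (A \<inter> B n)" "\<mu> A"] by blast
    qed
  qed
qed

section \<open>Variation measures computed from a Hahn set\<close>

lemma sets_pos_variation [simp, measurable_cong]: "sets (pos_variation N \<mu>) = sets N"
  by (simp add: pos_variation_def)

lemma space_pos_variation [simp]: "space (pos_variation N \<mu>) = space N"
  by (simp add: pos_variation_def)

lemma sets_neg_variation [simp, measurable_cong]: "sets (neg_variation N \<mu>) = sets N"
  by (simp add: neg_variation_def)

lemma space_neg_variation [simp]: "space (neg_variation N \<mu>) = space N"
  by (simp add: neg_variation_def)

lemma sets_total_variation [simp, measurable_cong]: "sets (total_variation N \<mu>) = sets N"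
  by (simp add: total_variation_def)

lemma space_total_variation [simp]: "space (total_variation N \<mu>) = space N"
  by (simp add: total_variation_def)

text \<open>The supremum is attained at \<open>A \<inter> P\<close>: discarding \<open>B - P\<close>
  from a candidate \<open>B\<close> and adding the rest of \<open>A \<inter> P\<close> never
  decreases \<mu>. Countable additivity of the supremum follows; it has to be proved, since
  \<open>measure_of\<close> assigns zero everywhere when the set function is not a measure.\<close>

lemma pos_variation_Hahn:
  assumes sm: "signed_measure N \<mu>" and P: "P \<in> sets N"
    "\<And>A. A \<in> sets N \<Longrightarrow> A \<subseteq> P \<Longrightarrow> \<mu> A \<ge> 0" "\<And>A. A \<in> sets N \<Longrightarrow> A \<inter> P = {} \<Longrightarrow> \<mu> A \<le> 0"
    and A: "A \<in> sets N"
  shows "emeasure (pos_variation N \<mu>) A = ennreal (\<mu> (A \<inter> P))"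
proof -
  have SUP_eq: "(SUP B\<in>{B \<in> sets N. B \<subseteq> A}. ennreal (\<mu> B)) = ennreal (\<mu> (A \<inter> P))"
    if A: "A \<in> sets N" for A
  proof (rule antisym)
    have "\<mu> B \<le> \<mu> (A \<inter> P)" if B: "B \<in> sets N" "B \<subseteq> A" for B
    proof -
      have "\<mu> B = \<mu> (B \<inter> P) + \<mu> (B - P)"
        using signed_measure_Un[OF sm, of "B \<inter> P" "B - P"] B P(1) by (auto simp: Int_Diff_Un)
      moreover have "\<mu> (B - P) \<le> 0" using B P(1) by (intro P(3)) auto
      moreover have "\<mu> (A \<inter> P - B \<inter> P) = \<mu> (A \<inter> P) - \<mu> (B \<inter> P)"
        using B P(1) A by (intro signed_measure_Diff[OF sm]) auto
      moreover have "0 \<le> \<mu> (A \<inter> P - B \<inter> P)" using A B P(1) by (intro P(2)) auto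
      ultimately show ?thesis by linarith
    qed
    then show "(SUP B\<in>{B \<in> sets N. B \<subseteq> A}. ennreal (\<mu> B)) \<le> ennreal (\<mu> (A \<inter> P))"
      by (intro SUP_least) (auto intro: ennreal_leI)
    show "ennreal (\<mu> (A \<inter> P)) \<le> (SUP B\<in>{B \<in> sets N. B \<subseteq> A}. ennreal (\<mu> B))"
      using A P by (intro SUP_upper) auto
  qed
  define f where "f = (\<lambda>A. SUP B\<in>{B \<in> sets N. B \<subseteq> A}. ennreal (\<mu> B))"
  have "emeasure (measure_of (space N) (sets N) f) A = f A"
  proof (rule emeasure_measure_of_sigma)
    show "sigma_algebra (space N) (sets N)" ..
    show "positive (sets N) f"
      using SUP_eq[of "{}"] signed_measure_empty[OF sm] by (simp add: positive_def f_def)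
    show "countably_additive (sets N) f"
    proof (rule countably_additiveI)
      fix F :: "nat \<Rightarrow> 'a set" assume F: "range F \<subseteq> sets N" "disjoint_family F" "\<Union> (range F) \<in> sets N"
      have eq: "(\<Union>n. F n \<inter> P) = \<Union> (range F) \<inter> P" by auto
      have "(\<lambda>n. \<mu> (F n \<inter> P)) sums \<mu> (\<Union> (range F) \<inter> P)"
        using signed_measure_sums[OF sm, of "\<lambda>n. F n \<inter> P"] F P(1)
        by (auto simp: disjoint_family_on_def eq)
      moreover have "0 \<le> \<mu> (F n \<inter> P)" for n using F P by (intro P(2)) auto
      ultimately have "(\<Sum>i. ennreal (\<mu> (F i \<inter> P))) = ennreal (\<mu> (\<Union> (range F) \<inter> P))"
        by (intro suminf_ennreal_eq)
      moreover have "f (F i) = ennreal (\<mu> (F i \<inter> P))" for i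
        unfolding f_def using F by (intro SUP_eq) auto
      moreover have "f (\<Union> (range F)) = ennreal (\<mu> (\<Union> (range F) \<inter> P))"
        unfolding f_def using F by (intro SUP_eq) auto
      ultimately show "(\<Sum>i. f (F i)) = f (\<Union> (range F))"
        by simp
    qed
  qed (rule A)
  then show "emeasure (pos_variation N \<mu>) A = ennreal (\<mu> (A \<inter> P))"
    using SUP_eq[OF A] by (simp add: pos_variation_def flip: f_def) (simp add: f_def)
qed

text \<open>\<open>space N - P\<close> is a Hahn set for -\<mu>.\<close>

lemma neg_variation_Hahn:
  assumes sm: "signed_measure N \<mu>" and P: "P \<in> sets N"
    "\<And>A. A \<in> sets N \<Longrightarrow> A \<subseteq> P \<Longrightarrow> \<mu> A \<ge> 0" "\<And>A. A \<in> sets N \<Longrightarrow> A \<inter> P = {} \<Longrightarrow> \<mu> A \<le> 0"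
    and A: "A \<in> sets N"
  shows "emeasure (neg_variation N \<mu>) A = ennreal (- \<mu> (A - P))"
proof -
  have *: "A \<inter> (space N - P) = A - P" if "A \<in> sets N" for A
    using sets.sets_into_space[OF that] by auto
  have "\<mu> B \<le> 0" if "B \<in> sets N" "B \<subseteq> space N - P" for B
    using that by (intro P(3)) auto
  moreover have "\<mu> B \<ge> 0" if "B \<in> sets N" "B \<inter> (space N - P) = {}" for B
    using that *[of B] by (intro P(2)) auto
  ultimately show ?thesis
    unfolding neg_variation_def
    using pos_variation_Hahn[OF signed_measure_uminus[OF sm], of "space N - P" A] P(1) A
    by (simp add: *)
qed

lemma emeasure_total_variation:
  assumes "A \<in> sets N"
  shows "emeasure (total_variation N \<mu>) A = emeasure (pos_variation N \<mu>) A + emeasure (neg_variation N \<mu>) A"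
  unfolding total_variation_def
proof (rule emeasure_measure_of_sigma)
  show "sigma_algebra (space N) (sets N)" ..
  show "countably_additive (sets N) (\<lambda>A. emeasure (pos_variation N \<mu>) A + emeasure (neg_variation N \<mu>) A)"
  proof (rule countably_additiveI)
    fix F :: "nat \<Rightarrow> 'a set" assume F: "range F \<subseteq> sets N" "disjoint_family F"
    then show "(\<Sum>i. emeasure (pos_variation N \<mu>) (F i) + emeasure (neg_variation N \<mu>) (F i)) =
        emeasure (pos_variation N \<mu>) (\<Union> (range F)) + emeasure (neg_variation N \<mu>) (\<Union> (range F))"
      by (subst suminf_add[symmetric]) (auto simp: suminf_emeasure)
  qed
qed (auto simp: positive_def assms)

text \<open>Finiteness holds because the variations are given by \<open>ennreal\<close> of real
  values of \<mu> on the Hahn set and its complement.\<close>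

lemma
  assumes sm: "signed_measure N \<mu>"
  shows finite_pos_variation: "finite_measure (pos_variation N \<mu>)"
    and finite_neg_variation: "finite_measure (neg_variation N \<mu>)"
    and finite_total_variation: "finite_measure (total_variation N \<mu>)"
    and Jordan_decomposition:
      "A \<in> sets N \<Longrightarrow> \<mu> A = measure (pos_variation N \<mu>) A - measure (neg_variation N \<mu>) A"
proof -
  obtain P where P: "P \<in> sets N" "\<And>A. A \<in> sets N \<Longrightarrow> A \<subseteq> P \<Longrightarrow> \<mu> A \<ge> 0"
    "\<And>A. A \<in> sets N \<Longrightarrow> A \<inter> P = {} \<Longrightarrow> \<mu> A \<le> 0"
    using Hahn_decomposition_signed_measure[OF sm] by blast
  note H = pos_variation_Hahn[OF sm P] neg_variation_Hahn[OF sm P]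
  show "finite_measure (pos_variation N \<mu>)"
    by (rule finite_measureI) (simp add: H)
  show "finite_measure (neg_variation N \<mu>)"
    by (rule finite_measureI) (simp add: H)
  show "finite_measure (total_variation N \<mu>)"
    by (rule finite_measureI) (simp add: H emeasure_total_variation)
  show "\<mu> A = measure (pos_variation N \<mu>) A - measure (neg_variation N \<mu>) A" if A: "A \<in> sets N"
  proof -
    have "\<mu> A = \<mu> (A \<inter> P) + \<mu> (A - P)"
      using signed_measure_Un[OF sm, of "A \<inter> P" "A - P"] A P(1) by (auto simp: Int_Diff_Un)
    moreover have "0 \<le> \<mu> (A \<inter> P)" "\<mu> (A - P) \<le> 0"
      using A P(1) by (auto intro!: P(2,3))
    ultimately show ?thesis
      by (simp add: measure_def H A)
  qed
qed

text \<open>\<open>\<mu> A = 0\<close> alone would not do, because positive and negative mass may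
  cancel inside \<open>A\<close>; the hypothesis is applied to \<open>A \<inter> P\<close> and
  \<open>A - P\<close> for a Hahn set \<open>P\<close>.\<close>

lemma total_variation_null_setI:
  assumes A: "A \<in> sets N" and null: "\<And>B. B \<in> sets N \<Longrightarrow> B \<subseteq> A \<Longrightarrow> \<mu> B = 0"
    and sm: "signed_measure N \<mu>"
  shows "A \<in> null_sets (total_variation N \<mu>)"
proof -
  obtain P where P: "P \<in> sets N" "\<And>A. A \<in> sets N \<Longrightarrow> A \<subseteq> P \<Longrightarrow> \<mu> A \<ge> 0"
    "\<And>A. A \<in> sets N \<Longrightarrow> A \<inter> P = {} \<Longrightarrow> \<mu> A \<le> 0"
    using Hahn_decomposition_signed_measure[OF sm] by blast
  show ?thesis
    using A null[of "A \<inter> P"] null[of "A - P"] P(1)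
    by (auto simp: null_sets_def emeasure_total_variation pos_variation_Hahn[OF sm P] neg_variation_Hahn[OF sm P])
qed

section \<open>Integration against a signed measure\<close>

lemma nn_integral_total_variation:
  assumes f: "f \<in> borel_measurable N"
  shows "(\<integral>\<^sup>+x. f x \<partial>total_variation N \<mu>) = (\<integral>\<^sup>+x. f x \<partial>pos_variation N \<mu>) + (\<integral>\<^sup>+x. f x \<partial>neg_variation N \<mu>)"
  using f
proof (induction rule: borel_measurable_induct)
  case (cong f g)
  then show ?case
    by (simp cong: nn_integral_cong_simp)
next
  case (set A)
  then show ?case by (simp add: emeasure_total_variation)
next
  case (mult u c)
  then show ?case by (simp add: nn_integral_cmult distrib_left)
next
  case (add u v)
  then show ?case by (simp add: nn_integral_add add_ac)
next
  case (seq U)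
  have inc: "incseq (\<lambda>i. \<integral>\<^sup>+x. U i x \<partial>K)" for K
    using seq(3) by (auto simp: incseq_def le_fun_def intro!: nn_integral_mono)
  have *: "(\<integral>\<^sup>+x. (SUP i. U i) x \<partial>K) = (SUP i. \<integral>\<^sup>+x. U i x \<partial>K)" if "sets K = sets N" for K
    using seq(1,3) that unfolding SUP_apply
    by (intro nn_integral_monotone_convergence_SUP) (auto cong: measurable_cong_sets)
  have "(\<integral>\<^sup>+x. (SUP i. U i) x \<partial>total_variation N \<mu>) =
      (SUP i. (\<integral>\<^sup>+x. U i x \<partial>pos_variation N \<mu>) + (\<integral>\<^sup>+x. U i x \<partial>neg_variation N \<mu>))"
    unfolding *[OF sets_total_variation] by (intro SUP_cong refl seq.IH)
  also have "\<dots> = (\<integral>\<^sup>+x. (SUP i. U i) x \<partial>pos_variation N \<mu>) + (\<integral>\<^sup>+x. (SUP i. U i) x \<partial>neg_variation N \<mu>)"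
    unfolding *[OF sets_pos_variation] *[OF sets_neg_variation] ennreal_SUP_add[OF inc inc] ..
  finally show ?case .
qed

lemma
  assumes "integrable (total_variation N \<mu>) (f :: _ \<Rightarrow> real)"
  shows integrable_pos_variation: "integrable (pos_variation N \<mu>) f"
    and integrable_neg_variation: "integrable (neg_variation N \<mu>) f"
    and abs_signed_integral_le: "\<bar>signed_integral N \<mu> f\<bar> \<le> (\<integral>x. \<bar>f x\<bar> \<partial>total_variation N \<mu>)"
proof -
  have m: "f \<in> borel_measurable N"
    using borel_measurable_integrable[OF assms] by (simp cong: measurable_cong_sets)
  have *: "integrable (pos_variation N \<mu>) f \<and> integrable (neg_variation N \<mu>) f"
    if "integrable (total_variation N \<mu>) f" "f \<in> borel_measurable N" for f :: "_ \<Rightarrow> real"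
    using that by (auto simp: integrable_iff_bounded nn_integral_total_variation cong: measurable_cong_sets)
  show i: "integrable (pos_variation N \<mu>) f" "integrable (neg_variation N \<mu>) f"
    using *[OF assms m] by auto
  have nn: "(\<integral>x. f x \<partial>total_variation N \<mu>) = (\<integral>x. f x \<partial>pos_variation N \<mu>) + (\<integral>x. f x \<partial>neg_variation N \<mu>)"
    if "integrable (total_variation N \<mu>) f" "f \<in> borel_measurable N" "\<And>x. 0 \<le> f x" for f :: "_ \<Rightarrow> real"
  proof -
    have "ennreal (\<integral>x. f x \<partial>total_variation N \<mu>) = ennreal ((\<integral>x. f x \<partial>pos_variation N \<mu>) + (\<integral>x. f x \<partial>neg_variation N \<mu>))"
      using that *[OF that(1,2)]
      by (simp add: nn_integral_eq_integral[symmetric] nn_integral_total_variation)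
    then show ?thesis
      using that(3) by (subst (asm) ennreal_inj) (auto intro!: add_nonneg_nonneg)
  qed
  have "\<bar>signed_integral N \<mu> f\<bar> \<le> (\<integral>x. \<bar>f x\<bar> \<partial>pos_variation N \<mu>) + (\<integral>x. \<bar>f x\<bar> \<partial>neg_variation N \<mu>)"
    unfolding signed_integral_def
    using integral_abs_bound[of "pos_variation N \<mu>" f] integral_abs_bound[of "neg_variation N \<mu>" f] by linarith
  also have "\<dots> = (\<integral>x. \<bar>f x\<bar> \<partial>total_variation N \<mu>)"
    using nn[OF integrable_abs[OF assms] borel_measurable_abs[OF m]] by linarith
  finally show "\<bar>signed_integral N \<mu> f\<bar> \<le> (\<integral>x. \<bar>f x\<bar> \<partial>total_variation N \<mu>)" .
qed

lemma signed_integral_linear: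
  assumes "integrable (total_variation N \<mu>) f" "integrable (total_variation N \<mu>) g"
  shows "signed_integral N \<mu> (\<lambda>x. a * f x + b * g x) = a * signed_integral N \<mu> f + b * signed_integral N \<mu> g"
proof -
  note i = integrable_pos_variation[OF assms(1)] integrable_pos_variation[OF assms(2)]
    integrable_neg_variation[OF assms(1)] integrable_neg_variation[OF assms(2)]
  show ?thesis
    unfolding signed_integral_def using i by (simp add: right_diff_distrib)
qed

lemma signed_integral_indicator:
  assumes "signed_measure N \<mu>" "A \<in> sets N"
  shows "signed_integral N \<mu> (indicator A) = \<mu> A"
  using assms Jordan_decomposition[OF assms] sets.sets_into_space[OF assms(2)] by (simp add: signed_integral_def Int_absorb2)

lemma AE_pos_neg_variation:
  assumes "AE x in total_variation N \<mu>. Q x"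
  shows "AE x in pos_variation N \<mu>. Q x" "AE x in neg_variation N \<mu>. Q x"
proof -
  obtain C where "{x \<in> space N. \<not> Q x} \<subseteq> C" "emeasure (total_variation N \<mu>) C = 0" "C \<in> sets N"
    using AE_E[OF assms] unfolding space_total_variation sets_total_variation .
  note C = this
  then have null: "emeasure (pos_variation N \<mu>) C = 0" "emeasure (neg_variation N \<mu>) C = 0"
    by (simp_all add: emeasure_total_variation)
  show "AE x in pos_variation N \<mu>. Q x"
    by (rule AE_I[OF _ null(1)]) (simp_all add: C(1,3))
  show "AE x in neg_variation N \<mu>. Q x"
    by (rule AE_I[OF _ null(2)]) (simp_all add: C(1,3))
qed

lemma signed_integral_tendsto:
  assumes "\<And>i. s i \<in> borel_measurable N" "f \<in> borel_measurable N"
    and w: "integrable (total_variation N \<mu>) w"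
    and lim: "AE x in total_variation N \<mu>. (\<lambda>i. s i x) \<longlonglongrightarrow> f x"
    and bound: "\<And>i. AE x in total_variation N \<mu>. \<bar>s i x\<bar> \<le> w x"
  shows "(\<lambda>i. signed_integral N \<mu> (s i)) \<longlonglongrightarrow> signed_integral N \<mu> f"
  unfolding signed_integral_def
proof (rule tendsto_diff)
  have *: "g \<in> borel_measurable (pos_variation N \<mu>)" "g \<in> borel_measurable (neg_variation N \<mu>)"
    if "g \<in> borel_measurable N" for g :: "_ \<Rightarrow> real"
    using that by (simp_all cong: measurable_cong_sets)
  show "(\<lambda>i. \<integral>x. s i x \<partial>pos_variation N \<mu>) \<longlonglongrightarrow> (\<integral>x. f x \<partial>pos_variation N \<mu>)"
    by (rule integral_dominated_convergence[OF *(1)[OF assms(2)] *(1)[OF assms(1)] integrable_pos_variation[OF w]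
          AE_pos_neg_variation(1)[OF lim]]) (unfold real_norm_def, rule AE_pos_neg_variation(1)[OF bound])
  show "(\<lambda>i. \<integral>x. s i x \<partial>neg_variation N \<mu>) \<longlonglongrightarrow> (\<integral>x. f x \<partial>neg_variation N \<mu>)"
    by (rule integral_dominated_convergence[OF *(2)[OF assms(2)] *(2)[OF assms(1)] integrable_neg_variation[OF w]
          AE_pos_neg_variation(2)[OF lim]]) (unfold real_norm_def, rule AE_pos_neg_variation(2)[OF bound])
qed

section \<open>Square integrable random variables\<close>

text \<open>Stated for bare coefficients so as to serve both \<open>L2_norm\<close> and
  \<open>H_norm\<close>: with \<open>a\<close> = <f,f>, \<open>b\<close> = <f,g> and
  \<open>c\<close> = <g,g>, the assumption says that <f + x g, f + x g> is nonnegative.\<close>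

lemma semidefinite_form:
  fixes a b c :: real
  assumes pos: "\<And>x. 0 \<le> a + 2 * x * b + x\<^sup>2 * c" and c: "0 \<le> c"
  shows semidefinite_Cauchy_Schwarz: "b\<^sup>2 \<le> a * c"
    and semidefinite_triangle: "sqrt (a + 2 * b + c) \<le> sqrt a + sqrt c"
proof -
  have a: "0 \<le> a" using pos[of 0] by simp
  show CS: "b\<^sup>2 \<le> a * c"
  proof (cases "c = 0")
    case True
    have "b = 0"
    proof (rule ccontr)
      assume "b \<noteq> 0"
      \<comment> \<open>With \<open>c = 0\<close> the form is affine in its variable; at this point
        it equals -1.\<close>
      define x where "x = - (a + 1) / (2 * b)"
      have "x * b = - (a + 1) / 2"
        using \<open>b \<noteq> 0\<close> by (simp add: x_def)
      then show False
        using pos[of x] True by simp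
    qed
    then show ?thesis using True by simp
  next
    case False
    then have "0 < c" using c by simp
    \<comment> \<open>\<open>- b / c\<close> minimises the quadratic.\<close>
    then have "0 \<le> (a + 2 * (- b / c) * b + (- b / c)\<^sup>2 * c) * c"
      by (intro mult_nonneg_nonneg pos less_imp_le)
    also have "\<dots> = a * c - b\<^sup>2"
      using \<open>0 < c\<close> by (simp add: field_simps power2_eq_square)
    finally show ?thesis by simp
  qed
  have "b \<le> sqrt (a * c)"
    using CS by (simp add: real_le_rsqrt)
  then have "a + 2 * b + c \<le> (sqrt a + sqrt c)\<^sup>2"
    using a c by (simp add: power2_sum real_sqrt_mult)
  then show "sqrt (a + 2 * b + c) \<le> sqrt a + sqrt c"
    using a c by (intro real_le_lsqrt) auto
qed

lemma L2_spaceD: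
  assumes "Y \<in> L2_space M"
  shows "Y \<in> borel_measurable M" "integrable M (\<lambda>\<omega>. (Y \<omega>)\<^sup>2)"
  using assms by (auto simp: L2_space_def)

lemma integrable_mult_L2:
  assumes "Y \<in> L2_space M" "Z \<in> L2_space M"
  shows "integrable M (\<lambda>\<omega>. Y \<omega> * Z \<omega>)"
proof (rule Bochner_Integration.integrable_bound)
  show "integrable M (\<lambda>\<omega>. (Y \<omega>)\<^sup>2 + (Z \<omega>)\<^sup>2)"
    using assms by (intro Bochner_Integration.integrable_add L2_spaceD)
  show "(\<lambda>\<omega>. Y \<omega> * Z \<omega>) \<in> borel_measurable M"
    using assms by (intro borel_measurable_times L2_spaceD)
  have "\<bar>y * z\<bar> \<le> y\<^sup>2 + z\<^sup>2" for y z :: real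
    using sum_squares_bound[of "\<bar>y\<bar>" "\<bar>z\<bar>"] zero_le_power2[of y] zero_le_power2[of z]
    unfolding abs_mult power2_abs by linarith
  then show "AE \<omega> in M. norm (Y \<omega> * Z \<omega>) \<le> norm ((Y \<omega>)\<^sup>2 + (Z \<omega>)\<^sup>2)"
    by auto
qed

lemma L2_space_linear:
  assumes "Y \<in> L2_space M" "Z \<in> L2_space M"
  shows "(\<lambda>\<omega>. a * Y \<omega> + b * Z \<omega>) \<in> L2_space M"
proof -
  have "(a * Y \<omega> + b * Z \<omega>)\<^sup>2 = a\<^sup>2 * (Y \<omega>)\<^sup>2 + 2 * a * b * (Y \<omega> * Z \<omega>) + b\<^sup>2 * (Z \<omega>)\<^sup>2" for \<omega>
    by (simp add: power2_eq_square algebra_simps)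
  then show ?thesis
    using assms L2_spaceD[OF assms(1)] L2_spaceD[OF assms(2)] integrable_mult_L2[OF assms]
    by (simp add: L2_space_def)
qed

lemma L2_space_diff: "Y \<in> L2_space M \<Longrightarrow> Z \<in> L2_space M \<Longrightarrow> (\<lambda>\<omega>. Y \<omega> - Z \<omega>) \<in> L2_space M"
  using L2_space_linear[of Y M Z 1 "-1"] by simp

lemma integral_linear_square:
  assumes "Y \<in> L2_space M" "Z \<in> L2_space M"
  shows "(\<integral>\<omega>. (Y \<omega> + x * Z \<omega>)\<^sup>2 \<partial>M) =
    (\<integral>\<omega>. (Y \<omega>)\<^sup>2 \<partial>M) + 2 * x * (\<integral>\<omega>. Y \<omega> * Z \<omega> \<partial>M) + x\<^sup>2 * (\<integral>\<omega>. (Z \<omega>)\<^sup>2 \<partial>M)"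
proof -
  have "(Y \<omega> + x * Z \<omega>)\<^sup>2 = (Y \<omega>)\<^sup>2 + 2 * x * (Y \<omega> * Z \<omega>) + x\<^sup>2 * (Z \<omega>)\<^sup>2" for \<omega>
    by (simp add: power2_eq_square algebra_simps)
  then show ?thesis
    using L2_spaceD[OF assms(1)] L2_spaceD[OF assms(2)] integrable_mult_L2[OF assms] by simp
qed

lemma L2_norm_power2: "(L2_norm M Y)\<^sup>2 = (\<integral>\<omega>. (Y \<omega>)\<^sup>2 \<partial>M)"
  by (simp add: L2_norm_def)

lemma L2_norm_nonneg [simp]: "0 \<le> L2_norm M Y"
  by (simp add: L2_norm_def)

lemma L2_norm_minus_commute: "L2_norm M (\<lambda>\<omega>. Y \<omega> - Z \<omega>) = L2_norm M (\<lambda>\<omega>. Z \<omega> - Y \<omega>)"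
  by (simp add: L2_norm_def power2_commute)

lemma
  assumes "Y \<in> L2_space M" "Z \<in> L2_space M"
  shows L2_Cauchy_Schwarz: "\<bar>\<integral>\<omega>. Y \<omega> * Z \<omega> \<partial>M\<bar> \<le> L2_norm M Y * L2_norm M Z"
    and L2_norm_triangle: "L2_norm M (\<lambda>\<omega>. Y \<omega> + Z \<omega>) \<le> L2_norm M Y + L2_norm M Z"
proof -
  have "0 \<le> (\<integral>\<omega>. (Y \<omega>)\<^sup>2 \<partial>M) + 2 * x * (\<integral>\<omega>. Y \<omega> * Z \<omega> \<partial>M) + x\<^sup>2 * (\<integral>\<omega>. (Z \<omega>)\<^sup>2 \<partial>M)" for x
    unfolding integral_linear_square[OF assms, symmetric] by simp
  note * = semidefinite_form[OF this]
  have "(\<integral>\<omega>. Y \<omega> * Z \<omega> \<partial>M)\<^sup>2 \<le> (L2_norm M Y * L2_norm M Z)\<^sup>2"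
    using *(1) by (simp add: power_mult_distrib L2_norm_power2)
  then show "\<bar>\<integral>\<omega>. Y \<omega> * Z \<omega> \<partial>M\<bar> \<le> L2_norm M Y * L2_norm M Z"
    by (simp add: abs_le_square_iff[symmetric] abs_mult)
  show "L2_norm M (\<lambda>\<omega>. Y \<omega> + Z \<omega>) \<le> L2_norm M Y + L2_norm M Z"
    using *(2) integral_linear_square[OF assms, of 1] by (simp add: L2_norm_def)
qed

lemma L2_norm_triangle_diff:
  assumes "Y \<in> L2_space M" "Z \<in> L2_space M" "W \<in> L2_space M"
  shows "L2_norm M (\<lambda>\<omega>. Y \<omega> - W \<omega>) \<le> L2_norm M (\<lambda>\<omega>. Y \<omega> - Z \<omega>) + L2_norm M (\<lambda>\<omega>. Z \<omega> - W \<omega>)"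
  using L2_norm_triangle[of "\<lambda>\<omega>. Y \<omega> - Z \<omega>" M "\<lambda>\<omega>. Z \<omega> - W \<omega>"] assms by (simp add: L2_space_diff)

lemma L2_norm_diff_le:
  assumes "Y \<in> L2_space M" "Z \<in> L2_space M"
  shows "\<bar>L2_norm M Y - L2_norm M Z\<bar> \<le> L2_norm M (\<lambda>\<omega>. Y \<omega> - Z \<omega>)"
  using L2_norm_triangle[of "\<lambda>\<omega>. Y \<omega> - Z \<omega>" M Z] L2_norm_triangle[of "\<lambda>\<omega>. Z \<omega> - Y \<omega>" M Y] assms
    L2_norm_minus_commute[of M Y Z] by (simp add: L2_space_diff)

lemma AE_eq_if_L2_norm_0:
  assumes "Y \<in> L2_space M" "Z \<in> L2_space M" "L2_norm M (\<lambda>\<omega>. Y \<omega> - Z \<omega>) = 0"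
  shows "AE \<omega> in M. Y \<omega> = Z \<omega>"
proof -
  have "(\<integral>\<omega>. (Y \<omega> - Z \<omega>)\<^sup>2 \<partial>M) = 0"
    using assms(3) by (simp add: L2_norm_def)
  then have "AE \<omega> in M. (Y \<omega> - Z \<omega>)\<^sup>2 = 0"
    using integral_nonneg_eq_0_iff_AE[OF L2_spaceD(2)[OF L2_space_diff[OF assms(1,2)]]] by simp
  then show ?thesis by eventually_elim simp
qed

lemma (in prob_space) L2_space_const: "(\<lambda>_. c) \<in> L2_space M"
  by (simp add: L2_space_def)

lemma (in prob_space) integrable_L2: "Y \<in> L2_space M \<Longrightarrow> integrable M Y"
  using integrable_mult_L2[of Y M "\<lambda>_. 1"] by (simp add: L2_space_const)

lemma (in prob_space) expectation_abs_le_L2_norm: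
  assumes "Y \<in> L2_space M"
  shows "expectation (\<lambda>\<omega>. \<bar>Y \<omega>\<bar>) \<le> L2_norm M Y"
proof -
  have "(\<lambda>\<omega>. \<bar>Y \<omega>\<bar>) \<in> L2_space M"
    using assms by (auto simp: L2_space_def intro: borel_measurable_abs)
  from L2_Cauchy_Schwarz[OF this L2_space_const[of 1]] show ?thesis
    by (simp add: L2_norm_def prob_space)
qed

text \<open>On a probability space the L2 norm dominates the L1 norm, so a subsequence converges
  almost everywhere. Fatou's lemma along that subsequence transfers the Cauchy estimate to the
  limit, which gives both its membership in L2 and the convergence of the whole sequence.\<close>

theorem (in prob_space) L2_complete:
  assumes Z: "\<And>n. Z n \<in> L2_space M"
    and Cauchy: "\<And>e. e > 0 \<Longrightarrow> \<exists>N. \<forall>i\<ge>N. \<forall>j\<ge>N. L2_norm M (\<lambda>\<omega>. Z i \<omega> - Z j \<omega>) < e"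
  obtains Y where "Y \<in> L2_space M" "(\<lambda>n. L2_norm M (\<lambda>\<omega>. Z n \<omega> - Y \<omega>)) \<longlonglongrightarrow> 0"
proof -
  have [measurable]: "Z n \<in> borel_measurable M" for n
    using Z by (rule L2_spaceD)
  have "\<exists>N. \<forall>i\<ge>N. \<forall>j\<ge>N. expectation (\<lambda>\<omega>. norm (Z i \<omega> - Z j \<omega>)) < e" if "e > 0" for e
  proof -
    have "expectation (\<lambda>\<omega>. norm (Z i \<omega> - Z j \<omega>)) \<le> L2_norm M (\<lambda>\<omega>. Z i \<omega> - Z j \<omega>)" for i j
      using expectation_abs_le_L2_norm[OF L2_space_diff[OF Z Z]] by simp
    then show ?thesis
      using Cauchy[OF that] by (meson le_less_trans)
  qed
  with integrable_L2[OF Z] obtain r where r: "strict_mono r" "AE \<omega> in M. Cauchy (\<lambda>i. Z (r i) \<omega>)"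
    by (rule cauchy_L1_AE_cauchy_subseq)
  define Y where "Y \<omega> = lim (\<lambda>i. Z (r i) \<omega>)" for \<omega>
  have [measurable]: "Y \<in> borel_measurable M"
    unfolding Y_def by measurable
  have lim: "AE \<omega> in M. (\<lambda>i. Z (r i) \<omega>) \<longlonglongrightarrow> Y \<omega>"
    using r(2) by eventually_elim (simp add: Y_def Cauchy_convergent_iff convergent_LIMSEQ_iff)
  have bound: "\<exists>N. \<forall>n\<ge>N. (\<integral>\<^sup>+\<omega>. ennreal ((Z n \<omega> - Y \<omega>)\<^sup>2) \<partial>M) \<le> ennreal (e\<^sup>2)" if e: "e > 0" for e
  proof -
    obtain N where N: "\<And>i j. i \<ge> N \<Longrightarrow> j \<ge> N \<Longrightarrow> L2_norm M (\<lambda>\<omega>. Z i \<omega> - Z j \<omega>) < e"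
      using Cauchy[OF e] by blast
    have "(\<integral>\<^sup>+\<omega>. ennreal ((Z n \<omega> - Y \<omega>)\<^sup>2) \<partial>M) \<le> ennreal (e\<^sup>2)" if n: "n \<ge> N" for n
    proof -
      have "AE \<omega> in M. ennreal ((Z n \<omega> - Y \<omega>)\<^sup>2) = liminf (\<lambda>i. ennreal ((Z n \<omega> - Z (r i) \<omega>)\<^sup>2))"
        using lim
      proof eventually_elim
        case (elim \<omega>)
        then have "(\<lambda>i. ennreal ((Z n \<omega> - Z (r i) \<omega>)\<^sup>2)) \<longlonglongrightarrow> ennreal ((Z n \<omega> - Y \<omega>)\<^sup>2)"
          by (intro tendsto_intros)
        from lim_imp_Liminf[OF sequentially_bot this] show ?case ..
      qed
      then have "(\<integral>\<^sup>+\<omega>. ennreal ((Z n \<omega> - Y \<omega>)\<^sup>2) \<partial>M) = (\<integral>\<^sup>+\<omega>. liminf (\<lambda>i. ennreal ((Z n \<omega> - Z (r i) \<omega>)\<^sup>2)) \<partial>M)"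
        by (rule nn_integral_cong_AE)
      also have "\<dots> \<le> liminf (\<lambda>i. \<integral>\<^sup>+\<omega>. ennreal ((Z n \<omega> - Z (r i) \<omega>)\<^sup>2) \<partial>M)"
        by (rule nn_integral_liminf) measurable
      also have "\<dots> \<le> ennreal (e\<^sup>2)"
      proof (rule Liminf_le)
        have "(\<integral>\<^sup>+\<omega>. ennreal ((Z n \<omega> - Z (r i) \<omega>)\<^sup>2) \<partial>M) \<le> ennreal (e\<^sup>2)" if "i \<ge> N" for i
        proof -
          have "r i \<ge> N" using seq_suble[OF r(1), of i] that by simp
          then have "(L2_norm M (\<lambda>\<omega>. Z n \<omega> - Z (r i) \<omega>))\<^sup>2 \<le> e\<^sup>2"
            using N[OF n, of "r i"] by (intro power_mono) auto
          then show ?thesis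
            by (subst nn_integral_eq_integral)
              (auto simp: L2_norm_power2 intro!: L2_spaceD L2_space_diff Z)
        qed
        then show "\<forall>\<^sub>F i in sequentially. (\<integral>\<^sup>+\<omega>. ennreal ((Z n \<omega> - Z (r i) \<omega>)\<^sup>2) \<partial>M) \<le> ennreal (e\<^sup>2)"
          unfolding eventually_sequentially by blast
      qed simp
      finally show ?thesis .
    qed
    then show ?thesis by blast
  qed
  have L2: "(\<lambda>\<omega>. Z n \<omega> - Y \<omega>) \<in> L2_space M"
    if "(\<integral>\<^sup>+\<omega>. ennreal ((Z n \<omega> - Y \<omega>)\<^sup>2) \<partial>M) \<le> ennreal e" for n e
    using le_less_trans[OF that ennreal_less_top] by (simp add: L2_space_def integrable_iff_bounded)
  have Y: "Y \<in> L2_space M"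
  proof -
    obtain N where "(\<integral>\<^sup>+\<omega>. ennreal ((Z N \<omega> - Y \<omega>)\<^sup>2) \<partial>M) \<le> ennreal (1\<^sup>2)"
      using bound[of 1] by auto
    from L2_space_diff[OF Z[of N] L2[OF this]] show ?thesis by simp
  qed
  have "(\<lambda>n. L2_norm M (\<lambda>\<omega>. Z n \<omega> - Y \<omega>)) \<longlonglongrightarrow> 0"
  proof (rule LIMSEQ_I)
    fix e :: real assume e: "e > 0"
    obtain N where N: "\<And>n. n \<ge> N \<Longrightarrow> (\<integral>\<^sup>+\<omega>. ennreal ((Z n \<omega> - Y \<omega>)\<^sup>2) \<partial>M) \<le> ennreal ((e / 2)\<^sup>2)"
      using bound[of "e / 2"] e by auto
    have "L2_norm M (\<lambda>\<omega>. Z n \<omega> - Y \<omega>) < e" if "n \<ge> N" for n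
    proof -
      have "(\<integral>\<omega>. (Z n \<omega> - Y \<omega>)\<^sup>2 \<partial>M) \<le> (e / 2)\<^sup>2"
        using N[OF that] by (subst (asm) nn_integral_eq_integral) (auto intro!: L2_spaceD L2_space_diff Z Y)
      then have "L2_norm M (\<lambda>\<omega>. Z n \<omega> - Y \<omega>) \<le> e / 2"
        unfolding L2_norm_def using e by (intro real_le_lsqrt) auto
      then show ?thesis using e by simp
    qed
    then show "\<exists>N. \<forall>n\<ge>N. norm (L2_norm M (\<lambda>\<omega>. Z n \<omega> - Y \<omega>) - 0) < e" by auto
  qed
  with Y show ?thesis by (rule that)
qed

section \<open>Functions of bounded variation\<close>

lemma BV_linear:
  assumes "\<phi> \<in> BV T" "\<psi> \<in> BV T"
  shows "(\<lambda>u. a * \<phi> u + b * \<psi> u) \<in> BV T"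
proof -
  obtain C D where C: "\<And>n t. mono_on {..n} t \<and> t ` {..n} \<subseteq> {0..T} \<Longrightarrow> (\<Sum>i<n. \<bar>\<phi> (t (Suc i)) - \<phi> (t i)\<bar>) \<le> C"
    and D: "\<And>n t. mono_on {..n} t \<and> t ` {..n} \<subseteq> {0..T} \<Longrightarrow> (\<Sum>i<n. \<bar>\<psi> (t (Suc i)) - \<psi> (t i)\<bar>) \<le> D"
    using assms unfolding BV_def by blast
  have "(\<Sum>i<n. \<bar>(a * \<phi> (t (Suc i)) + b * \<psi> (t (Suc i))) - (a * \<phi> (t i) + b * \<psi> (t i))\<bar>) \<le> \<bar>a\<bar> * C + \<bar>b\<bar> * D"
    if t: "mono_on {..n} t \<and> t ` {..n} \<subseteq> {0..T}" for n and t :: "nat \<Rightarrow> real"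
  proof -
    have "\<bar>(a * x + b * y) - (a * x' + b * y')\<bar> \<le> \<bar>a\<bar> * \<bar>x - x'\<bar> + \<bar>b\<bar> * \<bar>y - y'\<bar>" for x x' y y' :: real
    proof -
      have "(a * x + b * y) - (a * x' + b * y') = a * (x - x') + b * (y - y')"
        by (simp add: algebra_simps)
      then show ?thesis
        by (metis abs_mult abs_triangle_ineq)
    qed
    then have "(\<Sum>i<n. \<bar>(a * \<phi> (t (Suc i)) + b * \<psi> (t (Suc i))) - (a * \<phi> (t i) + b * \<psi> (t i))\<bar>)
        \<le> (\<Sum>i<n. \<bar>a\<bar> * \<bar>\<phi> (t (Suc i)) - \<phi> (t i)\<bar> + \<bar>b\<bar> * \<bar>\<psi> (t (Suc i)) - \<psi> (t i)\<bar>)"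
      by (intro sum_mono)
    also have "\<dots> = \<bar>a\<bar> * (\<Sum>i<n. \<bar>\<phi> (t (Suc i)) - \<phi> (t i)\<bar>) + \<bar>b\<bar> * (\<Sum>i<n. \<bar>\<psi> (t (Suc i)) - \<psi> (t i)\<bar>)"
      by (simp add: sum.distrib sum_distrib_left)
    also have "\<dots> \<le> \<bar>a\<bar> * C + \<bar>b\<bar> * D"
      using C[OF t] D[OF t] by (intro add_mono mult_left_mono) auto
    finally show ?thesis .
  qed
  then show ?thesis unfolding BV_def by blast
qed

text \<open>Along nonnegative increasing times the indicator only decreases, so its increments
  telescope.\<close>

lemma indicator_atMost_BV: "indicator {0..s} \<in> BV T"
  unfolding BV_def
proof (intro CollectI exI allI impI)
  fix n and t :: "nat \<Rightarrow> real" assume t: "mono_on {..n} t \<and> t ` {..n} \<subseteq> {0..T}"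
  have "(\<Sum>i<n. \<bar>indicator {0..s} (t (Suc i)) - indicator {0..s} (t i)\<bar>)
      = (\<Sum>i<n. indicator {0..s} (t i) - indicator {0..s} (t (Suc i)) :: real)"
  proof (rule sum.cong[OF refl])
    fix i assume "i \<in> {..<n}"
    then have "t i \<le> t (Suc i)" "0 \<le> t i"
      using t by (auto simp: mono_on_def image_subset_iff)
    then show "\<bar>indicator {0..s} (t (Suc i)) - indicator {0..s} (t i)\<bar>
        = (indicator {0..s} (t i) - indicator {0..s} (t (Suc i)) :: real)"
      by (auto simp: indicator_def)
  qed
  also have "\<dots> = indicator {0..s} (t 0) - indicator {0..s} (t n)"
    by (rule sum_lessThan_telescope')
  also have "\<dots> \<le> 1" by (auto simp: indicator_def)
  finally show "(\<Sum>i<n. \<bar>indicator {0..s} (t (Suc i)) - indicator {0..s} (t i)\<bar>) \<le> (1::real)" .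
qed

text \<open>\<open>V x\<close> is the total variation of \<phi> on [0,x], and \<phi> = V - (V -
  \<phi>). Both parts are monotone on [0,T] by the inequality \<open>step\<close>: from x to y, V
  grows by at least |\<phi>(y) - \<phi>(x)|.\<close>

theorem BV_Jordan_decomposition:
  assumes "\<phi> \<in> BV T"
  obtains f g where "mono_on {0..T} f" "mono_on {0..T} g" "\<And>x. \<phi> x = f x - g x"
proof -
  define P where "P x n t \<longleftrightarrow> mono_on {..n} t \<and> t ` {..n} \<subseteq> {0..x}" for x :: real and n :: nat and t
  define S where "S n t = (\<Sum>i<n. \<bar>\<phi> (t (Suc i)) - \<phi> (t i)\<bar>)" for n :: nat and t
  obtain C where C: "\<And>n t. P T n t \<Longrightarrow> S n t \<le> C"
    using assms unfolding BV_def P_def S_def by blast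
  define V where "V x = Sup {S n t | n t. P x n t}" for x
  have VT: "P x n t \<Longrightarrow> x \<le> T \<Longrightarrow> P T n t" for x n t
    unfolding P_def by (meson atLeastatMost_subset_iff order_refl subset_trans)
  have upper: "S n t \<le> V x" if "P x n t" "x \<le> T" for x n t
    unfolding V_def using that C VT by (intro cSup_upper) (auto intro!: bdd_aboveI[of _ C])
  have step: "V x + \<bar>\<phi> y - \<phi> x\<bar> \<le> V y" if xy: "0 \<le> x" "x \<le> y" "y \<le> T" for x y
  proof -
    have "V x \<le> V y - \<bar>\<phi> y - \<phi> x\<bar>"
      unfolding V_def[of x]
    proof (rule cSup_least)
      have "P x 0 (\<lambda>_. x)" using xy by (auto simp: P_def mono_on_def)
      then show "{S n t |n t. P x n t} \<noteq> {}" by blast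
      fix s assume "s \<in> {S n t |n t. P x n t}"
      then obtain n t where s: "s = S n t" "P x n t" by blast
      \<comment> \<open>A partition of [0,x] need not end at \<open>x\<close>. Appending
        \<open>x\<close> and then \<open>y\<close> isolates the increment from \<open>x\<close> to
        \<open>y\<close>; the extra increment up to \<open>x\<close> is nonnegative and
        dropped.\<close>
      define t' where "t' i = (if i \<le> n then t i else if i = Suc n then x else y)" for i
      have tx: "t i \<le> x" "0 \<le> t i" if "i \<le> n" for i using s that by (auto simp: P_def image_subset_iff)
      have tm: "t i \<le> t j" if "i \<le> j" "j \<le> n" for i j using s that by (auto simp: P_def mono_on_def)
      have "P y (Suc (Suc n)) t'"
        unfolding P_def
      proof (intro conjI image_subsetI)
        show "mono_on {..Suc (Suc n)} t'"
          using xy tx tm by (fastforce simp: mono_on_def t'_def)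
      qed (use xy tx in \<open>fastforce simp: t'_def\<close>)
      then have "S (Suc (Suc n)) t' \<le> V y" using xy by (intro upper)
      moreover have "S n t' = S n t"
        unfolding S_def by (intro sum.cong) (auto simp: t'_def)
      then have "S (Suc (Suc n)) t' \<ge> S n t + \<bar>\<phi> y - \<phi> x\<bar>"
        by (simp add: S_def t'_def)
      ultimately show "s \<le> V y - \<bar>\<phi> y - \<phi> x\<bar>" using s by linarith
    qed
    then show ?thesis by linarith
  qed
  show ?thesis
  proof (rule that[of V "\<lambda>x. V x - \<phi> x"])
    show "mono_on {0..T} V"
      unfolding mono_on_def using step by (smt (verit) atLeastAtMost_iff)
    show "mono_on {0..T} (\<lambda>x. V x - \<phi> x)"
      unfolding mono_on_def using step by (smt (verit) atLeastAtMost_iff)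
  qed simp
qed

text \<open>All three properties hold for monotone functions and pass to differences.\<close>

lemma
  assumes "\<phi> \<in> BV T"
  shows BV_measurable: "\<phi> \<in> borel_measurable (restrict_space borel {0..T})"
    and BV_bounded: "\<exists>K. \<forall>x\<in>{0..T}. \<bar>\<phi> x\<bar> \<le> K"
    and BV_countable_discontinuities: "countable {x\<in>{0..T}. \<not> continuous (at x within {0..T}) \<phi>}"
proof -
  obtain f g where f: "mono_on {0..T} f" and g: "mono_on {0..T} g" and \<phi>: "\<And>x. \<phi> x = f x - g x"
    using BV_Jordan_decomposition[OF assms] by blast
  have eq: "\<phi> = (\<lambda>x. f x - g x)" using \<phi> by auto
  show "\<phi> \<in> borel_measurable (restrict_space borel {0..T})"
    unfolding eq by (intro borel_measurable_diff borel_measurable_mono_on_fnc f g)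
  have "\<bar>h x\<bar> \<le> \<bar>h 0\<bar> + \<bar>h T\<bar>" if "mono_on {0..T} h" "x \<in> {0..T}" for h :: "real \<Rightarrow> real" and x
  proof -
    have "h 0 \<le> h x" "h x \<le> h T" using that by (auto simp: mono_on_def)
    then show ?thesis by linarith
  qed
  from this[OF f] this[OF g] have "\<bar>\<phi> x\<bar> \<le> \<bar>f 0\<bar> + \<bar>f T\<bar> + (\<bar>g 0\<bar> + \<bar>g T\<bar>)" if "x \<in> {0..T}" for x
    using that abs_triangle_ineq4[of "f x" "g x"] unfolding \<phi> by fastforce
  then show "\<exists>K. \<forall>x\<in>{0..T}. \<bar>\<phi> x\<bar> \<le> K" by blast
  have "{x\<in>{0..T}. \<not> continuous (at x within {0..T}) \<phi>} \<subseteq>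
      {x\<in>{0..T}. \<not> continuous (at x within {0..T}) f} \<union> {x\<in>{0..T}. \<not> continuous (at x within {0..T}) g}"
    unfolding eq by (auto intro: continuous_diff)
  then show "countable {x\<in>{0..T}. \<not> continuous (at x within {0..T}) \<phi>}"
    by (rule countable_subset) (intro countable_Un mono_on_ctble_discont f g)
qed

section \<open>The form induced by a covariance measure\<close>

lemma approximating_sequence:
  fixes f :: "'b \<Rightarrow> real"
  assumes "\<And>e. e > 0 \<Longrightarrow> \<exists>x y. P x y \<and> f x < e" and "\<And>x y. P x y \<Longrightarrow> 0 \<le> f x"
  obtains x y where "\<And>n. P (x n) (y n)" "(\<lambda>n. f (x n)) \<longlonglongrightarrow> 0"
proof -
  have "\<exists>x y. P x y \<and> f x < inverse (real (Suc n))" for n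
    by (intro assms(1)) simp
  then obtain x y where x: "\<And>n. P (x n) (y n)" "\<And>n. f (x n) < inverse (real (Suc n))"
    by metis
  have "(\<lambda>n. f (x n)) \<longlonglongrightarrow> 0"
    by (rule tendsto_sandwich[OF _ _ tendsto_const LIMSEQ_inverse_real_of_nat])
      (use x assms(2) in \<open>auto intro!: always_eventually simp: less_imp_le\<close>)
  with x(1) show ?thesis by (rule that)
qed

text \<open>This locale carries the Hilbert space part of the argument; the locale extending it adds
  path regularity and L2-continuity for the forward integral.\<close>

locale covariance_measure_process = prob_space M
  for M :: "'a measure" +
  fixes T :: real and X :: "real \<Rightarrow> 'a \<Rightarrow> real" and \<mu> :: "(real \<times> real) set \<Rightarrow> real"
  assumes T_pos: "0 < T"
    and X_L2: "\<And>t. t \<in> {0..T} \<Longrightarrow> X t \<in> L2_space M"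
    and zero_mean: "\<And>t. t \<in> {0..T} \<Longrightarrow> (\<integral>\<omega>. X t \<omega> \<partial>M) = 0"
    and cov: "has_covariance_measure M T X \<mu>"
    and L_mu_space: "is_function_space (L_mu T \<mu>)"
begin

abbreviation \<Lambda> :: "(real \<times> real) measure" where
  "\<Lambda> \<equiv> total_variation (borel_square T) \<mu>"

abbreviation ip :: "(real \<Rightarrow> real) \<Rightarrow> (real \<Rightarrow> real) \<Rightarrow> real" where
  "ip \<equiv> H_inner T \<mu>"

abbreviation hn :: "(real \<Rightarrow> real) \<Rightarrow> real" where
  "hn \<equiv> H_norm T \<mu>"

abbreviation I :: "real measure" where
  "I \<equiv> restrict_space borel {0..T}"

text \<open>The working class between \<open>BV T\<close> and \<open>L_mu\<close>: it is contained
  in \<open>L_mu\<close> because |\<mu>| is finite, and it contains the averaged integrands of the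
  forward approximations as well as the truncations of functions in \<open>L_mu\<close>.\<close>

definition Bd :: "(real \<Rightarrow> real) set" where
  "Bd = {\<phi> \<in> borel_measurable I. \<exists>K. \<forall>u\<in>{0..T}. \<bar>\<phi> u\<bar> \<le> K}"

section \<open>Integrability and bilinearity of the form on \<open>L_mu\<close>\<close>

lemma sm: "signed_measure (borel_square T) \<mu>"
  using cov by (simp add: has_covariance_measure_def)

sublocale tv: finite_measure \<Lambda>
  by (rule finite_total_variation[OF sm])

lemma space_I: "space I = {0..T}"
  by (simp add: space_restrict_space)

lemma \<mu>_rectangle:
  assumes "s \<in> {0..T}" "t \<in> {0..T}"
  shows "\<mu> ({0..s} \<times> {0..t}) = expectation (\<lambda>\<omega>. X s \<omega> * X t \<omega>)"
  using cov assms by (simp add: has_covariance_measure_def covariance_def zero_mean)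

lemma fst_I: "fst \<in> borel_square T \<rightarrow>\<^sub>M I" and snd_I: "snd \<in> borel_square T \<rightarrow>\<^sub>M I"
  by (auto intro!: measurable_restrict_space3 simp: borel_prod[symmetric])

lemma measurable_tensor:
  fixes \<phi> \<psi> :: "real \<Rightarrow> real"
  assumes "\<phi> \<in> borel_measurable I" "\<psi> \<in> borel_measurable I"
  shows "(\<lambda>(u, v). \<phi> u * \<psi> v) \<in> borel_measurable (borel_square T)"
  unfolding case_prod_beta
  using measurable_compose[OF fst_I assms(1)] measurable_compose[OF snd_I assms(2)]
  by (rule borel_measurable_times)

lemma L_mu_measurable: "\<phi> \<in> L_mu T \<mu> \<Longrightarrow> \<phi> \<in> borel_measurable I"
  by (simp add: L_mu_def)

lemma L_mu_linear:
  assumes "\<phi> \<in> L_mu T \<mu>" "\<psi> \<in> L_mu T \<mu>"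
  shows "(\<lambda>u. a * \<phi> u + b * \<psi> u) \<in> L_mu T \<mu>"
proof -
  have "(\<lambda>u. a * \<phi> u) \<in> L_mu T \<mu>" "(\<lambda>u. b * \<psi> u) \<in> L_mu T \<mu>"
    using L_mu_space assms by (auto simp: is_function_space_def)
  then show ?thesis
    using L_mu_space by (auto simp: is_function_space_def)
qed

lemma L_mu_diff: "\<phi> \<in> L_mu T \<mu> \<Longrightarrow> \<psi> \<in> L_mu T \<mu> \<Longrightarrow> (\<lambda>u. \<phi> u - \<psi> u) \<in> L_mu T \<mu>"
  using L_mu_linear[of \<phi> \<psi> 1 "-1"] by simp

lemma L_mu_abs: "\<phi> \<in> L_mu T \<mu> \<Longrightarrow> (\<lambda>u. \<bar>\<phi> u\<bar>) \<in> L_mu T \<mu>"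
  by (auto simp: L_mu_def)

lemma integrable_tensor:
  assumes "\<phi> \<in> L_mu T \<mu>" "\<psi> \<in> L_mu T \<mu>"
  shows "integrable \<Lambda> (\<lambda>(u, v). \<phi> u * \<psi> v)"
proof -
  define \<eta> where "\<eta> = (\<lambda>u. 1 * \<bar>\<phi> u\<bar> + 1 * \<bar>\<psi> u\<bar>)"
  have \<eta>: "\<eta> \<in> L_mu T \<mu>"
    unfolding \<eta>_def using assms by (intro L_mu_linear L_mu_abs)
  have int: "integrable \<Lambda> (\<lambda>(u, v). \<eta> u * \<eta> v)"
  proof (rule integrableI_bounded)
    have "(\<integral>\<^sup>+x. ennreal (norm (case x of (u, v) \<Rightarrow> \<eta> u * \<eta> v)) \<partial>\<Lambda>) = (\<integral>\<^sup>+(u, v). ennreal (\<bar>\<eta> u\<bar> * \<bar>\<eta> v\<bar>) \<partial>\<Lambda>)"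
      by (auto intro!: nn_integral_cong simp: abs_mult)
    then show "(\<integral>\<^sup>+x. ennreal (norm (case x of (u, v) \<Rightarrow> \<eta> u * \<eta> v)) \<partial>\<Lambda>) < \<infinity>"
      using \<eta> by (simp add: L_mu_def)
    show "(\<lambda>(u, v). \<eta> u * \<eta> v) \<in> borel_measurable \<Lambda>"
      using measurable_tensor[OF L_mu_measurable L_mu_measurable, OF \<eta> \<eta>] by (simp cong: measurable_cong_sets)
  qed
  show ?thesis
  proof (rule Bochner_Integration.integrable_bound[OF int])
    show "(\<lambda>(u, v). \<phi> u * \<psi> v) \<in> borel_measurable \<Lambda>"
      using measurable_tensor[OF L_mu_measurable L_mu_measurable, OF assms] by (simp cong: measurable_cong_sets)
    have "\<bar>\<phi> u * \<psi> v\<bar> \<le> \<bar>\<eta> u * \<eta> v\<bar>" for u v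
      unfolding abs_mult by (intro mult_mono) (auto simp: \<eta>_def)
    then show "AE x in \<Lambda>. norm (case x of (u, v) \<Rightarrow> \<phi> u * \<psi> v) \<le> norm (case x of (u, v) \<Rightarrow> \<eta> u * \<eta> v)"
      by auto
  qed
qed

lemma ip_linear_left:
  assumes "\<phi> \<in> L_mu T \<mu>" "\<psi> \<in> L_mu T \<mu>" "\<eta> \<in> L_mu T \<mu>"
  shows "ip (\<lambda>u. a * \<phi> u + b * \<psi> u) \<eta> = a * ip \<phi> \<eta> + b * ip \<psi> \<eta>"
  unfolding H_inner_def signed_integral_linear[OF integrable_tensor integrable_tensor, OF assms(1,3) assms(2,3), symmetric]
  by (rule arg_cong[where f="signed_integral _ _"]) (auto simp: algebra_simps)

lemma ip_linear_right:
  assumes "\<phi> \<in> L_mu T \<mu>" "\<psi> \<in> L_mu T \<mu>" "\<eta> \<in> L_mu T \<mu>"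
  shows "ip \<eta> (\<lambda>u. a * \<phi> u + b * \<psi> u) = a * ip \<eta> \<phi> + b * ip \<eta> \<psi>"
  unfolding H_inner_def signed_integral_linear[OF integrable_tensor integrable_tensor, OF assms(3,1) assms(3,2), symmetric]
  by (rule arg_cong[where f="signed_integral _ _"]) (auto simp: algebra_simps)

lemma ip_diff_left:
  assumes "\<phi> \<in> L_mu T \<mu>" "\<psi> \<in> L_mu T \<mu>" "\<eta> \<in> L_mu T \<mu>"
  shows "ip (\<lambda>u. \<phi> u - \<psi> u) \<eta> = ip \<phi> \<eta> - ip \<psi> \<eta>"
  using ip_linear_left[OF assms, of 1 "-1"] by simp

lemma ip_diff_right:
  assumes "\<phi> \<in> L_mu T \<mu>" "\<psi> \<in> L_mu T \<mu>" "\<eta> \<in> L_mu T \<mu>"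
  shows "ip \<eta> (\<lambda>u. \<phi> u - \<psi> u) = ip \<eta> \<phi> - ip \<eta> \<psi>"
  using ip_linear_right[OF assms, of 1 "-1"] by simp

section \<open>Bounded functions and the norm of the marginals\<close>

lemma Bd_measurable: "\<phi> \<in> Bd \<Longrightarrow> \<phi> \<in> borel_measurable I"
  by (simp add: Bd_def)

lemma Bd_bounded:
  assumes "\<phi> \<in> Bd"
  obtains K where "0 \<le> K" "\<And>u. u \<in> {0..T} \<Longrightarrow> \<bar>\<phi> u\<bar> \<le> K"
proof -
  obtain K where "\<forall>u\<in>{0..T}. \<bar>\<phi> u\<bar> \<le> K" using assms by (auto simp: Bd_def)
  then show ?thesis by (intro that[of "max 0 K"]) (auto simp: le_max_iff_disj)
qed

lemma BdI: "\<phi> \<in> borel_measurable I \<Longrightarrow> (\<And>u. u \<in> {0..T} \<Longrightarrow> \<bar>\<phi> u\<bar> \<le> K) \<Longrightarrow> \<phi> \<in> Bd"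
  unfolding Bd_def by blast

lemma Bd_linear:
  assumes "\<phi> \<in> Bd" "\<psi> \<in> Bd"
  shows "(\<lambda>u. a * \<phi> u + b * \<psi> u) \<in> Bd"
proof -
  obtain K where K: "\<And>u. u \<in> {0..T} \<Longrightarrow> \<bar>\<phi> u\<bar> \<le> K" using Bd_bounded[OF assms(1)] by blast
  obtain L where L: "\<And>u. u \<in> {0..T} \<Longrightarrow> \<bar>\<psi> u\<bar> \<le> L" using Bd_bounded[OF assms(2)] by blast
  show ?thesis
  proof (rule BdI)
    show "(\<lambda>u. a * \<phi> u + b * \<psi> u) \<in> borel_measurable I"
      using assms by (intro borel_measurable_add borel_measurable_times borel_measurable_const Bd_measurable)
    fix u assume "u \<in> {0..T}"
    then have "\<bar>a\<bar> * \<bar>\<phi> u\<bar> + \<bar>b\<bar> * \<bar>\<psi> u\<bar> \<le> \<bar>a\<bar> * K + \<bar>b\<bar> * L"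
      using K L by (intro add_mono mult_left_mono) auto
    then show "\<bar>a * \<phi> u + b * \<psi> u\<bar> \<le> \<bar>a\<bar> * K + \<bar>b\<bar> * L"
      using abs_triangle_ineq[of "a * \<phi> u" "b * \<psi> u"] by (simp add: abs_mult)
  qed
qed

lemma Bd_diff: "\<phi> \<in> Bd \<Longrightarrow> \<psi> \<in> Bd \<Longrightarrow> (\<lambda>u. \<phi> u - \<psi> u) \<in> Bd"
  using Bd_linear[of \<phi> \<psi> 1 "-1"] by simp

lemma Bd_L_mu: "Bd \<subseteq> L_mu T \<mu>"
proof
  fix \<phi> assume \<phi>: "\<phi> \<in> Bd"
  obtain K where K: "0 \<le> K" "\<And>u. u \<in> {0..T} \<Longrightarrow> \<bar>\<phi> u\<bar> \<le> K" using Bd_bounded[OF \<phi>] by blast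
  have "(\<integral>\<^sup>+(u, v). ennreal (\<bar>\<phi> u\<bar> * \<bar>\<phi> v\<bar>) \<partial>\<Lambda>) \<le> (\<integral>\<^sup>+x. ennreal (K * K) \<partial>\<Lambda>)"
    using K by (intro nn_integral_mono) (auto simp: space_restrict_space intro!: ennreal_leI mult_mono)
  also have "\<dots> < \<infinity>"
    using tv.emeasure_finite[of "space (borel_square T)"] by (auto simp: less_top[symmetric] ennreal_mult_eq_top_iff)
  finally show "\<phi> \<in> L_mu T \<mu>"
    using \<phi> by (auto simp: L_mu_def Bd_measurable)
qed

lemma BV_Bd: "BV T \<subseteq> Bd"
  using BV_measurable BV_bounded by (auto simp: Bd_def)

lemma indicator_Bd: "A \<in> sets borel \<Longrightarrow> indicator (A \<inter> {0..T}) \<in> Bd"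
  by (rule BdI[where K=1]) (auto intro!: measurable_restrict_space1 simp: indicator_def)

text \<open>The seminorm \<open>q\<close>, the \<open>L\<^sup>2\<close>-norm with respect to the marginals of \<open>|\<mu>|\<close>, dominates \<open>\<langle>\<cdot>,\<cdot>\<rangle>\<close> before
  positivity of the latter is known.\<close>

definition q :: "(real \<Rightarrow> real) \<Rightarrow> real" where
  "q \<phi> = L2_norm \<Lambda> (\<lambda>x. \<phi> (fst x)) + L2_norm \<Lambda> (\<lambda>x. \<phi> (snd x))"

lemma Bd_L2:
  assumes "\<phi> \<in> Bd"
  shows "(\<lambda>x. \<phi> (fst x)) \<in> L2_space \<Lambda>" "(\<lambda>x. \<phi> (snd x)) \<in> L2_space \<Lambda>"
proof -
  obtain K where K: "0 \<le> K" "\<And>u. u \<in> {0..T} \<Longrightarrow> \<bar>\<phi> u\<bar> \<le> K" using Bd_bounded[OF assms] by blast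
  have K2: "(\<phi> u)\<^sup>2 \<le> K\<^sup>2" if "u \<in> {0..T}" for u
    using K(2)[OF that] K(1) by (simp add: abs_le_square_iff[symmetric])
  have m: "(\<lambda>x. \<phi> (fst x)) \<in> borel_measurable \<Lambda>" "(\<lambda>x. \<phi> (snd x)) \<in> borel_measurable \<Lambda>"
    using measurable_compose[OF fst_I Bd_measurable[OF assms]] measurable_compose[OF snd_I Bd_measurable[OF assms]]
    by (simp_all cong: measurable_cong_sets)
  show "(\<lambda>x. \<phi> (fst x)) \<in> L2_space \<Lambda>" "(\<lambda>x. \<phi> (snd x)) \<in> L2_space \<Lambda>"
    using m K2 unfolding L2_space_def
    by (auto intro!: tv.integrable_const_bound[where B="K\<^sup>2"] simp: space_restrict_space)
qed

lemma q_nonneg: "0 \<le> q \<phi>"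
  by (simp add: q_def)

lemma q_add:
  assumes "\<phi> \<in> Bd" "\<psi> \<in> Bd"
  shows "q (\<lambda>u. \<phi> u + \<psi> u) \<le> q \<phi> + q \<psi>"
  using L2_norm_triangle[OF Bd_L2(1) Bd_L2(1), OF assms] L2_norm_triangle[OF Bd_L2(2) Bd_L2(2), OF assms]
  by (simp add: q_def)

lemma q_scale: "q (\<lambda>u. a * \<phi> u) = \<bar>a\<bar> * q \<phi>"
  by (simp add: q_def L2_norm_def power_mult_distrib real_sqrt_mult distrib_left)

text \<open>This is Cauchy-Schwarz in L2 of |\<mu>|, for \<phi> of the first and \<psi> of the
  second coordinate, and involves no positivity of the form. Since \<open>q\<close> adds both
  marginals, it bounds a function in either slot.\<close>

lemma ip_le_q:
  assumes "\<phi> \<in> Bd" "\<psi> \<in> Bd"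
  shows "\<bar>ip \<phi> \<psi>\<bar> \<le> q \<phi> * q \<psi>"
proof -
  have abs: "(\<lambda>u. \<bar>\<phi> u\<bar>) \<in> Bd" if "\<phi> \<in> Bd" for \<phi>
    using that by (auto simp: Bd_def)
  have "\<bar>ip \<phi> \<psi>\<bar> \<le> (\<integral>x. \<bar>case x of (u, v) \<Rightarrow> \<phi> u * \<psi> v\<bar> \<partial>\<Lambda>)"
    unfolding H_inner_def using assms Bd_L_mu by (intro abs_signed_integral_le integrable_tensor) auto
  also have "\<dots> = (\<integral>x. \<bar>\<phi> (fst x)\<bar> * \<bar>\<psi> (snd x)\<bar> \<partial>\<Lambda>)"
    by (simp add: case_prod_beta abs_mult)
  also have "\<dots> \<le> L2_norm \<Lambda> (\<lambda>x. \<bar>\<phi> (fst x)\<bar>) * L2_norm \<Lambda> (\<lambda>x. \<bar>\<psi> (snd x)\<bar>)"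
    using L2_Cauchy_Schwarz[OF Bd_L2(1) Bd_L2(2), OF abs abs, OF assms] by linarith
  also have "\<dots> = L2_norm \<Lambda> (\<lambda>x. \<phi> (fst x)) * L2_norm \<Lambda> (\<lambda>x. \<psi> (snd x))"
    by (simp add: L2_norm_def)
  also have "\<dots> \<le> q \<phi> * q \<psi>"
    by (intro mult_mono) (auto simp: q_def)
  finally show ?thesis .
qed

lemma q_tendsto:
  assumes "\<And>n. \<phi> n \<in> borel_measurable I" "\<psi> \<in> borel_measurable I"
    and K: "\<And>n u. u \<in> {0..T} \<Longrightarrow> \<bar>\<phi> n u\<bar> \<le> K"
    and lim: "\<And>u. u \<in> {0..T} \<Longrightarrow> (\<lambda>n. \<phi> n u) \<longlonglongrightarrow> \<psi> u"
  shows "(\<lambda>n. q (\<lambda>u. \<psi> u - \<phi> n u)) \<longlonglongrightarrow> 0"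
proof -
  have K': "\<bar>\<psi> u\<bar> \<le> K" if "u \<in> {0..T}" for u
    by (rule LIMSEQ_le_const2[OF tendsto_rabs[OF lim[OF that]]]) (use K[OF that] in auto)
  have bound: "(\<psi> u - \<phi> n u)\<^sup>2 \<le> (2 * K)\<^sup>2" if "u \<in> {0..T}" for u n
  proof -
    have "\<bar>\<psi> u - \<phi> n u\<bar> \<le> \<bar>2 * K\<bar>" using K[OF that, of n] K'[OF that] by linarith
    then show ?thesis by (simp only: abs_le_square_iff)
  qed
  have *: "(\<lambda>n. L2_norm \<Lambda> (\<lambda>x. \<psi> (p x) - \<phi> n (p x))) \<longlonglongrightarrow> 0" if p: "p \<in> borel_square T \<rightarrow>\<^sub>M I" for p
  proof -
    have [measurable]: "(\<lambda>x. \<phi> n (p x)) \<in> borel_measurable \<Lambda>" "(\<lambda>x. \<psi> (p x)) \<in> borel_measurable \<Lambda>" for n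
      using measurable_compose[OF p assms(1)] measurable_compose[OF p assms(2)] by (simp_all cong: measurable_cong_sets)
    have pT: "p x \<in> {0..T}" if "x \<in> space \<Lambda>" for x
      using measurable_space[OF p, of x] that by (simp add: space_I)
    have "(\<lambda>n. \<integral>x. (\<psi> (p x) - \<phi> n (p x))\<^sup>2 \<partial>\<Lambda>) \<longlonglongrightarrow> (\<integral>x. 0 \<partial>\<Lambda>)"
    proof (rule integral_dominated_convergence[where w="\<lambda>_. (2 * K)\<^sup>2"])
      have "(\<lambda>n. (\<psi> u - \<phi> n u)\<^sup>2) \<longlonglongrightarrow> (\<psi> u - \<psi> u)\<^sup>2" if "u \<in> {0..T}" for u
        by (intro tendsto_intros lim that)
      then show "AE x in \<Lambda>. (\<lambda>n. (\<psi> (p x) - \<phi> n (p x))\<^sup>2) \<longlonglongrightarrow> 0"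
        using pT by auto
      show "AE x in \<Lambda>. norm ((\<psi> (p x) - \<phi> n (p x))\<^sup>2) \<le> (2 * K)\<^sup>2" for n
        using pT bound by auto
    qed auto
    then show ?thesis
      unfolding L2_norm_def using tendsto_real_sqrt by fastforce
  qed
  show ?thesis
    unfolding q_def using tendsto_add[OF *[OF fst_I] *[OF snd_I]] by simp
qed

text \<open>Pairs a step function with its integral. Being a relation, it needs no canonical
  presentation: the random variables paired with one step function agree almost everywhere, as the
  isometry shows. The generators are the intervals [0,t], for which \<mu> of a product is a
  covariance.\<close>

inductive elem :: "(real \<Rightarrow> real) \<Rightarrow> ('a \<Rightarrow> real) \<Rightarrow> bool" where
  base: "t \<in> {0..T} \<Longrightarrow> elem (indicator {0..t}) (X t)"
| linear: "elem h Z \<Longrightarrow> elem k W \<Longrightarrow> elem (\<lambda>u. a * h u + b * k u) (\<lambda>\<omega>. a * Z \<omega> + b * W \<omega>)"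

lemma elem_diff: "elem h Z \<Longrightarrow> elem k W \<Longrightarrow> elem (\<lambda>u. h u - k u) (\<lambda>\<omega>. Z \<omega> - W \<omega>)"
  using linear[of h Z k W 1 "-1"] by simp

lemma elem_zero: "elem (\<lambda>_. 0) (\<lambda>_. 0)"
  using linear[OF base base, of 0 0 0 0] T_pos by simp

lemma elem_BV: "elem h Z \<Longrightarrow> h \<in> BV T"
  by (induction rule: elem.induct) (auto intro: indicator_atMost_BV BV_linear)

lemma elem_Bd: "elem h Z \<Longrightarrow> h \<in> Bd"
  using elem_BV BV_Bd by blast

lemma elem_L_mu: "elem h Z \<Longrightarrow> h \<in> L_mu T \<mu>"
  using elem_Bd Bd_L_mu by blast

lemma elem_L2: "elem h Z \<Longrightarrow> Z \<in> L2_space M"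
  by (induction rule: elem.induct) (auto intro: X_L2 L2_space_linear)

text \<open>Linearity in \<open>W\<close> reduces the claim to \<open>W = X t\<close>.
  \<open>Z\<close> stays an arbitrary square integrable variable so that forward approximations are
  covered as well.\<close>

lemma expectation_elem_right:
  assumes "elem k W" "g \<in> L_mu T \<mu>" "Z \<in> L2_space M"
    and "\<And>t. t \<in> {0..T} \<Longrightarrow> expectation (\<lambda>\<omega>. Z \<omega> * X t \<omega>) = ip g (indicator {0..t})"
  shows "expectation (\<lambda>\<omega>. Z \<omega> * W \<omega>) = ip g k"
  using assms(1)
proof induction
  case (base t)
  then show ?case by (rule assms(4))
next
  case (linear h Z' k W a b)
  have "expectation (\<lambda>\<omega>. Z \<omega> * (a * Z' \<omega> + b * W \<omega>)) = a * expectation (\<lambda>\<omega>. Z \<omega> * Z' \<omega>) + b * expectation (\<lambda>\<omega>. Z \<omega> * W \<omega>)"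
    using integrable_mult_L2[OF assms(3) elem_L2[OF linear(1)]] integrable_mult_L2[OF assms(3) elem_L2[OF linear(2)]]
    by (simp add: distrib_left mult.left_commute[of _ a] mult.left_commute[of _ b])
  then show ?case
    using linear assms(2) by (simp add: ip_linear_right elem_L_mu)
qed

lemma ip_indicator:
  assumes "A \<in> sets borel" "B \<in> sets borel" "A \<subseteq> {0..T}" "B \<subseteq> {0..T}"
  shows "ip (indicator A) (indicator B) = \<mu> (A \<times> B)"
proof -
  have "A \<times> B \<in> sets (borel_square T)"
    using assms by (auto simp: sets_restrict_space_iff borel_prod[symmetric])
  moreover have "(\<lambda>(u, v). indicator A u * indicator B v) = (indicator (A \<times> B) :: real \<times> real \<Rightarrow> real)"
    by (auto simp: indicator_def)
  ultimately show ?thesis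
    by (simp add: H_inner_def signed_integral_indicator[OF sm])
qed

lemma ip_indicator_X:
  assumes "s \<in> {0..T}" "t \<in> {0..T}"
  shows "expectation (\<lambda>\<omega>. X s \<omega> * X t \<omega>) = ip (indicator {0..s}) (indicator {0..t})"
  using assms by (subst ip_indicator) (auto simp: \<mu>_rectangle)

lemma expectation_elem:
  assumes "elem h Z" "elem k W"
  shows "expectation (\<lambda>\<omega>. Z \<omega> * W \<omega>) = ip h k"
proof (rule expectation_elem_right[OF assms(2) elem_L_mu[OF assms(1)] elem_L2[OF assms(1)]])
  show "expectation (\<lambda>\<omega>. Z \<omega> * X t \<omega>) = ip h (indicator {0..t})" if t: "t \<in> {0..T}" for t
    using assms(1)
  proof induction
    case (base s)
    then show ?case using t by (intro ip_indicator_X)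
  next
    case (linear h Z k W a b)
    have "expectation (\<lambda>\<omega>. (a * Z \<omega> + b * W \<omega>) * X t \<omega>) = a * expectation (\<lambda>\<omega>. Z \<omega> * X t \<omega>) + b * expectation (\<lambda>\<omega>. W \<omega> * X t \<omega>)"
      using integrable_mult_L2[OF elem_L2[OF linear(1)] X_L2[OF t]] integrable_mult_L2[OF elem_L2[OF linear(2)] X_L2[OF t]]
      by (simp add: distrib_right mult.assoc)
    then show ?case
      using linear base[OF t] by (simp add: ip_linear_left elem_L_mu)
  qed
qed

text \<open>The closure of the step functions for \<open>q\<close>, set up for a monotone class
  argument: it is stable under linear combinations and bounded pointwise limits, and turns out to be
  all of \<open>Bd\<close>.\<close>

definition step_closure :: "(real \<Rightarrow> real) set" where
  "step_closure = {\<phi> \<in> Bd. \<forall>e>0. \<exists>h Z. elem h Z \<and> q (\<lambda>u. \<phi> u - h u) < e}"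

lemma step_closure_sequence:
  assumes "\<phi> \<in> step_closure"
  obtains h Z where "\<And>n. elem (h n) (Z n)" "(\<lambda>n. q (\<lambda>u. \<phi> u - h n u)) \<longlonglongrightarrow> 0"
proof -
  have "\<exists>h Z. elem h Z \<and> q (\<lambda>u. \<phi> u - h u) < e" if "e > 0" for e
    using assms that by (auto simp: step_closure_def)
  then show ?thesis
    using approximating_sequence[of elem "\<lambda>h. q (\<lambda>u. \<phi> u - h u)"] q_nonneg that by blast
qed

lemma elem_step_closure: "elem h Z \<Longrightarrow> h \<in> step_closure"
  unfolding step_closure_def using elem_Bd by (auto intro!: exI[of _ h] simp: q_def L2_norm_def)

lemma step_closure_linear:
  assumes "\<phi> \<in> step_closure" "\<psi> \<in> step_closure"
  shows "(\<lambda>u. a * \<phi> u + b * \<psi> u) \<in> step_closure"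
proof -
  obtain h Z where h: "\<And>n. elem (h n) (Z n)" "(\<lambda>n. q (\<lambda>u. \<phi> u - h n u)) \<longlonglongrightarrow> 0"
    using step_closure_sequence[OF assms(1)] by blast
  obtain k W where k: "\<And>n. elem (k n) (W n)" "(\<lambda>n. q (\<lambda>u. \<psi> u - k n u)) \<longlonglongrightarrow> 0"
    using step_closure_sequence[OF assms(2)] by blast
  have Bd: "\<phi> \<in> Bd" "\<psi> \<in> Bd" using assms by (auto simp: step_closure_def)
  have le: "q (\<lambda>u. (a * \<phi> u + b * \<psi> u) - (a * h n u + b * k n u)) \<le> \<bar>a\<bar> * q (\<lambda>u. \<phi> u - h n u) + \<bar>b\<bar> * q (\<lambda>u. \<psi> u - k n u)" for n
  proof -
    have "(\<lambda>u. \<phi> u - h n u) \<in> Bd" "(\<lambda>u. \<psi> u - k n u) \<in> Bd"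
      using Bd_diff[OF Bd(1) elem_Bd[OF h(1)]] Bd_diff[OF Bd(2) elem_Bd[OF k(1)]] by auto
    then have "(\<lambda>u. a * (\<phi> u - h n u)) \<in> Bd" "(\<lambda>u. b * (\<psi> u - k n u)) \<in> Bd"
      using Bd_linear[of _ _ _ 0] by fastforce+
    from q_add[OF this] show ?thesis
      unfolding q_scale by (simp add: algebra_simps)
  qed
  have "(\<lambda>n. \<bar>a\<bar> * q (\<lambda>u. \<phi> u - h n u) + \<bar>b\<bar> * q (\<lambda>u. \<psi> u - k n u)) \<longlonglongrightarrow> \<bar>a\<bar> * 0 + \<bar>b\<bar> * 0"
    by (intro tendsto_intros h k)
  then have ev: "\<forall>\<^sub>F n in sequentially. \<bar>a\<bar> * q (\<lambda>u. \<phi> u - h n u) + \<bar>b\<bar> * q (\<lambda>u. \<psi> u - k n u) < e" if "e > 0" for e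
    using that by (intro order_tendstoD(2)) auto
  have "\<exists>h Z. elem h Z \<and> q (\<lambda>u. (a * \<phi> u + b * \<psi> u) - h u) < e" if e: "e > 0" for e
  proof -
    obtain n where "\<bar>a\<bar> * q (\<lambda>u. \<phi> u - h n u) + \<bar>b\<bar> * q (\<lambda>u. \<psi> u - k n u) < e"
      using ev[OF e] by (auto simp: eventually_sequentially)
    with le[of n] linear[OF h(1) k(1), of a n b n] show ?thesis
      by (meson le_less_trans)
  qed
  then show ?thesis
    using Bd by (simp add: step_closure_def Bd_linear)
qed

lemma step_closure_limit:
  assumes \<phi>: "\<And>n. \<phi> n \<in> step_closure" and \<psi>: "\<psi> \<in> borel_measurable I"
    and K: "\<And>n u. u \<in> {0..T} \<Longrightarrow> \<bar>\<phi> n u\<bar> \<le> K"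
    and lim: "\<And>u. u \<in> {0..T} \<Longrightarrow> (\<lambda>n. \<phi> n u) \<longlonglongrightarrow> \<psi> u"
  shows "\<psi> \<in> step_closure"
proof -
  have \<phi>Bd: "\<phi> n \<in> Bd" for n using \<phi> by (auto simp: step_closure_def)
  have \<psi>Bd: "\<psi> \<in> Bd"
  proof (rule BdI[OF \<psi>])
    show "\<bar>\<psi> u\<bar> \<le> K" if "u \<in> {0..T}" for u
      by (rule LIMSEQ_le_const2[OF tendsto_rabs[OF lim[OF that]]]) (use K[OF that] in auto)
  qed
  have "\<exists>h Z. elem h Z \<and> q (\<lambda>u. \<psi> u - h u) < e" if e: "e > 0" for e
  proof -
    have "(\<lambda>n. q (\<lambda>u. \<psi> u - \<phi> n u)) \<longlonglongrightarrow> 0"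
      by (rule q_tendsto[OF Bd_measurable[OF \<phi>Bd] \<psi> K lim])
    then have "\<forall>\<^sub>F n in sequentially. q (\<lambda>u. \<psi> u - \<phi> n u) < e / 2"
      using e by (intro order_tendstoD(2)) auto
    then obtain n where n: "q (\<lambda>u. \<psi> u - \<phi> n u) < e / 2"
      by (auto simp: eventually_sequentially)
    obtain h Z where h: "elem h Z" "q (\<lambda>u. \<phi> n u - h u) < e / 2"
      using \<phi>[of n] e half_gt_zero unfolding step_closure_def by blast
    have "q (\<lambda>u. (\<psi> u - \<phi> n u) + (\<phi> n u - h u)) \<le> q (\<lambda>u. \<psi> u - \<phi> n u) + q (\<lambda>u. \<phi> n u - h u)"
      by (intro q_add Bd_diff \<phi>Bd \<psi>Bd elem_Bd[OF h(1)])
    then show ?thesis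
      using n h by (intro exI[of _ h] exI[of _ Z]) auto
  qed
  then show ?thesis using \<psi>Bd by (simp add: step_closure_def)
qed

lemma step_closure_cong:
  assumes "\<phi> \<in> step_closure" "\<psi> \<in> borel_measurable I" "\<And>u. u \<in> {0..T} \<Longrightarrow> \<phi> u = \<psi> u"
  shows "\<psi> \<in> step_closure"
proof -
  obtain K where "\<And>u. u \<in> {0..T} \<Longrightarrow> \<bar>\<phi> u\<bar> \<le> K"
    using assms(1) Bd_bounded unfolding step_closure_def by blast
  then show ?thesis
    using assms by (intro step_closure_limit[of "\<lambda>_. \<phi>" \<psi> K]) auto
qed

text \<open>Dynkin's theorem with the half-lines \<open>{..a}\<close> as a generator stable under
  intersection: their traces on [0,T] are empty or intervals [0,t], whose indicators are
  elementary.\<close>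

lemma indicator_step_closure:
  assumes "A \<in> sets borel"
  shows "indicator (A \<inter> {0..T}) \<in> step_closure"
proof -
  have T: "indicator ({0..T} :: real set) \<in> step_closure"
    using base[of T] T_pos by (intro elem_step_closure) auto
  note E = elem_step_closure[OF elem_zero]
  have "Int_stable (range (\<lambda>a::real. {..a}))"
    by (auto simp: Int_stable_def)
  moreover have "range (\<lambda>a::real. {..a}) \<subseteq> Pow UNIV" by simp
  moreover have "A \<in> sigma_sets UNIV (range (\<lambda>a. {..a}))"
    using assms unfolding borel_eq_atMost by simp
  ultimately show ?thesis
  proof (induction rule: sigma_sets_induct_disjoint)
    case (basic A)
    then obtain a where a: "A = {..a}" by blast
    show ?case
    proof (cases "a < 0")
      case True
      then have "A \<inter> {0..T} = {}" using a by auto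
      then show ?thesis using E by simp
    next
      case False
      then have "A \<inter> {0..T} = {0..min a T}" using a by auto
      then show ?thesis using base[of "min a T"] T_pos False by (auto intro: elem_step_closure)
    qed
  next
    case empty
    then show ?case using E by simp
  next
    case (compl A)
    have "(indicator ((UNIV - A) \<inter> {0..T}) :: real \<Rightarrow> real) = (\<lambda>u. 1 * indicator {0..T} u + (-1) * indicator (A \<inter> {0..T}) u)"
      by (auto simp: indicator_def)
    then show ?case using step_closure_linear[OF T compl(2), of 1 "-1"] by simp
  next
    case (union A)
    have meas: "A i \<in> sets borel" for i
      using union(2) unfolding borel_eq_atMost by auto
    \<comment> \<open>The countable union is reached as a bounded limit of finite unions, whose
      indicators are sums by disjointness.\<close>
    have part: "indicator ((\<Union>i<n. A i) \<inter> {0..T}) \<in> step_closure" for n :: nat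
    proof (induction n)
      case 0
      have "(indicator ((\<Union>i<0. A i) \<inter> {0..T}) :: real \<Rightarrow> real) = (\<lambda>_. 0)"
        by (rule ext) simp
      then show ?case using E by (simp only:)
    next
      case (Suc n)
      have "A n \<inter> A i = {}" if "i < n" for i
        using union(1) that by (auto simp: disjoint_family_on_def)
      then have "A n \<inter> (\<Union>i<n. A i) = {}"
        by blast
      then have "(indicator ((\<Union>i<Suc n. A i) \<inter> {0..T}) :: real \<Rightarrow> real)
          = (\<lambda>u. 1 * indicator ((\<Union>i<n. A i) \<inter> {0..T}) u + 1 * indicator (A n \<inter> {0..T}) u)"
        by (auto simp: indicator_def fun_eq_iff less_Suc_eq)
      then show ?case using step_closure_linear[OF Suc union(3), of 1 1 n] by simp
    qed
    show ?case
    proof (rule step_closure_limit[OF part])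
      show "(indicator ((\<Union>i. A i) \<inter> {0..T}) :: real \<Rightarrow> real) \<in> borel_measurable I"
        using meas by (intro Bd_measurable indicator_Bd) auto
      show "\<bar>indicator ((\<Union>i<n. A i) \<inter> {0..T}) u :: real\<bar> \<le> 1" for n u
        by (simp add: indicator_def)
      show "(\<lambda>n. indicator ((\<Union>i<n. A i) \<inter> {0..T}) u :: real) \<longlonglongrightarrow> indicator ((\<Union>i. A i) \<inter> {0..T}) u" for u
        using LIMSEQ_indicator_UN[of "\<lambda>i. A i \<inter> {0..T}" u] by simp
    qed
  qed
qed

lemma Bd_step_closure:
  assumes "\<phi> \<in> Bd"
  shows "\<phi> \<in> step_closure"
proof -
  obtain K where K: "0 \<le> K" "\<And>u. u \<in> {0..T} \<Longrightarrow> \<bar>\<phi> u\<bar> \<le> K" using Bd_bounded[OF assms] by blast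
  \<comment> \<open>The simple functions come with
    \<open>dist (F i u) 0 \<le> 2 * dist (\<phi> u) 0\<close>; this is the source of the factor
    2.\<close>
  obtain F where F: "\<And>i. simple_function I (F i)" "\<And>u. u \<in> {0..T} \<Longrightarrow> (\<lambda>i. F i u) \<longlonglongrightarrow> \<phi> u"
      "\<And>i u. u \<in> {0..T} \<Longrightarrow> \<bar>F i u\<bar> \<le> 2 * \<bar>\<phi> u\<bar>"
    using borel_measurable_implies_sequence_metric[OF Bd_measurable[OF assms], of 0]
    unfolding space_I dist_real_def diff_0_right by blast
  have sum: "(\<lambda>u. \<Sum>y\<in>S. c y * indicator (A y) u) \<in> step_closure"
    if "finite S" "\<And>y. y \<in> S \<Longrightarrow> A y \<in> sets I" for S c and A :: "real \<Rightarrow> real set"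
    using that
  proof (induction S rule: finite_induct)
    case empty
    then show ?case using elem_step_closure[OF elem_zero] by simp
  next
    case (insert y S)
    have "A y \<in> sets I" using insert by simp
    then obtain B where "B \<in> sets borel" "A y = B \<inter> {0..T}"
      by (auto simp: sets_restrict_space)
    then have "indicator (A y) \<in> step_closure" using indicator_step_closure by simp
    moreover have "(\<lambda>u. \<Sum>y\<in>S. c y * indicator (A y) u) \<in> step_closure"
      using insert by blast
    ultimately have "(\<lambda>u. c y * indicator (A y) u + 1 * (\<Sum>y\<in>S. c y * indicator (A y) u)) \<in> step_closure"
      by (rule step_closure_linear)
    then show ?case
      unfolding sum.insert[OF insert(1,2)] by simp
  qed
  have "F i \<in> step_closure" for i
  proof (rule step_closure_cong)
    show "(\<lambda>u. \<Sum>y\<in>F i ` space I. y * indicator (F i -` {y} \<inter> space I) u) \<in> step_closure"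
      using simple_functionD[OF F(1)] by (intro sum) auto
    show "F i \<in> borel_measurable I" by (rule borel_measurable_simple_function[OF F(1)])
    show "(\<Sum>y\<in>F i ` space I. y * indicator (F i -` {y} \<inter> space I) u) = F i u" if "u \<in> {0..T}" for u
    proof -
      have "(\<Sum>y\<in>F i ` space I. y * indicator (F i -` {y} \<inter> space I) u) = (\<Sum>y\<in>F i ` space I. if y = F i u then y else 0)"
        using that by (intro sum.cong) (auto simp: indicator_def space_I)
      also have "\<dots> = F i u"
        using that simple_functionD(1)[OF F(1)] by (subst sum.delta) (auto simp: space_I)
      finally show ?thesis .
    qed
  qed
  then show ?thesis
  proof (rule step_closure_limit[OF _ Bd_measurable[OF assms]])
    show "\<bar>F i u\<bar> \<le> 2 * K" if "u \<in> {0..T}" for i u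
      using F(3)[OF that, of i] K(2)[OF that] by linarith
  qed (rule F(2))
qed

text \<open>With \<open>\<delta> n\<close> = \<phi> - h_n and \<open>\<eta> n\<close> = \<psi> -
  k_n, the form at (\<phi> - \<delta>, \<psi> - \<eta>) expands into the limit and three error
  terms, each of which tends to 0 by \<open>ip_le_q\<close>.\<close>

lemma ip_tendsto_q:
  assumes "\<phi> \<in> Bd" "\<psi> \<in> Bd" "\<And>n. h n \<in> Bd" "\<And>n. k n \<in> Bd"
    and h: "(\<lambda>n. q (\<lambda>u. \<phi> u - h n u)) \<longlonglongrightarrow> 0" and k: "(\<lambda>n. q (\<lambda>u. \<psi> u - k n u)) \<longlonglongrightarrow> 0"
  shows "(\<lambda>n. ip (h n) (k n)) \<longlonglongrightarrow> ip \<phi> \<psi>"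
proof -
  have L: "\<phi> \<in> L_mu T \<mu>" "\<psi> \<in> L_mu T \<mu>" "h n \<in> L_mu T \<mu>" "k n \<in> L_mu T \<mu>" for n
    using assms Bd_L_mu by auto
  have zero: "(\<lambda>n. ip (\<phi>' n) (\<psi>' n)) \<longlonglongrightarrow> 0"
    if "\<And>n. \<phi>' n \<in> Bd" "\<And>n. \<psi>' n \<in> Bd" "(\<lambda>n. q (\<phi>' n) * q (\<psi>' n)) \<longlonglongrightarrow> 0" for \<phi>' \<psi>'
    by (rule tendsto_0_le[OF that(3), of _ 1]) (use ip_le_q[OF that(1,2)] q_nonneg in auto)
  define \<delta> \<eta> where "\<delta> n = (\<lambda>u. \<phi> u - h n u)" and "\<eta> n = (\<lambda>u. \<psi> u - k n u)" for n
  have Bd: "\<delta> n \<in> Bd" "\<eta> n \<in> Bd" for n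
    using assms by (auto simp: \<delta>_def \<eta>_def Bd_diff)
  have lim: "(\<lambda>n. q (\<delta> n)) \<longlonglongrightarrow> 0" "(\<lambda>n. q (\<eta> n)) \<longlonglongrightarrow> 0"
    using h k by (auto simp: \<delta>_def \<eta>_def)
  have "(\<lambda>n. ip \<phi> \<psi> - ip (\<delta> n) \<psi> - ip \<phi> (\<eta> n) + ip (\<delta> n) (\<eta> n)) \<longlonglongrightarrow> ip \<phi> \<psi> - 0 - 0 + 0"
    using assms Bd tendsto_mult[OF lim] tendsto_mult_left[OF lim(1), of "q \<psi>"] tendsto_mult_left[OF lim(2), of "q \<phi>"]
    by (intro tendsto_add tendsto_diff tendsto_const zero) (auto simp: mult.commute)
  moreover have "ip \<phi> \<psi> - ip (\<delta> n) \<psi> - ip \<phi> (\<eta> n) + ip (\<delta> n) (\<eta> n) = ip (h n) (k n)" for n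
    unfolding \<delta>_def \<eta>_def using L by (simp add: ip_diff_left ip_diff_right L_mu_diff)
  ultimately show ?thesis by simp
qed

section \<open>Truncation; symmetry and positivity on all of \<open>L_mu\<close>\<close>

definition trunc :: "nat \<Rightarrow> (real \<Rightarrow> real) \<Rightarrow> real \<Rightarrow> real" where
  "trunc n \<phi> u = (if \<bar>\<phi> u\<bar> \<le> real n then \<phi> u else 0)"

lemma trunc_Bd:
  assumes "\<phi> \<in> borel_measurable I"
  shows "trunc n \<phi> \<in> Bd"
proof (rule BdI[where K="real n"])
  show "trunc n \<phi> \<in> borel_measurable I"
    using assms unfolding trunc_def by measurable
qed (auto simp: trunc_def)

lemma trunc_eventually: "\<forall>\<^sub>F n in sequentially. trunc n \<phi> u = \<phi> u"
proof -
  obtain N :: nat where "\<bar>\<phi> u\<bar> \<le> real N" using real_arch_simple by blast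
  then show ?thesis
    unfolding eventually_sequentially by (intro exI[of _ N]) (auto simp: trunc_def)
qed

text \<open>The substitute for \<open>q\<close> on unbounded functions: dominated convergence with
  the majorant |\<phi>(u)| |\<psi>(v)|, which is integrable by
  \<open>integrable_tensor\<close>.\<close>

lemma ip_tendsto_dominated:
  assumes "\<phi> \<in> L_mu T \<mu>" "\<psi> \<in> L_mu T \<mu>" "\<And>n. f n \<in> borel_measurable I" "\<And>n. g n \<in> borel_measurable I"
    and meas: "f' \<in> borel_measurable I" "g' \<in> borel_measurable I"
    and bound: "\<And>n u. \<bar>f n u\<bar> \<le> \<bar>\<phi> u\<bar>" "\<And>n u. \<bar>g n u\<bar> \<le> \<bar>\<psi> u\<bar>"
    and lim: "\<And>u. (\<lambda>n. f n u) \<longlonglongrightarrow> f' u" "\<And>u. (\<lambda>n. g n u) \<longlonglongrightarrow> g' u"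
  shows "(\<lambda>n. ip (f n) (g n)) \<longlonglongrightarrow> ip f' g'"
  unfolding H_inner_def
proof (rule signed_integral_tendsto[OF measurable_tensor measurable_tensor integrable_tensor[OF L_mu_abs L_mu_abs]])
  show "AE x in \<Lambda>. (\<lambda>i. case x of (u, v) \<Rightarrow> f i u * g i v) \<longlonglongrightarrow> (case x of (u, v) \<Rightarrow> f' u * g' v)"
    by (auto intro!: tendsto_mult lim)
  show "AE x in \<Lambda>. \<bar>case x of (u, v) \<Rightarrow> f i u * g i v\<bar> \<le> (case x of (u, v) \<Rightarrow> \<bar>\<phi> u\<bar> * \<bar>\<psi> v\<bar>)" for i
    by (intro AE_I2) (auto simp: abs_mult intro!: mult_mono bound)
qed (fact assms)+

lemma ip_trunc_tendsto:
  assumes "\<phi> \<in> L_mu T \<mu>" "\<psi> \<in> L_mu T \<mu>"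
  shows "(\<lambda>n. ip (trunc n \<phi>) (trunc n \<psi>)) \<longlonglongrightarrow> ip \<phi> \<psi>"
proof (rule ip_tendsto_dominated[OF assms])
  show "(\<lambda>n. trunc n \<phi> u) \<longlonglongrightarrow> \<phi> u" "(\<lambda>n. trunc n \<psi> u) \<longlonglongrightarrow> \<psi> u" for u
    by (intro tendsto_eventually trunc_eventually)+
  show "trunc n \<phi> \<in> borel_measurable I" "trunc n \<psi> \<in> borel_measurable I" for n
    using Bd_measurable[OF trunc_Bd[OF L_mu_measurable]] assms by auto
qed (use assms in \<open>auto simp: trunc_def L_mu_measurable\<close>)

text \<open>Nothing in the definition of \<open>H_inner\<close> makes it symmetric, and the symmetry
  of \<mu> is given only on rectangles. It is imported from E(ZW) = E(WZ) on step functions, then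
  carried to bounded functions by \<open>q\<close> and to \<open>L_mu\<close> by truncation.\<close>

lemma ip_commute:
  assumes "\<phi> \<in> L_mu T \<mu>" "\<psi> \<in> L_mu T \<mu>"
  shows "ip \<phi> \<psi> = ip \<psi> \<phi>"
proof -
  have Bd: "ip \<phi> \<psi> = ip \<psi> \<phi>" if b: "\<phi> \<in> Bd" "\<psi> \<in> Bd" for \<phi> \<psi>
  proof -
    obtain h Z where h: "\<And>n. elem (h n) (Z n)" "(\<lambda>n. q (\<lambda>u. \<phi> u - h n u)) \<longlonglongrightarrow> 0"
      using step_closure_sequence[OF Bd_step_closure[OF b(1)]] by blast
    obtain k W where k: "\<And>n. elem (k n) (W n)" "(\<lambda>n. q (\<lambda>u. \<psi> u - k n u)) \<longlonglongrightarrow> 0"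
      using step_closure_sequence[OF Bd_step_closure[OF b(2)]] by blast
    have "(\<lambda>n. ip (h n) (k n)) \<longlonglongrightarrow> ip \<phi> \<psi>" "(\<lambda>n. ip (k n) (h n)) \<longlonglongrightarrow> ip \<psi> \<phi>"
      using b h k by (auto intro!: ip_tendsto_q elem_Bd)
    moreover have "ip (h n) (k n) = ip (k n) (h n)" for n
      using expectation_elem[OF h(1)[of n] k(1)[of n]] expectation_elem[OF k(1)[of n] h(1)[of n]]
      by (simp add: mult.commute)
    ultimately show ?thesis using LIMSEQ_unique by simp
  qed
  have "ip (trunc n \<phi>) (trunc n \<psi>) = ip (trunc n \<psi>) (trunc n \<phi>)" for n
    using assms by (intro Bd trunc_Bd L_mu_measurable)
  then show ?thesis
    using ip_trunc_tendsto[OF assms] ip_trunc_tendsto[OF assms(2,1)] LIMSEQ_unique by simp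
qed

lemma ip_nonneg:
  assumes "\<phi> \<in> L_mu T \<mu>"
  shows "0 \<le> ip \<phi> \<phi>"
proof -
  have Bd: "0 \<le> ip \<phi> \<phi>" if b: "\<phi> \<in> Bd" for \<phi>
  proof -
    obtain h Z where h: "\<And>n. elem (h n) (Z n)" "(\<lambda>n. q (\<lambda>u. \<phi> u - h n u)) \<longlonglongrightarrow> 0"
      using step_closure_sequence[OF Bd_step_closure[OF b]] by blast
    have lim: "(\<lambda>n. ip (h n) (h n)) \<longlonglongrightarrow> ip \<phi> \<phi>"
      using b h by (auto intro!: ip_tendsto_q elem_Bd)
    have "0 \<le> ip (h n) (h n)" for n
      unfolding expectation_elem[OF h(1)[of n] h(1)[of n], symmetric] by simp
    then show ?thesis by (intro LIMSEQ_le_const[OF lim]) auto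
  qed
  have "0 \<le> ip (trunc n \<phi>) (trunc n \<phi>)" for n
    using assms by (intro Bd trunc_Bd L_mu_measurable)
  then show ?thesis
    by (intro LIMSEQ_le_const[OF ip_trunc_tendsto[OF assms assms]]) auto
qed

theorem semiscalar_product_H_inner: "semiscalar_product (L_mu T \<mu>) ip"
  unfolding semiscalar_product_def using ip_commute ip_nonneg ip_linear_left by auto

section \<open>The seminorm and the density of step functions\<close>

lemma hn_power2: "\<phi> \<in> L_mu T \<mu> \<Longrightarrow> (hn \<phi>)\<^sup>2 = ip \<phi> \<phi>"
  by (simp add: H_norm_def ip_nonneg)

lemma hn_nonneg: "\<phi> \<in> L_mu T \<mu> \<Longrightarrow> 0 \<le> hn \<phi>"
  by (simp add: H_norm_def ip_nonneg)

lemma ip_linear_square: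
  assumes "\<phi> \<in> L_mu T \<mu>" "\<psi> \<in> L_mu T \<mu>"
  shows "ip (\<lambda>u. 1 * \<phi> u + x * \<psi> u) (\<lambda>u. 1 * \<phi> u + x * \<psi> u) = ip \<phi> \<phi> + 2 * x * ip \<phi> \<psi> + x\<^sup>2 * ip \<psi> \<psi>"
  unfolding ip_linear_left[OF assms L_mu_linear[OF assms]] ip_linear_right[OF assms assms(1)]
    ip_linear_right[OF assms assms(2)] ip_commute[OF assms(2,1)]
  by (simp add: algebra_simps power2_eq_square)

lemma
  assumes "\<phi> \<in> L_mu T \<mu>" "\<psi> \<in> L_mu T \<mu>"
  shows ip_Cauchy_Schwarz: "(ip \<phi> \<psi>)\<^sup>2 \<le> ip \<phi> \<phi> * ip \<psi> \<psi>"
    and hn_triangle: "hn (\<lambda>u. \<phi> u + \<psi> u) \<le> hn \<phi> + hn \<psi>"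
proof -
  have "0 \<le> ip \<phi> \<phi> + 2 * x * ip \<phi> \<psi> + x\<^sup>2 * ip \<psi> \<psi>" for x
    unfolding ip_linear_square[OF assms, symmetric] by (intro ip_nonneg L_mu_linear assms)
  note * = semidefinite_form[OF this ip_nonneg[OF assms(2)]]
  show "(ip \<phi> \<psi>)\<^sup>2 \<le> ip \<phi> \<phi> * ip \<psi> \<psi>" by (rule *)
  show "hn (\<lambda>u. \<phi> u + \<psi> u) \<le> hn \<phi> + hn \<psi>"
    using *(2) ip_linear_square[OF assms, of 1] by (simp add: H_norm_def)
qed

lemma hn_scale:
  assumes "\<phi> \<in> L_mu T \<mu>"
  shows "hn (\<lambda>u. a * \<phi> u) = \<bar>a\<bar> * hn \<phi>"
proof -
  have "ip (\<lambda>u. a * \<phi> u) (\<lambda>u. a * \<phi> u) = a\<^sup>2 * ip \<phi> \<phi>"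
    using ip_linear_left[OF assms assms L_mu_linear[OF assms assms, of a 0], of a 0]
      ip_linear_right[OF assms assms assms, of a 0] by (simp add: power2_eq_square)
  then show ?thesis by (simp add: H_norm_def real_sqrt_mult)
qed

lemma hn_minus_commute:
  assumes "\<phi> \<in> L_mu T \<mu>" "\<psi> \<in> L_mu T \<mu>"
  shows "hn (\<lambda>u. \<phi> u - \<psi> u) = hn (\<lambda>u. \<psi> u - \<phi> u)"
  using hn_scale[OF L_mu_diff[OF assms], of "-1"] by simp

lemma hn_diff_le:
  assumes "\<phi> \<in> L_mu T \<mu>" "\<psi> \<in> L_mu T \<mu>"
  shows "\<bar>hn \<phi> - hn \<psi>\<bar> \<le> hn (\<lambda>u. \<phi> u - \<psi> u)"
  using hn_triangle[OF L_mu_diff[OF assms] assms(2)] hn_triangle[OF L_mu_diff[OF assms(2,1)] assms(1)]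
    hn_minus_commute[OF assms] by simp

lemma elem_hn: "elem h Z \<Longrightarrow> L2_norm M Z = hn h"
  using expectation_elem[of h Z h Z] by (simp add: L2_norm_def H_norm_def power2_eq_square)

text \<open>Truncation comes first because \<open>q\<close> controls bounded functions only: the
  tail \<phi> - \<open>trunc n \<phi>\<close> is small in \<open>H_norm\<close> by dominated
  convergence, and the bounded part is approximated in \<open>q\<close>, which dominates
  \<open>H_norm\<close> on \<open>Bd\<close> by \<open>ip_le_q\<close>.\<close>

lemma elem_hn_dense:
  assumes "\<phi> \<in> L_mu T \<mu>" "e > 0"
  shows "\<exists>h Z. elem h Z \<and> hn (\<lambda>u. \<phi> u - h u) < e"
proof -
  have "(\<lambda>n. ip (\<lambda>u. \<phi> u - trunc n \<phi> u) (\<lambda>u. \<phi> u - trunc n \<phi> u)) \<longlonglongrightarrow> ip (\<lambda>_. 0) (\<lambda>_. 0)"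
  proof (rule ip_tendsto_dominated[OF assms(1) assms(1)])
    show "(\<lambda>n. \<phi> u - trunc n \<phi> u) \<longlonglongrightarrow> 0" "(\<lambda>n. \<phi> u - trunc n \<phi> u) \<longlonglongrightarrow> 0" for u
      using trunc_eventually[of \<phi> u] by (auto intro!: tendsto_eventually elim: eventually_mono)
    show "(\<lambda>u. \<phi> u - trunc n \<phi> u) \<in> borel_measurable I" "(\<lambda>u. \<phi> u - trunc n \<phi> u) \<in> borel_measurable I" for n
      using L_mu_measurable[OF assms(1)] Bd_measurable[OF trunc_Bd] by (auto intro: borel_measurable_diff)
  qed (auto simp: trunc_def)
  then have "(\<lambda>n. hn (\<lambda>u. \<phi> u - trunc n \<phi> u)) \<longlonglongrightarrow> sqrt (ip (\<lambda>_. 0) (\<lambda>_. 0))"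
    unfolding H_norm_def by (rule tendsto_real_sqrt)
  moreover have "ip (\<lambda>_. 0) (\<lambda>_. 0) = 0"
    by (simp add: H_inner_def signed_integral_def case_prod_beta)
  ultimately have "\<forall>\<^sub>F n in sequentially. hn (\<lambda>u. \<phi> u - trunc n \<phi> u) < e / 2"
    using assms(2) by (intro order_tendstoD(2)) auto
  then obtain n where n: "hn (\<lambda>u. \<phi> u - trunc n \<phi> u) < e / 2"
    by (auto simp: eventually_sequentially)
  have tB: "trunc n \<phi> \<in> Bd" by (intro trunc_Bd L_mu_measurable assms)
  then obtain h Z where h: "elem h Z" "q (\<lambda>u. trunc n \<phi> u - h u) < e / 2"
    using Bd_step_closure[OF tB] half_gt_zero[OF assms(2)] unfolding step_closure_def by blast
  have dB: "(\<lambda>u. trunc n \<phi> u - h u) \<in> Bd" using tB elem_Bd[OF h(1)] by (rule Bd_diff)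
  have "hn (\<lambda>u. trunc n \<phi> u - h u) \<le> q (\<lambda>u. trunc n \<phi> u - h u)"
    unfolding H_norm_def using ip_le_q[OF dB dB] q_nonneg
    by (intro real_le_lsqrt) (auto simp: power2_eq_square)
  moreover have "hn (\<lambda>u. (\<phi> u - trunc n \<phi> u) + (trunc n \<phi> u - h u)) \<le> hn (\<lambda>u. \<phi> u - trunc n \<phi> u) + hn (\<lambda>u. trunc n \<phi> u - h u)"
    using tB Bd_L_mu by (intro hn_triangle L_mu_diff assms(1) elem_L_mu[OF h(1)]) auto
  ultimately have "hn (\<lambda>u. \<phi> u - h u) < e" using n h by simp
  then show ?thesis using h by blast
qed

text \<open>The closure of \<open>elem\<close> for the two seminorms taken together; over
  \<open>L_mu\<close> this is the graph of the extended isometry. A single pair (h, Z) has to be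
  close in both coordinates at once.\<close>

definition represents :: "(real \<Rightarrow> real) \<Rightarrow> ('a \<Rightarrow> real) \<Rightarrow> bool" where
  "represents \<phi> Y \<longleftrightarrow> Y \<in> L2_space M \<and>
     (\<forall>e>0. \<exists>h Z. elem h Z \<and> hn (\<lambda>u. \<phi> u - h u) < e \<and> L2_norm M (\<lambda>\<omega>. Y \<omega> - Z \<omega>) < e)"

lemma representsE:
  assumes "represents \<phi> Y" "e > 0"
  obtains h Z where "elem h Z" "hn (\<lambda>u. \<phi> u - h u) < e" "L2_norm M (\<lambda>\<omega>. Y \<omega> - Z \<omega>) < e"
  using assms unfolding represents_def by blast

lemma represents_L2: "represents \<phi> Y \<Longrightarrow> Y \<in> L2_space M"
  by (simp add: represents_def)

text \<open>The isometry turns step functions approximating \<phi> into a Cauchy sequence in L2, and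
  completeness supplies the limit.\<close>

lemma represents_exists:
  assumes \<phi>: "\<phi> \<in> L_mu T \<mu>"
  shows "\<exists>Y. represents \<phi> Y"
proof -
  obtain h Z where hZ: "\<And>n. elem (h n) (Z n)" and lim: "(\<lambda>n. hn (\<lambda>u. \<phi> u - h n u)) \<longlonglongrightarrow> 0"
    using approximating_sequence[of elem "\<lambda>h. hn (\<lambda>u. \<phi> u - h u)"] elem_hn_dense[OF \<phi>]
      hn_nonneg[OF L_mu_diff[OF \<phi> elem_L_mu]] by blast
  obtain Y where Y: "Y \<in> L2_space M" "(\<lambda>n. L2_norm M (\<lambda>\<omega>. Z n \<omega> - Y \<omega>)) \<longlonglongrightarrow> 0"
  proof (rule L2_complete)
    show "Z n \<in> L2_space M" for n using hZ by (rule elem_L2)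
    fix e :: real assume e: "e > 0"
    then have "\<forall>\<^sub>F n in sequentially. hn (\<lambda>u. \<phi> u - h n u) < e / 2"
      using lim by (intro order_tendstoD(2)) auto
    then obtain N where N: "\<And>n. n \<ge> N \<Longrightarrow> hn (\<lambda>u. \<phi> u - h n u) < e / 2"
      by (auto simp: eventually_sequentially)
    have "L2_norm M (\<lambda>\<omega>. Z i \<omega> - Z j \<omega>) < e" if "i \<ge> N" "j \<ge> N" for i j
    proof -
      have L: "h n \<in> L_mu T \<mu>" for n using hZ by (rule elem_L_mu)
      have "L2_norm M (\<lambda>\<omega>. Z i \<omega> - Z j \<omega>) = hn (\<lambda>u. h i u - h j u)"
        by (intro elem_hn elem_diff hZ)
      also have "\<dots> = hn (\<lambda>u. (h i u - \<phi> u) + (\<phi> u - h j u))"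
        by simp
      also have "\<dots> \<le> hn (\<lambda>u. h i u - \<phi> u) + hn (\<lambda>u. \<phi> u - h j u)"
        by (intro hn_triangle L_mu_diff L \<phi>)
      also have "\<dots> < e / 2 + e / 2"
        using N[OF that(1)] N[OF that(2)] hn_minus_commute[OF \<phi> L, of i] by linarith
      finally show ?thesis by simp
    qed
    then show "\<exists>N. \<forall>i\<ge>N. \<forall>j\<ge>N. L2_norm M (\<lambda>\<omega>. Z i \<omega> - Z j \<omega>) < e" by blast
  qed blast
  have "\<exists>h Z. elem h Z \<and> hn (\<lambda>u. \<phi> u - h u) < e \<and> L2_norm M (\<lambda>\<omega>. Y \<omega> - Z \<omega>) < e" if "e > 0" for e
  proof -
    have "\<forall>\<^sub>F n in sequentially. hn (\<lambda>u. \<phi> u - h n u) < e \<and> L2_norm M (\<lambda>\<omega>. Z n \<omega> - Y \<omega>) < e"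
      using that by (intro eventually_conj order_tendstoD(2)[OF lim] order_tendstoD(2)[OF Y(2)])
    then obtain n where "hn (\<lambda>u. \<phi> u - h n u) < e" "L2_norm M (\<lambda>\<omega>. Z n \<omega> - Y \<omega>) < e"
      by (auto simp: eventually_sequentially)
    then show ?thesis
      using hZ[of n] L2_norm_minus_commute[of M Y "Z n"] by (intro exI[of _ "h n"] exI[of _ "Z n"]) simp
  qed
  then show ?thesis using Y(1) unfolding represents_def by blast
qed

lemma represents_norm:
  assumes "represents \<phi> Y" "\<phi> \<in> L_mu T \<mu>"
  shows "L2_norm M Y = hn \<phi>"
proof -
  have "\<bar>L2_norm M Y - hn \<phi>\<bar> \<le> e" if e: "e > 0" for e
  proof -
    obtain h Z where h: "elem h Z" "hn (\<lambda>u. \<phi> u - h u) < e / 2" "L2_norm M (\<lambda>\<omega>. Y \<omega> - Z \<omega>) < e / 2"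
      using representsE[OF assms(1), of "e / 2"] e by auto
    then show ?thesis
      using L2_norm_diff_le[OF represents_L2[OF assms(1)] elem_L2[OF h(1)]] hn_diff_le[OF assms(2) elem_L_mu[OF h(1)]]
        elem_hn[OF h(1)] by linarith
  qed
  then show ?thesis
    by (metis abs_le_zero_iff eq_iff_diff_eq_0 field_le_epsilon add_0)
qed

lemma represents_linear:
  assumes "represents \<phi> Y" "represents \<psi> Z" "\<phi> \<in> L_mu T \<mu>" "\<psi> \<in> L_mu T \<mu>"
  shows "represents (\<lambda>u. a * \<phi> u + b * \<psi> u) (\<lambda>\<omega>. a * Y \<omega> + b * Z \<omega>)"
  unfolding represents_def
proof (intro conjI allI impI)
  show "(\<lambda>\<omega>. a * Y \<omega> + b * Z \<omega>) \<in> L2_space M"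
    using assms by (intro L2_space_linear represents_L2)
  fix e :: real assume e: "e > 0"
  \<comment> \<open>The summand 1 keeps the denominator positive and leaves (|a| + |b|) d strictly
    below e.\<close>
  define d where "d = e / (\<bar>a\<bar> + \<bar>b\<bar> + 1)"
  have d: "d > 0" "\<bar>a\<bar> * d + \<bar>b\<bar> * d < e"
    using e by (auto simp: d_def field_simps add_pos_nonneg)
  obtain h V where h: "elem h V" "hn (\<lambda>u. \<phi> u - h u) < d" "L2_norm M (\<lambda>\<omega>. Y \<omega> - V \<omega>) < d"
    using representsE[OF assms(1) d(1)] by blast
  obtain k W where k: "elem k W" "hn (\<lambda>u. \<psi> u - k u) < d" "L2_norm M (\<lambda>\<omega>. Z \<omega> - W \<omega>) < d"
    using representsE[OF assms(2) d(1)] by blast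
  have L: "(\<lambda>u. \<phi> u - h u) \<in> L_mu T \<mu>" "(\<lambda>u. \<psi> u - k u) \<in> L_mu T \<mu>"
    using L_mu_diff[OF assms(3) elem_L_mu[OF h(1)]] L_mu_diff[OF assms(4) elem_L_mu[OF k(1)]] .
  have L': "(\<lambda>u. a * (\<phi> u - h u)) \<in> L_mu T \<mu>" "(\<lambda>u. b * (\<psi> u - k u)) \<in> L_mu T \<mu>"
    using L_mu_linear[OF L(1) L(1), of a 0] L_mu_linear[OF L(2) L(2), of b 0] by simp_all
  have "\<bar>a\<bar> * hn (\<lambda>u. \<phi> u - h u) \<le> \<bar>a\<bar> * d" "\<bar>b\<bar> * hn (\<lambda>u. \<psi> u - k u) \<le> \<bar>b\<bar> * d"
    using h k by (auto intro!: mult_left_mono)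
  then have "hn (\<lambda>u. a * \<phi> u + b * \<psi> u - (a * h u + b * k u)) < e"
    using hn_triangle[OF L'] d(2) unfolding hn_scale[OF L(1)] hn_scale[OF L(2)]
    by (simp add: algebra_simps)
  moreover have P: "(\<lambda>\<omega>. Y \<omega> - V \<omega>) \<in> L2_space M" "(\<lambda>\<omega>. Z \<omega> - W \<omega>) \<in> L2_space M"
    using L2_space_diff[OF represents_L2[OF assms(1)] elem_L2[OF h(1)]]
      L2_space_diff[OF represents_L2[OF assms(2)] elem_L2[OF k(1)]] .
  have P': "(\<lambda>\<omega>. a * (Y \<omega> - V \<omega>)) \<in> L2_space M" "(\<lambda>\<omega>. b * (Z \<omega> - W \<omega>)) \<in> L2_space M"
    using L2_space_linear[OF P(1) P(1), of a 0] L2_space_linear[OF P(2) P(2), of b 0] by simp_all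
  have sc: "L2_norm M (\<lambda>\<omega>. c * U \<omega>) = \<bar>c\<bar> * L2_norm M U" for c U
    by (simp add: L2_norm_def power_mult_distrib real_sqrt_mult)
  have "\<bar>a\<bar> * L2_norm M (\<lambda>\<omega>. Y \<omega> - V \<omega>) \<le> \<bar>a\<bar> * d" "\<bar>b\<bar> * L2_norm M (\<lambda>\<omega>. Z \<omega> - W \<omega>) \<le> \<bar>b\<bar> * d"
    using h k by (auto intro!: mult_left_mono)
  then have "L2_norm M (\<lambda>\<omega>. a * Y \<omega> + b * Z \<omega> - (a * V \<omega> + b * W \<omega>)) < e"
    using L2_norm_triangle[OF P'] d(2) unfolding sc
    by (simp add: algebra_simps)
  ultimately show "\<exists>h Z'. elem h Z' \<and> hn (\<lambda>u. a * \<phi> u + b * \<psi> u - h u) < e \<and>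
      L2_norm M (\<lambda>\<omega>. a * Y \<omega> + b * Z \<omega> - Z' \<omega>) < e"
    using linear[OF h(1) k(1)] by blast
qed

text \<open>The isometry for differences yields both the uniqueness of representatives and the
  continuity of the extension.\<close>

lemma represents_diff_norm:
  assumes "represents \<phi> Y" "represents \<psi> Z" "\<phi> \<in> L_mu T \<mu>" "\<psi> \<in> L_mu T \<mu>"
  shows "L2_norm M (\<lambda>\<omega>. Y \<omega> - Z \<omega>) = hn (\<lambda>u. \<phi> u - \<psi> u)"
  using represents_norm[OF represents_linear[OF assms, of 1 "-1"] L_mu_linear[OF assms(3,4)]] by simp

lemma represents_AE_eq:
  assumes "represents \<phi> Y" "represents \<phi> Z" "\<phi> \<in> L_mu T \<mu>"
  shows "AE \<omega> in M. Y \<omega> = Z \<omega>"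
proof (rule AE_eq_if_L2_norm_0)
  have "hn (\<lambda>u. \<phi> u - \<phi> u) = 0"
    by (simp add: H_norm_def H_inner_def signed_integral_def case_prod_beta)
  then show "L2_norm M (\<lambda>\<omega>. Y \<omega> - Z \<omega>) = 0"
    using represents_diff_norm[OF assms(1,2,3,3)] by simp
qed (use assms in \<open>auto intro: represents_L2\<close>)

end

section \<open>The forward integral\<close>

text \<open>The bound \<open>K\<close> and the finiteness of all measures involved make the
  integrand integrable, so the usual Fubini theorem applies to each of the two variations.\<close>

lemma (in finite_measure) signed_integral_Fubini:
  fixes f :: "'a \<Rightarrow> 'b \<Rightarrow> real"
  assumes sm: "signed_measure N \<mu>"
    and f: "case_prod f \<in> borel_measurable (M \<Otimes>\<^sub>M N)"
    and K: "\<And>s x. s \<in> space M \<Longrightarrow> x \<in> space N \<Longrightarrow> \<bar>f s x\<bar> \<le> K"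
  shows "signed_integral N \<mu> (\<lambda>x. \<integral>s. f s x \<partial>M) = (\<integral>s. signed_integral N \<mu> (f s) \<partial>M)"
proof -
  have *: "(\<integral>x. (\<integral>s. f s x \<partial>M) \<partial>P) = (\<integral>s. (\<integral>x. f s x \<partial>P) \<partial>M) \<and> integrable M (\<lambda>s. \<integral>x. f s x \<partial>P)"
    if P: "finite_measure P" "sets P = sets N" for P
  proof -
    interpret P: finite_measure P by fact
    interpret pair_sigma_finite M P ..
    have fin: "finite_measure (M \<Otimes>\<^sub>M P)"
      by (rule finite_measure_pair_measure) unfold_locales
    have "case_prod f \<in> borel_measurable (M \<Otimes>\<^sub>M P)"
      using f unfolding measurable_cong_sets[OF sets_pair_measure_cong[OF refl P(2)] refl] .
    then have int: "integrable (M \<Otimes>\<^sub>M P) (case_prod f)"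
      using K sets_eq_imp_space_eq[OF P(2)]
      by (intro finite_measure.integrable_const_bound[OF fin, of _ K]) (auto simp: space_pair_measure)
    show ?thesis
      using Fubini_integral[OF int] integrable_fst[OF int] by simp
  qed
  show ?thesis
    unfolding signed_integral_def
    using *[OF finite_pos_variation[OF sm] sets_pos_variation] *[OF finite_neg_variation[OF sm] sets_neg_variation]
    by simp
qed

locale covariance_measure_cadlag_process = covariance_measure_process M T X \<mu>
  for M :: "'a measure" and T X \<mu> +
  assumes cadlag: "cadlag_process M T X"
    and L2_cont: "L2_continuous M T X"
    and start: "AE \<omega> in M. X 0 \<omega> = 0"
begin

section \<open>Lines parallel to the axes are null for |\<mu>|\<close>

lemma indicator_atMost_Bd: "indicator {0..t} \<in> Bd"
  using BV_Bd indicator_atMost_BV by blast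

lemma indicator_atMost_L_mu: "indicator {0..t} \<in> L_mu T \<mu>"
  using indicator_atMost_Bd Bd_L_mu by blast

text \<open>{u} is the limit of the intervals ]s_n, u] with s_n increasing to u; their indicators
  correspond to X_u - X_(s_n), which tends to 0 in L2 by L2-continuity. At u = 0 there is no room on
  the left, but {0} = [0,0] corresponds to X_0, which vanishes almost surely.\<close>

lemma ip_indicator_singleton:
  assumes u: "u \<in> {0..T}"
  shows "ip (indicator {u}) (indicator {u}) = 0"
proof (cases "u = 0")
  case True
  have "expectation (\<lambda>\<omega>. X 0 \<omega> * X 0 \<omega>) = expectation (\<lambda>_. 0)"
    using start X_L2[of 0] T_pos by (intro integral_cong_AE) (auto dest: L2_spaceD)
  then show ?thesis
    using ip_indicator_X[of 0 0] T_pos True by simp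
next
  case False
  then have u0: "0 < u" using u by auto
  \<comment> \<open>These times start at 0 and stay strictly below \<open>u\<close>, so they lie in
    [0,T] and avoid \<open>u\<close>, as convergence along \<open>at u within {0..T}\<close>
    demands.\<close>
  define s where "s n = u - u / real (Suc n)" for n
  have s_lim: "s \<longlonglongrightarrow> u - 0"
    unfolding s_def using LIMSEQ_Suc[OF lim_const_over_n[of u]] by (intro tendsto_diff tendsto_const)
  have s_in: "0 \<le> s n" "s n < u" for n
    using u0 by (auto simp: s_def field_simps)
  define f :: "nat \<Rightarrow> real \<Rightarrow> real" where "f n = (\<lambda>v. indicator {0..u} v - indicator {0..s n} v)" for n
  have elem_f: "elem (f n) (\<lambda>\<omega>. X u \<omega> - X (s n) \<omega>)" for n
    unfolding f_def using u s_in[of n] by (intro elem_diff base) auto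
  have "((\<lambda>t. L2_norm M (\<lambda>\<omega>. X t \<omega> - X u \<omega>)) \<longlongrightarrow> 0) (at u within {0..T})"
    using L2_cont u by (auto simp: L2_continuous_def tendsto_L2_def)
  moreover have "filterlim s (at u within {0..T}) sequentially"
    unfolding filterlim_at using s_lim s_in u
    by (auto intro!: always_eventually simp: less_imp_neq) (meson less_le_trans less_imp_le)
  ultimately have "(\<lambda>n. L2_norm M (\<lambda>\<omega>. X (s n) \<omega> - X u \<omega>)) \<longlonglongrightarrow> 0"
    by (rule filterlim_compose)
  then have "(\<lambda>n. (L2_norm M (\<lambda>\<omega>. X (s n) \<omega> - X u \<omega>))\<^sup>2) \<longlonglongrightarrow> 0\<^sup>2"
    by (intro tendsto_intros)
  moreover have "(L2_norm M (\<lambda>\<omega>. X (s n) \<omega> - X u \<omega>))\<^sup>2 = ip (f n) (f n)" for n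
    using elem_hn[OF elem_f[of n]] L2_norm_minus_commute[of M "X u" "X (s n)"] hn_power2[OF elem_L_mu[OF elem_f[of n]]] by simp
  ultimately have "(\<lambda>n. ip (f n) (f n)) \<longlonglongrightarrow> 0" by simp
  moreover have "(\<lambda>n. ip (f n) (f n)) \<longlonglongrightarrow> ip (indicator {u}) (indicator {u})"
  proof (rule ip_tendsto_dominated[OF indicator_atMost_L_mu[of T] indicator_atMost_L_mu[of T]])
    show "f n \<in> borel_measurable I" "f n \<in> borel_measurable I" for n
      using elem_Bd[OF elem_f[of n]] by (auto intro: Bd_measurable)
    show "(indicator {u} :: real \<Rightarrow> real) \<in> borel_measurable I" "(indicator {u} :: real \<Rightarrow> real) \<in> borel_measurable I"
      using Bd_measurable[OF indicator_Bd[of "{u}"]] u by auto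
    show "\<bar>f n v\<bar> \<le> \<bar>indicator {0..T} v\<bar>" "\<bar>f n v\<bar> \<le> \<bar>indicator {0..T} v\<bar>" for n v
      using u s_in[of n] by (auto simp: f_def indicator_def)
    show "(\<lambda>n. f n v) \<longlonglongrightarrow> indicator {u} v" "(\<lambda>n. f n v) \<longlonglongrightarrow> indicator {u} v" for v
    proof -
      have "\<forall>\<^sub>F n in sequentially. f n v = indicator {u} v"
      proof (cases "0 \<le> v \<and> v < u")
        case True
        then have "\<forall>\<^sub>F n in sequentially. v < s n"
          using s_lim by (intro order_tendstoD(1)) auto
        then show ?thesis
          by eventually_elim (use True in \<open>auto simp: f_def indicator_def\<close>)
      next
        case False
        have "f n v = indicator {u} v" for n
          using False s_in[of n] u0 by (auto simp: f_def indicator_def)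
        then show ?thesis by simp
      qed
      then show "(\<lambda>n. f n v) \<longlonglongrightarrow> indicator {u} v" "(\<lambda>n. f n v) \<longlonglongrightarrow> indicator {u} v"
        by (auto intro: tendsto_eventually)
    qed
  qed
  ultimately show ?thesis by (rule LIMSEQ_unique[rotated])
qed

lemma
  assumes "u \<in> {0..T}" "B \<in> sets borel" "B \<subseteq> {0..T}"
  shows \<mu>_vertical: "\<mu> ({u} \<times> B) = 0" and \<mu>_horizontal: "\<mu> (B \<times> {u}) = 0"
proof -
  have "indicator {u} \<in> Bd" "indicator B \<in> Bd"
    using indicator_Bd[of "{u}"] indicator_Bd[of B] assms by (auto simp: Int_absorb2)
  then have L: "indicator {u} \<in> L_mu T \<mu>" "indicator B \<in> L_mu T \<mu>"
    using Bd_L_mu by auto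
  have "ip (indicator {u}) (indicator B) = 0"
    using ip_Cauchy_Schwarz[OF L] by (simp add: ip_indicator_singleton[OF assms(1)])
  then show "\<mu> ({u} \<times> B) = 0" "\<mu> (B \<times> {u}) = 0"
    using ip_indicator[of "{u}" B] ip_indicator[of B "{u}"] ip_commute[OF L] assms by auto
qed

text \<open>A measurable subset of such a line is a product of {u} with a Borel section, so \<mu>
  vanishes on every subset of the line; this is what the passage from \<mu> to |\<mu>|
  requires.\<close>

lemma null_lines:
  assumes u: "u \<in> {0..T}"
  shows "{u} \<times> {0..T} \<in> null_sets \<Lambda>" "{0..T} \<times> {u} \<in> null_sets \<Lambda>"
proof -
  have borel: "C \<in> sets (borel \<Otimes>\<^sub>M borel)" "C \<subseteq> {0..T} \<times> {0..T}" if "C \<in> sets (borel_square T)" for C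
    using that by (auto simp: sets_restrict_space_iff borel_prod[symmetric])
  show "{u} \<times> {0..T} \<in> null_sets \<Lambda>"
  proof (rule total_variation_null_setI[OF _ _ sm])
    show "{u} \<times> {0..T} \<in> sets (borel_square T)"
      using u by (auto simp: sets_restrict_space_iff borel_prod[symmetric])
    fix C assume C: "C \<in> sets (borel_square T)" "C \<subseteq> {u} \<times> {0..T}"
    then have "C = {u} \<times> (Pair u -` C)" by auto
    moreover have "\<mu> ({u} \<times> (Pair u -` C)) = 0"
      using sets_Pair1[OF borel(1)[OF C(1)]] borel(2)[OF C(1)] by (intro \<mu>_vertical u) auto
    ultimately show "\<mu> C = 0" by simp
  qed
  show "{0..T} \<times> {u} \<in> null_sets \<Lambda>"
  proof (rule total_variation_null_setI[OF _ _ sm])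
    show "{0..T} \<times> {u} \<in> sets (borel_square T)"
      using u by (auto simp: sets_restrict_space_iff borel_prod[symmetric])
    fix C assume C: "C \<in> sets (borel_square T)" "C \<subseteq> {0..T} \<times> {u}"
    then have "C = ((\<lambda>x. (x, u)) -` C) \<times> {u}" by auto
    moreover have "\<mu> (((\<lambda>x. (x, u)) -` C) \<times> {u}) = 0"
      using sets_Pair2[OF borel(1)[OF C(1)]] borel(2)[OF C(1)] by (intro \<mu>_horizontal u) auto
    ultimately show "\<mu> C = 0" by simp
  qed
qed

lemma AE_countable_lines:
  assumes "countable D" "D \<subseteq> {0..T}"
  shows "AE x in \<Lambda>. fst x \<notin> D \<and> snd x \<notin> D"
proof -
  have "(\<Union>u\<in>D. {u} \<times> {0..T}) \<in> null_sets \<Lambda>" "(\<Union>u\<in>D. {0..T} \<times> {u}) \<in> null_sets \<Lambda>"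
    using assms null_lines by (auto intro!: null_sets_UN')
  from AE_not_in[OF this(1)] AE_not_in[OF this(2)] AE_space show ?thesis
    by eventually_elim (auto simp: space_restrict_space)
qed

section \<open>Averaging an integrand over a backward window\<close>

abbreviation L :: "real measure" where
  "L \<equiv> restrict_space lborel {0..T}"

sublocale L: finite_measure L
  by (rule finite_measureI) (auto simp: space_restrict_space emeasure_restrict_space emeasure_lborel_Icc_eq)

lemma space_L: "space L = {0..T}"
  by (simp add: space_restrict_space)

lemma sets_L [measurable_cong]: "sets L = sets I"
  by (simp add: sets_restrict_space)

text \<open>As a function of \<open>u\<close>, this is the step function corresponding to \<phi>(s)
  (X_(s+\<epsilon>) - X_s) / \<epsilon>. The minimum with \<open>T\<close> reflects the constant
  extension of X beyond T.\<close>

definition kernel :: "(real \<Rightarrow> real) \<Rightarrow> real \<Rightarrow> real \<Rightarrow> real \<Rightarrow> real" where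
  "kernel \<phi> \<epsilon> s u = \<phi> s / \<epsilon> * (indicator {0..min (s + \<epsilon>) T} u - indicator {0..s} u)"

definition smear :: "(real \<Rightarrow> real) \<Rightarrow> real \<Rightarrow> real \<Rightarrow> real" where
  "smear \<phi> \<epsilon> u = (\<integral>s. kernel \<phi> \<epsilon> s u \<partial>L)"

text \<open>For \<open>u\<close> in [0,T], u lies in ]s, min(s+\<epsilon>, T)] exactly when s lies
  in [u-\<epsilon>, u[. Read in \<open>s\<close>, the kernel is thus a weight on a window to the
  left of \<open>u\<close>.\<close>

lemma kernel_eq:
  assumes "s \<in> {0..T}" "u \<in> {0..T}" "\<epsilon> > 0"
  shows "kernel \<phi> \<epsilon> s u = \<phi> s * (indicator {u - \<epsilon>..<u} s / \<epsilon>)"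
  using assms by (auto simp: kernel_def indicator_def)

lemma kernel_measurable:
  assumes [measurable]: "\<phi> \<in> borel_measurable I"
  shows "(\<lambda>(s, u). kernel \<phi> \<epsilon> s u) \<in> borel_measurable (L \<Otimes>\<^sub>M I)"
proof -
  have [measurable]: "(\<lambda>s. s) \<in> borel_measurable I" by (rule measurable_restrict_space1) simp
  have "(\<lambda>x. \<phi> (fst x) / \<epsilon> * ((if 0 \<le> snd x \<and> snd x \<le> min (fst x + \<epsilon>) T then 1 else 0)
      - (if 0 \<le> snd x \<and> snd x \<le> fst x then 1 else 0))) \<in> borel_measurable (I \<Otimes>\<^sub>M I)"
    by measurable
  then have "(\<lambda>x. \<phi> (fst x) / \<epsilon> * ((if 0 \<le> snd x \<and> snd x \<le> min (fst x + \<epsilon>) T then 1 else 0)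
      - (if 0 \<le> snd x \<and> snd x \<le> fst x then 1 else 0))) \<in> borel_measurable (L \<Otimes>\<^sub>M I)"
    unfolding measurable_cong_sets[OF sets_pair_measure_cong[OF sets_L refl] refl] .
  then show ?thesis
    by (simp add: kernel_def case_prod_beta indicator_def of_bool_def)
qed

lemma smear_measurable:
  assumes "\<phi> \<in> borel_measurable I"
  shows "smear \<phi> \<epsilon> \<in> borel_measurable I"
proof -
  have "(\<lambda>(u, s). kernel \<phi> \<epsilon> s u) \<in> borel_measurable (I \<Otimes>\<^sub>M L)"
    using measurable_pair_swap[OF kernel_measurable[OF assms]] by (simp add: case_prod_beta)
  from L.borel_measurable_lebesgue_integral[OF this] show ?thesis
    by (simp add: smear_def[abs_def])
qed

lemma integrable_window: "integrable L (\<lambda>s. indicator {u - \<epsilon>..<u} s / \<epsilon> :: real)"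
  by (intro Bochner_Integration.integrable_divide L.integrable_const_bound[where B=1])
    (auto simp: indicator_def intro!: measurable_restrict_space1)

text \<open>Near 0 the window sticks out of [0,T] and loses mass; hence equality only for \<epsilon>
  \<le> u, and a bound in general.\<close>

lemma integral_window:
  assumes "\<epsilon> > 0"
  shows "(\<integral>s. indicator {u - \<epsilon>..<u} s / \<epsilon> \<partial>L) \<le> (1::real)"
    and "u - \<epsilon> \<ge> 0 \<Longrightarrow> u \<le> T \<Longrightarrow> (\<integral>s. indicator {u - \<epsilon>..<u} s / \<epsilon> \<partial>L) = (1::real)"
proof -
  have "(\<integral>s. indicator {u - \<epsilon>..<u} s / \<epsilon> \<partial>L) = (\<integral>s. indicator {u - \<epsilon>..<u} s \<partial>L) / \<epsilon>"
    by simp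
  also have "(\<integral>s. indicator {u - \<epsilon>..<u} s \<partial>L) = measure L ({u - \<epsilon>..<u} \<inter> {0..T})"
    by (simp add: space_L)
  also have "\<dots> = measure lborel ({u - \<epsilon>..<u} \<inter> {0..T})"
    by (rule measure_restrict_space) auto
  finally have eq: "(\<integral>s. indicator {u - \<epsilon>..<u} s / \<epsilon> \<partial>L) = measure lborel ({u - \<epsilon>..<u} \<inter> {0..T}) / \<epsilon>" .
  have "measure lborel ({u - \<epsilon>..<u} \<inter> {0..T}) \<le> measure lborel {u - \<epsilon>..<u}"
    using assms by (intro measure_mono_fmeasurable) (auto simp: fmeasurable_def)
  also have "\<dots> = \<epsilon>" using assms by simp
  finally show "(\<integral>s. indicator {u - \<epsilon>..<u} s / \<epsilon> \<partial>L) \<le> (1::real)"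
    unfolding eq using assms by simp
  show "(\<integral>s. indicator {u - \<epsilon>..<u} s / \<epsilon> \<partial>L) = (1::real)" if "u - \<epsilon> \<ge> 0" "u \<le> T"
  proof -
    have "{u - \<epsilon>..<u} \<inter> {0..T} = {u - \<epsilon>..<u}" using that by auto
    then show ?thesis unfolding eq using assms by simp
  qed
qed

lemma smear_eq:
  assumes "u \<in> {0..T}" "\<epsilon> > 0"
  shows "smear \<phi> \<epsilon> u = (\<integral>s. \<phi> s * (indicator {u - \<epsilon>..<u} s / \<epsilon>) \<partial>L)"
  unfolding smear_def using assms kernel_eq by (intro Bochner_Integration.integral_cong) (auto simp: space_L)

text \<open>The window has mass at most 1, so a bound of \<open>g\<close> inside the window is
  enough. It is applied to \<phi> itself and to the deviation of \<phi> from \<phi>(u).\<close>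

lemma integral_window_bound:
  assumes "\<epsilon> > 0" "0 \<le> K" "\<And>s. s \<in> {0..T} \<Longrightarrow> u - \<epsilon> \<le> s \<Longrightarrow> s < u \<Longrightarrow> \<bar>g s\<bar> \<le> K"
  shows "\<bar>\<integral>s. g s * (indicator {u - \<epsilon>..<u} s / \<epsilon>) \<partial>L\<bar> \<le> K"
proof -
  have "\<bar>\<integral>s. g s * (indicator {u - \<epsilon>..<u} s / \<epsilon>) \<partial>L\<bar> \<le> (\<integral>s. \<bar>g s * (indicator {u - \<epsilon>..<u} s / \<epsilon>)\<bar> \<partial>L)"
    by (rule integral_abs_bound)
  also have "\<dots> \<le> (\<integral>s. K * (indicator {u - \<epsilon>..<u} s / \<epsilon>) \<partial>L)"
  proof (rule integral_mono_AE')
    show "integrable L (\<lambda>s. K * (indicator {u - \<epsilon>..<u} s / \<epsilon>))"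
      by (intro integrable_mult_right integrable_window)
    show "AE s in L. \<bar>g s * (indicator {u - \<epsilon>..<u} s / \<epsilon>)\<bar> \<le> K * (indicator {u - \<epsilon>..<u} s / \<epsilon>)"
      using assms by (intro AE_I2) (auto simp: space_L indicator_def divide_simps)
    show "AE s in L. 0 \<le> K * (indicator {u - \<epsilon>..<u} s / \<epsilon>)"
      using assms by simp
  qed
  also have "\<dots> \<le> K * 1"
    unfolding integral_mult_right_zero using integral_window(1)[OF assms(1)] assms(2) by (intro mult_left_mono)
  finally show ?thesis by simp
qed

lemma smear_bound:
  assumes "\<epsilon> > 0" "0 \<le> K" "\<And>s. s \<in> {0..T} \<Longrightarrow> \<bar>\<phi> s\<bar> \<le> K" "u \<in> {0..T}"
  shows "\<bar>smear \<phi> \<epsilon> u\<bar> \<le> K"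
  unfolding smear_eq[OF assms(4,1)] using assms by (intro integral_window_bound)

lemma smear_Bd:
  assumes "\<phi> \<in> Bd" "\<epsilon> > 0"
  shows "smear \<phi> \<epsilon> \<in> Bd"
proof -
  obtain K where K: "0 \<le> K" "\<And>u. u \<in> {0..T} \<Longrightarrow> \<bar>\<phi> u\<bar> \<le> K" using Bd_bounded[OF assms(1)] by blast
  show ?thesis
    by (rule BdI[OF smear_measurable[OF Bd_measurable[OF assms(1)]] smear_bound[OF assms(2) K]])
qed

lemma smear_tendsto:
  assumes \<phi>: "\<phi> \<in> Bd" and u: "u \<in> {0<..T}" and cont: "continuous (at u within {0..T}) \<phi>"
  shows "((\<lambda>\<epsilon>. smear \<phi> \<epsilon> u) \<longlongrightarrow> \<phi> u) (at_right 0)"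
proof (rule tendstoI)
  fix e :: real assume e: "e > 0"
  obtain K where K: "0 \<le> K" "\<And>u. u \<in> {0..T} \<Longrightarrow> \<bar>\<phi> u\<bar> \<le> K" using Bd_bounded[OF \<phi>] by blast
  obtain d where d: "d > 0" "\<And>s. s \<in> {0..T} \<Longrightarrow> dist s u < d \<Longrightarrow> dist (\<phi> s) (\<phi> u) < e / 2"
    using cont half_gt_zero[OF e] unfolding continuous_within_eps_delta by blast
  \<comment> \<open>\<epsilon> < u gives the window full mass, and \<epsilon> < d keeps it within
    the neighbourhood where \<phi> is close to \<phi>(u).\<close>
  have "dist (smear \<phi> \<epsilon> u) (\<phi> u) < e" if \<epsilon>: "0 < \<epsilon>" "\<epsilon> < min d u" for \<epsilon>
  proof -
    have m: "\<phi> \<in> borel_measurable L" using Bd_measurable[OF \<phi>] by (simp cong: measurable_cong_sets add: sets_L)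
    have int: "integrable L (\<lambda>s. \<phi> s * (indicator {u - \<epsilon>..<u} s / \<epsilon>))"
    proof (rule Bochner_Integration.integrable_bound)
      show "integrable L (\<lambda>s. K * (indicator {u - \<epsilon>..<u} s / \<epsilon>))"
        by (intro integrable_mult_right integrable_window)
      show "(\<lambda>s. \<phi> s * (indicator {u - \<epsilon>..<u} s / \<epsilon>)) \<in> borel_measurable L"
        by (intro borel_measurable_times m borel_measurable_integrable[OF integrable_window])
      show "AE s in L. norm (\<phi> s * (indicator {u - \<epsilon>..<u} s / \<epsilon>)) \<le> norm (K * (indicator {u - \<epsilon>..<u} s / \<epsilon>))"
        using K by (intro AE_I2) (auto simp: space_L abs_mult intro!: divide_right_mono mult_right_mono)
    qed
    have "smear \<phi> \<epsilon> u - \<phi> u = (\<integral>s. \<phi> s * (indicator {u - \<epsilon>..<u} s / \<epsilon>) \<partial>L) - (\<integral>s. \<phi> u * (indicator {u - \<epsilon>..<u} s / \<epsilon>) \<partial>L)"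
      unfolding integral_mult_right_zero using u \<epsilon> by (subst integral_window(2)) (auto simp: smear_eq)
    also have "\<dots> = (\<integral>s. \<phi> s * (indicator {u - \<epsilon>..<u} s / \<epsilon>) - \<phi> u * (indicator {u - \<epsilon>..<u} s / \<epsilon>) \<partial>L)"
      by (intro Bochner_Integration.integral_diff[symmetric] int integrable_mult_right integrable_window)
    also have "\<dots> = (\<integral>s. (\<phi> s - \<phi> u) * (indicator {u - \<epsilon>..<u} s / \<epsilon>) \<partial>L)"
      by (simp only: left_diff_distrib)
    finally have eq: "smear \<phi> \<epsilon> u - \<phi> u = (\<integral>s. (\<phi> s - \<phi> u) * (indicator {u - \<epsilon>..<u} s / \<epsilon>) \<partial>L)" .
    have "\<bar>smear \<phi> \<epsilon> u - \<phi> u\<bar> \<le> e / 2"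
      unfolding eq
    proof (rule integral_window_bound[OF \<epsilon>(1)])
      show "\<bar>\<phi> s - \<phi> u\<bar> \<le> e / 2" if "s \<in> {0..T}" "u - \<epsilon> \<le> s" "s < u" for s
        using d(2)[of s] that \<epsilon> by (auto simp: dist_real_def)
    qed (use e in simp)
    then show ?thesis using e by (simp add: dist_real_def)
  qed
  then show "\<forall>\<^sub>F \<epsilon> in at_right 0. dist (smear \<phi> \<epsilon> u) (\<phi> u) < e"
    using d(1) u by (intro eventually_at_rightI[of 0 "min d u"]) (simp_all only: greaterThanLessThan_iff, simp)
qed

lemma hn_smear_tendsto:
  assumes \<phi>: "\<phi> \<in> BV T"
  shows "((\<lambda>\<epsilon>. hn (\<lambda>u. smear \<phi> \<epsilon> u - \<phi> u)) \<longlongrightarrow> 0) (at_right 0)"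
proof -
  have Bd: "\<phi> \<in> Bd" using \<phi> BV_Bd by blast
  obtain K where K: "0 \<le> K" "\<And>u. u \<in> {0..T} \<Longrightarrow> \<bar>\<phi> u\<bar> \<le> K" using Bd_bounded[OF Bd] by blast
  \<comment> \<open>The point 0 is exceptional even if \<phi> is continuous there: its window lies
    outside [0,T], so the average at 0 is 0 whatever \<phi>(0) is.\<close>
  define D where "D = insert 0 {x\<in>{0..T}. \<not> continuous (at x within {0..T}) \<phi>}"
  have D: "countable D" "D \<subseteq> {0..T}"
    using BV_countable_discontinuities[OF \<phi>] T_pos by (auto simp: D_def)
  \<comment> \<open>Dominated convergence is applied along sequences, which determine limits along
    \<open>at_right 0\<close>.\<close>
  have "(\<lambda>n. hn (\<lambda>u. smear \<phi> (\<epsilon> n) u - \<phi> u)) \<longlonglongrightarrow> 0"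
    if \<epsilon>: "\<And>n. 0 < \<epsilon> n" "\<epsilon> \<longlonglongrightarrow> 0" for \<epsilon> :: "nat \<Rightarrow> real"
  proof -
    have fl: "filterlim \<epsilon> (at_right 0) sequentially"
      using \<epsilon> by (auto simp: filterlim_at intro!: always_eventually less_imp_neq[symmetric])
    have meas: "(\<lambda>u. smear \<phi> (\<epsilon> n) u - \<phi> u) \<in> borel_measurable I" for n
      using Bd_diff[OF smear_Bd[OF Bd \<epsilon>(1)] Bd] by (rule Bd_measurable)
    have bound: "\<bar>smear \<phi> (\<epsilon> n) u - \<phi> u\<bar> \<le> 2 * K" if "u \<in> {0..T}" for n u
      using smear_bound[of "\<epsilon> n" K \<phi> u, OF \<epsilon>(1) K that] K(2)[OF that] by linarith
    have lim: "(\<lambda>n. smear \<phi> (\<epsilon> n) u - \<phi> u) \<longlonglongrightarrow> 0" if "u \<in> {0..T}" "u \<notin> D" for u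
    proof -
      have "((\<lambda>\<epsilon>. smear \<phi> \<epsilon> u) \<longlongrightarrow> \<phi> u) (at_right 0)"
        using that by (intro smear_tendsto[OF Bd]) (auto simp: D_def)
      from filterlim_compose[OF this fl] show ?thesis
        using tendsto_diff[OF _ tendsto_const, of "\<lambda>n. smear \<phi> (\<epsilon> n) u" "\<phi> u" sequentially "\<phi> u"] by simp
    qed
    have "(\<lambda>n. ip (\<lambda>u. smear \<phi> (\<epsilon> n) u - \<phi> u) (\<lambda>u. smear \<phi> (\<epsilon> n) u - \<phi> u)) \<longlonglongrightarrow> signed_integral (borel_square T) \<mu> (\<lambda>_. 0)"
      unfolding H_inner_def
    proof (rule signed_integral_tendsto[OF measurable_tensor[OF meas meas], where w="\<lambda>_. 2 * K * (2 * K)"])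
      show "AE x in \<Lambda>. (\<lambda>n. case x of (u, v) \<Rightarrow> (smear \<phi> (\<epsilon> n) u - \<phi> u) * (smear \<phi> (\<epsilon> n) v - \<phi> v)) \<longlonglongrightarrow> 0"
        using AE_countable_lines[OF D] AE_space
      proof eventually_elim
        case (elim x)
        then have "(\<lambda>n. (smear \<phi> (\<epsilon> n) (fst x) - \<phi> (fst x)) * (smear \<phi> (\<epsilon> n) (snd x) - \<phi> (snd x))) \<longlonglongrightarrow> 0 * 0"
          by (intro tendsto_mult lim) (auto simp: space_restrict_space)
        then show ?case by (simp add: case_prod_beta)
      qed
      show "AE x in \<Lambda>. \<bar>case x of (u, v) \<Rightarrow> (smear \<phi> (\<epsilon> n) u - \<phi> u) * (smear \<phi> (\<epsilon> n) v - \<phi> v)\<bar> \<le> 2 * K * (2 * K)" for n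
      proof (intro AE_I2)
        fix x assume "x \<in> space \<Lambda>"
        then have "\<bar>smear \<phi> (\<epsilon> n) (fst x) - \<phi> (fst x)\<bar> * \<bar>smear \<phi> (\<epsilon> n) (snd x) - \<phi> (snd x)\<bar> \<le> 2 * K * (2 * K)"
          using K(1) by (intro mult_mono bound) (auto simp: space_restrict_space)
        then show "\<bar>case x of (u, v) \<Rightarrow> (smear \<phi> (\<epsilon> n) u - \<phi> u) * (smear \<phi> (\<epsilon> n) v - \<phi> v)\<bar> \<le> 2 * K * (2 * K)"
          by (simp only: case_prod_beta abs_mult)
      qed
    qed auto
    moreover have "signed_integral (borel_square T) \<mu> (\<lambda>_. 0) = 0"
      by (simp add: signed_integral_def)
    ultimately show ?thesis
      unfolding H_norm_def using tendsto_real_sqrt by fastforce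
  qed
  then show ?thesis
    unfolding tendsto_at_iff_sequentially by (auto simp: comp_def)
qed

end

section \<open>Forward approximations as square integrable random variables\<close>

context covariance_measure_cadlag_process
begin

abbreviation XE :: "real \<Rightarrow> 'a \<Rightarrow> real" where
  "XE \<equiv> extend_process T X"

lemma XE_L2: "XE t \<in> L2_space M"
  using T_pos by (auto simp: extend_process_def intro!: X_L2)

lemma XE_measurable: "XE t \<in> borel_measurable M"
  by (rule L2_spaceD[OF XE_L2])

lemma XE_right_continuous:
  assumes "0 \<le> t" "\<omega> \<in> space M"
  shows "((\<lambda>s. XE s \<omega>) \<longlongrightarrow> XE t \<omega>) (at_right t)"
proof (cases "t < T")
  case True
  then have "((\<lambda>s. X s \<omega>) \<longlongrightarrow> X t \<omega>) (at_right t)"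
    using cadlag assms by (auto simp: cadlag_process_def)
  moreover have "\<forall>\<^sub>F s in at_right t. X s \<omega> = XE s \<omega>"
    using True assms(1) by (intro eventually_at_rightI[of t T]) (auto simp: extend_process_def)
  ultimately have "((\<lambda>s. XE s \<omega>) \<longlongrightarrow> X t \<omega>) (at_right t)"
    by (rule Lim_transform_eventually)
  then show ?thesis using True assms(1) by (simp add: extend_process_def)
next
  case False
  have "\<forall>\<^sub>F s in at_right t. XE s \<omega> = XE t \<omega>"
    using False assms(1) T_pos by (intro eventually_at_rightI[of t "t + 1"]) (auto simp: extend_process_def)
  then show ?thesis by (rule tendsto_eventually)
qed

text \<open>By right continuity the process is the limit of its values at grid times just to the
  right of the current time. Each discretised process uses only countably many times, which makes it
  jointly measurable.\<close>

lemma XE_jointly_measurable: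
  assumes "0 \<le> c"
  shows "(\<lambda>(s, \<omega>). XE (s + c) \<omega>) \<in> borel_measurable (L \<Otimes>\<^sub>M M)"
proof (rule borel_measurable_LIMSEQ_real)
  \<comment> \<open>The next grid point of mesh 1/(n+1): the added 1 puts it strictly to the right
    of \<open>t\<close> even when \<open>t\<close> is itself a grid point, as a limit along
    \<open>at_right t\<close> requires.\<close>
  define r :: "nat \<Rightarrow> real \<Rightarrow> real" where "r n t = (of_int \<lfloor>real (Suc n) * t\<rfloor> + 1) / real (Suc n)" for n t
  show "(\<lambda>(s, \<omega>). XE (r n (s + c)) \<omega>) \<in> borel_measurable (L \<Otimes>\<^sub>M M)" for n
  proof -
    have [measurable]: "(\<lambda>s. s) \<in> borel_measurable L" by (rule measurable_restrict_space1) simp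
    have floor: "(\<lambda>x. \<lfloor>real (Suc n) * (fst x + c)\<rfloor>) \<in> measurable (L \<Otimes>\<^sub>M M) (count_space UNIV)"
      by measurable
    have "(\<lambda>x. XE ((of_int i + 1) / real (Suc n)) (snd x)) \<in> borel_measurable (L \<Otimes>\<^sub>M M)" for i :: int
      by (rule measurable_compose[OF measurable_snd XE_measurable])
    from measurable_compose_countable[of "\<lambda>i x. XE ((of_int i + 1) / real (Suc n)) (snd x)", OF this floor]
    have "(\<lambda>x. XE ((of_int \<lfloor>real (Suc n) * (fst x + c)\<rfloor> + 1) / real (Suc n)) (snd x)) \<in> borel_measurable (L \<Otimes>\<^sub>M M)" .
    then show ?thesis by (simp add: r_def case_prod_beta)
  qed
  fix x assume x: "x \<in> space (L \<Otimes>\<^sub>M M)"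
  define t where "t = fst x + c"
  have t: "0 \<le> t" "snd x \<in> space M" using x assms by (auto simp: t_def space_pair_measure space_L)
  have r_gt: "t < r n t" for n
  proof -
    have "real (Suc n) * t < of_int \<lfloor>real (Suc n) * t\<rfloor> + 1" by linarith
    then show ?thesis unfolding r_def by (simp add: pos_less_divide_eq mult.commute)
  qed
  have r_le: "r n t \<le> t + 1 / real (Suc n)" for n
  proof -
    have "of_int \<lfloor>real (Suc n) * t\<rfloor> + 1 \<le> real (Suc n) * t + 1" by linarith
    then have "r n t \<le> (real (Suc n) * t + 1) / real (Suc n)"
      unfolding r_def by (intro divide_right_mono) auto
    also have "\<dots> = t + 1 / real (Suc n)" by (simp add: add_divide_distrib)
    finally show ?thesis .
  qed
  have "(\<lambda>n. t + 1 / real (Suc n)) \<longlonglongrightarrow> t + 0"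
    by (intro tendsto_add tendsto_const LIMSEQ_Suc[OF lim_const_over_n])
  then have "(\<lambda>n. r n t) \<longlonglongrightarrow> t"
    by (intro tendsto_sandwich[of "\<lambda>_. t" "\<lambda>n. r n t" sequentially "\<lambda>n. t + 1 / real (Suc n)"])
      (use r_gt r_le in \<open>auto intro!: always_eventually less_imp_le\<close>)
  then have "filterlim (\<lambda>n. r n t) (at_right t) sequentially"
    using r_gt by (auto simp: filterlim_at intro!: always_eventually less_imp_neq[symmetric])
  from filterlim_compose[OF XE_right_continuous[OF t] this]
  show "(\<lambda>n. case x of (s, \<omega>) \<Rightarrow> XE (r n (s + c)) \<omega>) \<longlonglongrightarrow> (case x of (s, \<omega>) \<Rightarrow> XE (s + c) \<omega>)"
    by (simp add: t_def case_prod_beta)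
qed

text \<open>The second moment of X_t is the form at the indicator of [0,t], hence at most the total
  mass of |\<mu>|, uniformly in t.\<close>

lemma XE_norm_bound: "\<exists>C. \<forall>t. L2_norm M (XE t) \<le> C"
proof -
  have "L2_norm M (XE t) \<le> sqrt (\<integral>x. 1 \<partial>\<Lambda>)" for t
  proof -
    define t' where "t' = max 0 (min t T)"
    have t': "t' \<in> {0..T}" using T_pos by (auto simp: t'_def)
    have "L2_norm M (XE t) = sqrt (ip (indicator {0..t'}) (indicator {0..t'}))"
      using elem_hn[OF base[OF t']] by (simp add: extend_process_def t'_def H_norm_def)
    also have "\<dots> \<le> sqrt (\<integral>x. 1 \<partial>\<Lambda>)"
    proof (rule real_sqrt_le_mono)
      have "ip (indicator {0..t'}) (indicator {0..t'}) \<le> (\<integral>x. \<bar>case x of (u, v) \<Rightarrow> indicator {0..t'} u * indicator {0..t'} v\<bar> \<partial>\<Lambda>)"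
        unfolding H_inner_def
        by (rule order_trans[OF abs_ge_self abs_signed_integral_le[OF integrable_tensor[OF indicator_atMost_L_mu indicator_atMost_L_mu]]])
      also have "\<dots> \<le> (\<integral>x. 1 \<partial>\<Lambda>)"
        by (rule integral_mono_AE') (auto simp: indicator_def)
      finally show "ip (indicator {0..t'}) (indicator {0..t'}) \<le> (\<integral>x. 1 \<partial>\<Lambda>)" .
    qed
    finally show ?thesis .
  qed
  then show ?thesis by blast
qed

text \<open>For s in [0,T] and \<epsilon> > 0, this is the random variable that \<open>elem\<close>
  pairs with the step function \<open>kernel \<phi> \<epsilon> s\<close>.\<close>

definition quotient :: "(real \<Rightarrow> real) \<Rightarrow> real \<Rightarrow> real \<Rightarrow> 'a \<Rightarrow> real" where
  "quotient \<phi> \<epsilon> s \<omega> = \<phi> s * ((XE (s + \<epsilon>) \<omega> - XE s \<omega>) / \<epsilon>)"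

abbreviation F :: "(real \<Rightarrow> real) \<Rightarrow> real \<Rightarrow> 'a \<Rightarrow> real" where
  "F \<equiv> forward_approx T X"

lemma F_eq: "F \<phi> \<epsilon> \<omega> = (\<integral>s. quotient \<phi> \<epsilon> s \<omega> \<partial>L)"
  unfolding forward_approx_def quotient_def set_lebesgue_integral_def
  by (subst integral_restrict_space) (auto simp: set_lebesgue_integral_def)

lemma quotient_measurable:
  assumes "\<phi> \<in> borel_measurable I" "\<epsilon> > 0"
  shows "(\<lambda>(s, \<omega>). quotient \<phi> \<epsilon> s \<omega>) \<in> borel_measurable (L \<Otimes>\<^sub>M M)"
proof -
  have "\<phi> \<in> borel_measurable L" using assms(1) by (simp cong: measurable_cong_sets add: sets_L)
  then have [measurable]: "(\<lambda>x. \<phi> (fst x)) \<in> borel_measurable (L \<Otimes>\<^sub>M M)"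
    by (rule measurable_compose[OF measurable_fst])
  have [measurable]: "(\<lambda>x. XE (fst x + \<epsilon>) (snd x)) \<in> borel_measurable (L \<Otimes>\<^sub>M M)"
      "(\<lambda>x. XE (fst x) (snd x)) \<in> borel_measurable (L \<Otimes>\<^sub>M M)"
    using XE_jointly_measurable[of \<epsilon>] XE_jointly_measurable[of 0] assms(2) by (simp_all add: case_prod_beta)
  show ?thesis
    unfolding quotient_def case_prod_beta by measurable
qed

lemma quotient_L2: "quotient \<phi> \<epsilon> s \<in> L2_space M"
  using L2_space_linear[OF XE_L2[of "s + \<epsilon>"] XE_L2[of s], of "\<phi> s / \<epsilon>" "- \<phi> s / \<epsilon>"]
  unfolding quotient_def[abs_def] by (simp add: algebra_simps diff_divide_distrib)

lemma quotient_norm_bound: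
  assumes "\<phi> \<in> Bd" "\<epsilon> > 0"
  shows "\<exists>C\<ge>0. \<forall>s\<in>{0..T}. L2_norm M (quotient \<phi> \<epsilon> s) \<le> C"
proof -
  obtain K where K: "0 \<le> K" "\<And>u. u \<in> {0..T} \<Longrightarrow> \<bar>\<phi> u\<bar> \<le> K" using Bd_bounded[OF assms(1)] by blast
  obtain C where C: "\<And>t. L2_norm M (XE t) \<le> C" using XE_norm_bound by blast
  have C0: "0 \<le> C" using C[of 0] L2_norm_nonneg order_trans by blast
  have "L2_norm M (quotient \<phi> \<epsilon> s) \<le> K / \<epsilon> * (2 * C)" if s: "s \<in> {0..T}" for s
  proof -
    have "L2_norm M (quotient \<phi> \<epsilon> s) = \<bar>\<phi> s\<bar> / \<epsilon> * L2_norm M (\<lambda>\<omega>. XE (s + \<epsilon>) \<omega> - XE s \<omega>)"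
      using assms(2) by (simp add: L2_norm_def quotient_def power_mult_distrib power_divide real_sqrt_mult real_sqrt_divide)
    also have "\<dots> \<le> K / \<epsilon> * (C + C)"
    proof (intro mult_mono divide_right_mono K(2) s)
      have "L2_norm M (\<lambda>\<omega>. XE (s + \<epsilon>) \<omega> + - XE s \<omega>) \<le> L2_norm M (XE (s + \<epsilon>)) + L2_norm M (\<lambda>\<omega>. - XE s \<omega>)"
        using L2_space_linear[OF XE_L2 XE_L2, of "-1" s 0 s] by (intro L2_norm_triangle XE_L2) simp
      also have "L2_norm M (\<lambda>\<omega>. - XE s \<omega>) = L2_norm M (XE s)" by (simp add: L2_norm_def)
      finally show "L2_norm M (\<lambda>\<omega>. XE (s + \<epsilon>) \<omega> - XE s \<omega>) \<le> C + C"
        using C[of "s + \<epsilon>"] C[of s] by simp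
    qed (use assms(2) K in auto)
    finally show ?thesis by simp
  qed
  moreover have "0 \<le> K / \<epsilon> * (2 * C)" using K C0 assms(2) by auto
  ultimately show ?thesis by blast
qed

sublocale LM: pair_sigma_finite L M ..

text \<open>\<open>Z\<close> may depend on \<open>s\<close> to cover two uses: a fixed variable
  against which the approximation is tested, and the quotient itself, whose square is needed in
  \<open>F_L2\<close>.\<close>

lemma integrable_product_quotient:
  assumes \<phi>: "\<phi> \<in> Bd" "\<epsilon> > 0" and Z: "\<And>s. Z s \<in> L2_space M" "(\<lambda>(s, \<omega>). Z s \<omega>) \<in> borel_measurable (L \<Otimes>\<^sub>M M)"
    and D: "0 \<le> D" "\<And>s. s \<in> {0..T} \<Longrightarrow> L2_norm M (Z s) \<le> D"
  shows "integrable (L \<Otimes>\<^sub>M M) (\<lambda>(s, \<omega>). Z s \<omega> * quotient \<phi> \<epsilon> s \<omega>)"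
proof (rule LM.Fubini_integrable)
  show meas: "(\<lambda>(s, \<omega>). Z s \<omega> * quotient \<phi> \<epsilon> s \<omega>) \<in> borel_measurable (L \<Otimes>\<^sub>M M)"
    using borel_measurable_times[OF Z(2) quotient_measurable[OF Bd_measurable[OF \<phi>(1)] \<phi>(2)]] by (simp add: case_prod_beta)
  obtain C where C: "0 \<le> C" "\<And>s. s \<in> {0..T} \<Longrightarrow> L2_norm M (quotient \<phi> \<epsilon> s) \<le> C"
    using quotient_norm_bound[OF \<phi>] by blast
  show "AE s in L. integrable M (\<lambda>\<omega>. case (s, \<omega>) of (s, \<omega>) \<Rightarrow> Z s \<omega> * quotient \<phi> \<epsilon> s \<omega>)"
    using integrable_mult_L2[OF Z(1) quotient_L2] by simp
  show "integrable L (\<lambda>s. \<integral>\<omega>. norm (case (s, \<omega>) of (s, \<omega>) \<Rightarrow> Z s \<omega> * quotient \<phi> \<epsilon> s \<omega>) \<partial>M)"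
  proof (rule L.integrable_const_bound[where B="D * C"])
    show "(\<lambda>s. \<integral>\<omega>. norm (case (s, \<omega>) of (s, \<omega>) \<Rightarrow> Z s \<omega> * quotient \<phi> \<epsilon> s \<omega>) \<partial>M) \<in> borel_measurable L"
      using meas by measurable
    have abs: "(\<lambda>\<omega>. \<bar>Y \<omega>\<bar>) \<in> L2_space M" "L2_norm M (\<lambda>\<omega>. \<bar>Y \<omega>\<bar>) = L2_norm M Y" if "Y \<in> L2_space M" for Y
      using that by (auto simp: L2_space_def L2_norm_def intro: borel_measurable_abs)
    have "(\<integral>\<omega>. \<bar>Z s \<omega> * quotient \<phi> \<epsilon> s \<omega>\<bar> \<partial>M) \<le> D * C" if s: "s \<in> {0..T}" for s
    proof -
      have "(\<integral>\<omega>. \<bar>Z s \<omega>\<bar> * \<bar>quotient \<phi> \<epsilon> s \<omega>\<bar> \<partial>M) \<le> L2_norm M (Z s) * L2_norm M (quotient \<phi> \<epsilon> s)"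
        using L2_Cauchy_Schwarz[OF abs(1)[OF Z(1)] abs(1)[OF quotient_L2], of s \<phi> \<epsilon> s]
        unfolding abs(2)[OF Z(1)] abs(2)[OF quotient_L2] by linarith
      also have "\<dots> \<le> D * C"
        by (intro mult_mono D(2) C(2) s D(1)) simp
      finally show ?thesis by (simp add: abs_mult)
    qed
    then show "AE s in L. norm (\<integral>\<omega>. norm (case (s, \<omega>) of (s, \<omega>) \<Rightarrow> Z s \<omega> * quotient \<phi> \<epsilon> s \<omega>) \<partial>M) \<le> D * C"
      by (intro AE_I2) (simp add: space_L)
  qed
qed

text \<open>Cauchy-Schwarz in the time variable against the constant 1 bounds the square of the
  approximation by T times the time integral of the squared quotient, which is integrable over
  \<open>M\<close> by Fubini.\<close>

lemma F_L2:
  assumes \<phi>: "\<phi> \<in> Bd" "\<epsilon> > 0"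
  shows "F \<phi> \<epsilon> \<in> L2_space M"
proof -
  note meas = quotient_measurable[OF Bd_measurable[OF \<phi>(1)] \<phi>(2)]
  have F_meas: "F \<phi> \<epsilon> \<in> borel_measurable M"
  proof -
    have "(\<lambda>(\<omega>, s). quotient \<phi> \<epsilon> s \<omega>) \<in> borel_measurable (M \<Otimes>\<^sub>M L)"
      using measurable_pair_swap[OF meas] by (simp add: case_prod_beta)
    from L.borel_measurable_lebesgue_integral[OF this] show ?thesis
      by (simp add: F_eq[abs_def])
  qed
  obtain C where C: "0 \<le> C" "\<And>s. s \<in> {0..T} \<Longrightarrow> L2_norm M (quotient \<phi> \<epsilon> s) \<le> C"
    using quotient_norm_bound[OF \<phi>] by blast
  have sq: "integrable (L \<Otimes>\<^sub>M M) (\<lambda>(s, \<omega>). (quotient \<phi> \<epsilon> s \<omega>)\<^sup>2)"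
    using integrable_product_quotient[OF \<phi> quotient_L2 meas C] by (simp add: power2_eq_square)
  have "integrable M (\<lambda>\<omega>. (F \<phi> \<epsilon> \<omega>)\<^sup>2)"
  proof (rule Bochner_Integration.integrable_bound)
    show "integrable M (\<lambda>\<omega>. T * (\<integral>s. (quotient \<phi> \<epsilon> s \<omega>)\<^sup>2 \<partial>L))"
      using LM.integrable_snd[OF sq] by simp
    show "(\<lambda>\<omega>. (F \<phi> \<epsilon> \<omega>)\<^sup>2) \<in> borel_measurable M" using F_meas by measurable
    show "AE \<omega> in M. norm ((F \<phi> \<epsilon> \<omega>)\<^sup>2) \<le> norm (T * (\<integral>s. (quotient \<phi> \<epsilon> s \<omega>)\<^sup>2 \<partial>L))"
      using LM.AE_integrable_snd[OF sq] AE_space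
    proof eventually_elim
      case (elim \<omega>)
      have "(\<lambda>s. quotient \<phi> \<epsilon> s \<omega>) \<in> borel_measurable L"
        using measurable_compose[OF measurable_Pair2'[OF elim(2)] meas] by simp
      then have q: "(\<lambda>s. quotient \<phi> \<epsilon> s \<omega>) \<in> L2_space L"
        using elim(1) by (simp add: L2_space_def)
      have one: "(\<lambda>_. 1) \<in> L2_space L" by (simp add: L2_space_def)
      have "L2_norm L (\<lambda>_. 1) = sqrt T"
        using T_pos by (simp add: L2_norm_def measure_restrict_space space_L)
      then have "\<bar>F \<phi> \<epsilon> \<omega>\<bar> \<le> L2_norm L (\<lambda>s. quotient \<phi> \<epsilon> s \<omega>) * sqrt T"
        using L2_Cauchy_Schwarz[OF q one] by (simp add: F_eq)
      then have "\<bar>F \<phi> \<epsilon> \<omega>\<bar>\<^sup>2 \<le> (L2_norm L (\<lambda>s. quotient \<phi> \<epsilon> s \<omega>) * sqrt T)\<^sup>2"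
        by (intro power_mono) auto
      then show ?case
        using T_pos by (simp add: power_mult_distrib L2_norm_power2 mult.commute)
    qed
  qed
  then show ?thesis using F_meas by (simp add: L2_space_def)
qed

lemma kernel_eq_linear:
  "kernel \<phi> \<epsilon> s = (\<lambda>u. (\<phi> s / \<epsilon>) * indicator {0..min (s + \<epsilon>) T} u + (- (\<phi> s / \<epsilon>)) * indicator {0..s} u)"
  by (simp add: kernel_def fun_eq_iff right_diff_distrib)

text \<open>Integrating \<open>X\<close> against \<open>\<phi>\<close> forward at scale \<open>\<epsilon>\<close> is, by Fubini, integrating \<open>smear \<phi> \<epsilon>\<close>.\<close>

lemma expectation_mult_F:
  assumes \<phi>: "\<phi> \<in> Bd" "\<epsilon> > 0" and g: "g \<in> Bd" and Z: "Z \<in> L2_space M"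
    and ZX: "\<And>t. t \<in> {0..T} \<Longrightarrow> expectation (\<lambda>\<omega>. Z \<omega> * X t \<omega>) = ip g (indicator {0..t})"
  shows "expectation (\<lambda>\<omega>. Z \<omega> * F \<phi> \<epsilon> \<omega>) = ip g (smear \<phi> \<epsilon>)"
proof -
  have "(\<lambda>(s, \<omega>). Z \<omega>) \<in> borel_measurable (L \<Otimes>\<^sub>M M)"
    unfolding case_prod_beta by (rule measurable_compose[OF measurable_snd L2_spaceD(1)[OF Z]])
  then have int: "integrable (L \<Otimes>\<^sub>M M) (\<lambda>(s, \<omega>). Z \<omega> * quotient \<phi> \<epsilon> s \<omega>)"
    using Z by (intro integrable_product_quotient[OF \<phi>, where D="L2_norm M Z"]) auto
  obtain K where K: "0 \<le> K" "\<And>u. u \<in> {0..T} \<Longrightarrow> \<bar>\<phi> u\<bar> \<le> K" using Bd_bounded[OF \<phi>(1)] by blast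
  obtain K' where K': "0 \<le> K'" "\<And>u. u \<in> {0..T} \<Longrightarrow> \<bar>g u\<bar> \<le> K'" using Bd_bounded[OF g] by blast
  \<comment> \<open>At fixed \<open>s\<close> the quotient combines two values of X, so
    \<open>ZX\<close> turns the expectation into the form at a step function.\<close>
  have pointwise: "expectation (\<lambda>\<omega>. Z \<omega> * quotient \<phi> \<epsilon> s \<omega>) = ip g (kernel \<phi> \<epsilon> s)" if s: "s \<in> {0..T}" for s
  proof -
    have XE: "XE (s + \<epsilon>) = X (min (s + \<epsilon>) T)" "XE s = X s"
      using s \<phi>(2) by (auto simp: extend_process_def)
    have in_T: "min (s + \<epsilon>) T \<in> {0..T}" using s \<phi>(2) T_pos by auto
    have "expectation (\<lambda>\<omega>. Z \<omega> * quotient \<phi> \<epsilon> s \<omega>) =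
        expectation (\<lambda>\<omega>. (\<phi> s / \<epsilon>) * (Z \<omega> * X (min (s + \<epsilon>) T) \<omega>) + (- (\<phi> s / \<epsilon>)) * (Z \<omega> * X s \<omega>))"
      unfolding quotient_def XE by (intro Bochner_Integration.integral_cong refl) (simp add: algebra_simps diff_divide_distrib)
    also have "\<dots> = (\<phi> s / \<epsilon>) * ip g (indicator {0..min (s + \<epsilon>) T}) + (- (\<phi> s / \<epsilon>)) * ip g (indicator {0..s})"
      unfolding ZX[OF in_T, symmetric] ZX[OF s, symmetric]
      using integrable_mult_L2[OF Z X_L2[OF in_T]] integrable_mult_L2[OF Z X_L2[OF s]]
      by (subst Bochner_Integration.integral_add) auto
    also have "\<dots> = ip g (kernel \<phi> \<epsilon> s)"
      unfolding kernel_eq_linear using g Bd_L_mu by (intro ip_linear_right[symmetric] indicator_atMost_L_mu) auto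
    finally show ?thesis .
  qed
  have "expectation (\<lambda>\<omega>. Z \<omega> * F \<phi> \<epsilon> \<omega>) = expectation (\<lambda>\<omega>. \<integral>s. Z \<omega> * quotient \<phi> \<epsilon> s \<omega> \<partial>L)"
    by (simp add: F_eq)
  also have "\<dots> = (\<integral>s. expectation (\<lambda>\<omega>. Z \<omega> * quotient \<phi> \<epsilon> s \<omega>) \<partial>L)"
    by (rule LM.Fubini_integral[OF int])
  also have "\<dots> = (\<integral>s. ip g (kernel \<phi> \<epsilon> s) \<partial>L)"
    by (intro Bochner_Integration.integral_cong refl pointwise) (simp add: space_L)
  also have "\<dots> = (\<integral>s. signed_integral (borel_square T) \<mu> (\<lambda>x. g (fst x) * kernel \<phi> \<epsilon> s (snd x)) \<partial>L)"
    by (simp only: H_inner_def case_prod_unfold)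
  also have "\<dots> = signed_integral (borel_square T) \<mu> (\<lambda>x. \<integral>s. g (fst x) * kernel \<phi> \<epsilon> s (snd x) \<partial>L)"
  \<comment> \<open>\<epsilon> is fixed here, so the factor 1/\<epsilon> does no harm to the uniform
    bound \<open>K' * (K * (1 / \<epsilon>))\<close>.\<close>
  proof (rule L.signed_integral_Fubini[OF sm, symmetric])
    have "(\<lambda>y. (fst y, snd (snd y))) \<in> L \<Otimes>\<^sub>M borel_square T \<rightarrow>\<^sub>M L \<Otimes>\<^sub>M I"
      by (intro measurable_Pair measurable_fst measurable_compose[OF measurable_snd snd_I])
    from measurable_compose[OF this kernel_measurable[OF Bd_measurable[OF \<phi>(1)], of \<epsilon>]]
    have "(\<lambda>y. kernel \<phi> \<epsilon> (fst y) (snd (snd y))) \<in> borel_measurable (L \<Otimes>\<^sub>M borel_square T)"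
      by (simp add: case_prod_beta)
    moreover have "(\<lambda>y. g (fst (snd y))) \<in> borel_measurable (L \<Otimes>\<^sub>M borel_square T)"
      by (rule measurable_compose[OF measurable_compose[OF measurable_snd fst_I] Bd_measurable[OF g]])
    ultimately show "(\<lambda>(s, x). g (fst x) * kernel \<phi> \<epsilon> s (snd x)) \<in> borel_measurable (L \<Otimes>\<^sub>M borel_square T)"
      unfolding case_prod_beta by (intro borel_measurable_times)
    fix s x assume s: "s \<in> space L" and x: "x \<in> space (borel_square T)"
    have "\<bar>kernel \<phi> \<epsilon> s (snd x)\<bar> = \<bar>\<phi> s\<bar> * (indicator {snd x - \<epsilon>..<snd x} s / \<epsilon>)"
      using s x \<phi>(2) by (subst kernel_eq) (auto simp: space_L space_restrict_space abs_mult)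
    also have "\<dots> \<le> K * (1 / \<epsilon>)"
      using s K \<phi>(2) by (intro mult_mono divide_right_mono) (auto simp: space_L indicator_def)
    finally show "\<bar>g (fst x) * kernel \<phi> \<epsilon> s (snd x)\<bar> \<le> K' * (K * (1 / \<epsilon>))"
      unfolding abs_mult using K' x by (intro mult_mono) (auto simp: space_restrict_space)
  qed
  also have "\<dots> = ip g (smear \<phi> \<epsilon>)"
    by (simp add: H_inner_def smear_def case_prod_unfold)
  finally show ?thesis .
qed

text \<open>\<open>expectation_mult_F\<close> is used twice: tested against \<open>X t\<close>, it
  gives the products of the approximation with every X_t, which is exactly the hypothesis for
  testing the approximation against itself. With \<open>FF\<close>, \<open>FZ\<close> and E(Z^2)
  known, the two squares expand alike.\<close>

lemma F_elem_distance:
  assumes \<phi>: "\<phi> \<in> Bd" "\<epsilon> > 0" and h: "elem h Z"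
  shows "L2_norm M (\<lambda>\<omega>. F \<phi> \<epsilon> \<omega> - Z \<omega>) = hn (\<lambda>u. smear \<phi> \<epsilon> u - h u)"
proof -
  note L = subsetD[OF Bd_L_mu smear_Bd[OF \<phi>]] elem_L_mu[OF h]
  have FX: "expectation (\<lambda>\<omega>. F \<phi> \<epsilon> \<omega> * X t \<omega>) = ip (smear \<phi> \<epsilon>) (indicator {0..t})" if t: "t \<in> {0..T}" for t
  proof -
    have "expectation (\<lambda>\<omega>. X t \<omega> * F \<phi> \<epsilon> \<omega>) = ip (indicator {0..t}) (smear \<phi> \<epsilon>)"
      using t by (intro expectation_mult_F \<phi> indicator_atMost_Bd X_L2 ip_indicator_X)
    then show ?thesis
      using ip_commute[OF indicator_atMost_L_mu L(1)] by (simp add: mult.commute)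
  qed
  have FZ: "expectation (\<lambda>\<omega>. F \<phi> \<epsilon> \<omega> * Z \<omega>) = ip (smear \<phi> \<epsilon>) h"
    by (rule expectation_elem_right[OF h L(1) F_L2[OF \<phi>] FX])
  have FF: "expectation (\<lambda>\<omega>. F \<phi> \<epsilon> \<omega> * F \<phi> \<epsilon> \<omega>) = ip (smear \<phi> \<epsilon>) (smear \<phi> \<epsilon>)"
    by (rule expectation_mult_F[OF \<phi> smear_Bd[OF \<phi>] F_L2[OF \<phi>] FX])
  have "expectation (\<lambda>\<omega>. (F \<phi> \<epsilon> \<omega> + (-1) * Z \<omega>)\<^sup>2) = ip (\<lambda>u. 1 * smear \<phi> \<epsilon> u + (-1) * h u) (\<lambda>u. 1 * smear \<phi> \<epsilon> u + (-1) * h u)"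
    unfolding ip_linear_square[OF L] integral_linear_square[OF F_L2[OF \<phi>] elem_L2[OF h]]
    using FF FZ expectation_elem[OF h h] by (simp add: power2_eq_square)
  then show ?thesis
    by (simp add: L2_norm_def H_norm_def)
qed

text \<open>\<open>F_elem_distance\<close> measures distances to elementary variables only, so an
  elementary \<open>Z\<close> near \<open>Y\<close> mediates. The three errors of size e/3 are those
  between \<open>smear \<phi> \<epsilon>\<close> and \<phi>, between \<phi> and h, and between Z and
  Y.\<close>

theorem has_forward_integral_BV:
  assumes \<phi>: "\<phi> \<in> BV T" and Y: "represents \<phi> Y"
  shows "has_forward_integral M T X \<phi> Y"
  unfolding has_forward_integral_def tendsto_L2_def
proof (intro conjI tendstoI)
  have Bd: "\<phi> \<in> Bd" using \<phi> BV_Bd by blast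
  have pos: "\<forall>\<^sub>F \<epsilon> in at_right 0. 0 < (\<epsilon>::real)"
    by (rule eventually_at_right_less)
  show YL2: "Y \<in> L2_space M" using Y by (rule represents_L2)
  show "\<forall>\<^sub>F \<epsilon> in at_right 0. F \<phi> \<epsilon> \<in> L2_space M"
    using pos by eventually_elim (rule F_L2[OF Bd])
  fix e :: real assume e: "e > 0"
  obtain h Z where h: "elem h Z" "hn (\<lambda>u. \<phi> u - h u) < e / 3" "L2_norm M (\<lambda>\<omega>. Y \<omega> - Z \<omega>) < e / 3"
    using representsE[OF Y, of "e / 3"] e by auto
  have "\<forall>\<^sub>F \<epsilon> in at_right 0. hn (\<lambda>u. smear \<phi> \<epsilon> u - \<phi> u) < e / 3"
    using e by (intro order_tendstoD(2)[OF hn_smear_tendsto[OF \<phi>]]) auto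
  with pos show "\<forall>\<^sub>F \<epsilon> in at_right 0. dist (L2_norm M (\<lambda>\<omega>. F \<phi> \<epsilon> \<omega> - Y \<omega>)) 0 < e"
  proof eventually_elim
    case (elim \<epsilon>)
    have L: "smear \<phi> \<epsilon> \<in> L_mu T \<mu>" "\<phi> \<in> L_mu T \<mu>" "h \<in> L_mu T \<mu>"
      using smear_Bd[OF Bd elim(1)] Bd elem_Bd[OF h(1)] Bd_L_mu by auto
    have "L2_norm M (\<lambda>\<omega>. F \<phi> \<epsilon> \<omega> - Y \<omega>) \<le> L2_norm M (\<lambda>\<omega>. F \<phi> \<epsilon> \<omega> - Z \<omega>) + L2_norm M (\<lambda>\<omega>. Z \<omega> - Y \<omega>)"
      by (rule L2_norm_triangle_diff[OF F_L2[OF Bd elim(1)] elem_L2[OF h(1)] YL2])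
    moreover have "hn (\<lambda>u. (smear \<phi> \<epsilon> u - \<phi> u) + (\<phi> u - h u)) \<le> hn (\<lambda>u. smear \<phi> \<epsilon> u - \<phi> u) + hn (\<lambda>u. \<phi> u - h u)"
      by (intro hn_triangle L_mu_diff L)
    ultimately show ?case
      using F_elem_distance[OF Bd elim(1) h(1)] h elim L2_norm_minus_commute[of M Y Z] by (simp add: dist_real_def)
  qed
qed

section \<open>Existence and uniqueness of the continuous extension\<close>

lemma elem_represents:
  assumes "elem h Z"
  shows "represents h Z"
proof -
  have "hn (\<lambda>u. h u - h u) = 0" "L2_norm M (\<lambda>\<omega>. Z \<omega> - Z \<omega>) = 0"
    by (simp_all add: H_norm_def H_inner_def signed_integral_def case_prod_beta L2_norm_def)
  then show ?thesis
    using assms unfolding represents_def by (auto intro!: elem_L2 exI[of _ h] exI[of _ Z])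
qed

lemma forward_integral_unique:
  assumes "has_forward_integral M T X \<phi> Y" "has_forward_integral M T X \<phi> Z"
  shows "L2_norm M (\<lambda>\<omega>. Y \<omega> - Z \<omega>) = 0"
proof -
  have L2: "Y \<in> L2_space M" "Z \<in> L2_space M" and ev: "\<forall>\<^sub>F \<epsilon> in at_right 0. F \<phi> \<epsilon> \<in> L2_space M"
    and lim: "((\<lambda>\<epsilon>. L2_norm M (\<lambda>\<omega>. F \<phi> \<epsilon> \<omega> - Y \<omega>)) \<longlongrightarrow> 0) (at_right 0)"
      "((\<lambda>\<epsilon>. L2_norm M (\<lambda>\<omega>. F \<phi> \<epsilon> \<omega> - Z \<omega>)) \<longlongrightarrow> 0) (at_right 0)"
    using assms by (auto simp: has_forward_integral_def tendsto_L2_def)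
  have "((\<lambda>\<epsilon>. L2_norm M (\<lambda>\<omega>. F \<phi> \<epsilon> \<omega> - Y \<omega>) + L2_norm M (\<lambda>\<omega>. F \<phi> \<epsilon> \<omega> - Z \<omega>)) \<longlongrightarrow> 0 + 0) (at_right 0)"
    by (intro tendsto_add lim)
  moreover have "\<forall>\<^sub>F \<epsilon> in at_right 0. L2_norm M (\<lambda>\<omega>. Y \<omega> - Z \<omega>) \<le>
      L2_norm M (\<lambda>\<omega>. F \<phi> \<epsilon> \<omega> - Y \<omega>) + L2_norm M (\<lambda>\<omega>. F \<phi> \<epsilon> \<omega> - Z \<omega>)"
    using ev
  proof eventually_elim
    case (elim \<epsilon>)
    then show ?case
      using L2_norm_triangle_diff[OF L2(1) elim L2(2)] L2_norm_minus_commute[of M Y "F \<phi> \<epsilon>"] by simp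
  qed
  ultimately have "L2_norm M (\<lambda>\<omega>. Y \<omega> - Z \<omega>) \<le> 0 + 0"
    by (intro tendsto_lowerbound) auto
  then show ?thesis by (simp add: antisym)
qed

text \<open>A representative is chosen separately for each integrand, so linearity is obtained
  almost everywhere, from the uniqueness of representatives.\<close>

theorem continuous_extension_exists: "continuous_extension M T X \<mu> (\<lambda>\<phi>. SOME Y. represents \<phi> Y)"
proof -
  define \<Psi> where "\<Psi> \<phi> = (SOME Y. represents \<phi> Y)" for \<phi>
  have rep: "represents \<phi> (\<Psi> \<phi>)" if "\<phi> \<in> L_mu T \<mu>" for \<phi>
    unfolding \<Psi>_def using represents_exists[OF that] by (rule someI_ex)
  have "continuous_extension M T X \<mu> \<Psi>"
    unfolding continuous_extension_def
  proof (intro conjI ballI)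
    show "\<Psi> \<phi> \<in> L2_space M" if "\<phi> \<in> L_mu T \<mu>" for \<phi>
      using rep[OF that] by (rule represents_L2)
    show "L2_linear_on M (L_mu T \<mu>) \<Psi>"
      unfolding L2_linear_on_def
    proof (intro ballI allI)
      fix \<phi> \<psi> a b assume L: "\<phi> \<in> L_mu T \<mu>" "\<psi> \<in> L_mu T \<mu>"
      show "AE \<omega> in M. \<Psi> (\<lambda>u. a * \<phi> u + b * \<psi> u) \<omega> = a * \<Psi> \<phi> \<omega> + b * \<Psi> \<psi> \<omega>"
        by (rule represents_AE_eq[OF rep[OF L_mu_linear[OF L]] represents_linear[OF rep[OF L(1)] rep[OF L(2)] L] L_mu_linear[OF L]])
    qed
    show "has_forward_integral M T X \<phi> (\<Psi> \<phi>)" if "\<phi> \<in> BV T" for \<phi>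
      using that BV_Bd Bd_L_mu by (intro has_forward_integral_BV rep) auto
    show "L2_continuous_on M (L_mu T \<mu>) hn \<Psi>"
      unfolding L2_continuous_on_def
    proof (intro ballI allI impI)
      fix \<phi> and e :: real assume \<phi>: "\<phi> \<in> L_mu T \<mu>" and e: "e > 0"
      \<comment> \<open>The extension is isometric, so \<open>d = e\<close> works.\<close>
      then show "\<exists>d>0. \<forall>\<psi>\<in>L_mu T \<mu>. hn (\<lambda>u. \<psi> u - \<phi> u) < d \<longrightarrow> L2_norm M (\<lambda>\<omega>. \<Psi> \<psi> \<omega> - \<Psi> \<phi> \<omega>) < e"
        using represents_diff_norm[OF rep rep] by (intro exI[of _ e]) auto
    qed
  qed
  then show ?thesis by (simp add: \<Psi>_def[abs_def])
qed

text \<open>Step functions are step_closure and have bounded variation, so a continuous extension is determined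
  up to null sets.\<close>

theorem continuous_extension_represents:
  assumes \<Psi>: "continuous_extension M T X \<mu> \<Psi>" and \<phi>: "\<phi> \<in> L_mu T \<mu>"
  shows "represents \<phi> (\<Psi> \<phi>)"
  unfolding represents_def
proof (intro conjI allI impI)
  have \<Psi>_L2: "\<Psi> \<psi> \<in> L2_space M" if "\<psi> \<in> L_mu T \<mu>" for \<psi>
    using \<Psi> that by (simp add: continuous_extension_def)
  show "\<Psi> \<phi> \<in> L2_space M" using \<phi> by (rule \<Psi>_L2)
  fix e :: real assume e: "e > 0"
  obtain d where d: "d > 0" "\<And>\<psi>. \<psi> \<in> L_mu T \<mu> \<Longrightarrow> hn (\<lambda>u. \<psi> u - \<phi> u) < d \<Longrightarrow> L2_norm M (\<lambda>\<omega>. \<Psi> \<psi> \<omega> - \<Psi> \<phi> \<omega>) < e"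
    using \<Psi> \<phi> e unfolding continuous_extension_def L2_continuous_on_def by blast
  \<comment> \<open>\<open>d\<close> serves the continuity of \<open>\<Psi>\<close> at \<phi>, and
    \<open>e\<close> the closeness of \<open>h\<close> to \<phi> that \<open>represents\<close>
    demands.\<close>
  obtain h Z where h: "elem h Z" "hn (\<lambda>u. \<phi> u - h u) < min d e"
    using elem_hn_dense[OF \<phi>, of "min d e"] d(1) e by auto
  note hL = elem_L_mu[OF h(1)]
  have "has_forward_integral M T X h (\<Psi> h)"
    using \<Psi> elem_BV[OF h(1)] by (simp add: continuous_extension_def)
  then have "L2_norm M (\<lambda>\<omega>. \<Psi> h \<omega> - Z \<omega>) = 0"
    using has_forward_integral_BV[OF elem_BV[OF h(1)] elem_represents[OF h(1)]] by (rule forward_integral_unique)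
  moreover have "L2_norm M (\<lambda>\<omega>. \<Psi> h \<omega> - \<Psi> \<phi> \<omega>) < e"
    using d(2)[OF hL] h(2) hn_minus_commute[OF \<phi> hL] by simp
  ultimately have "L2_norm M (\<lambda>\<omega>. \<Psi> \<phi> \<omega> - Z \<omega>) < e"
    using L2_norm_triangle_diff[OF \<Psi>_L2[OF \<phi>] \<Psi>_L2[OF hL] elem_L2[OF h(1)]]
      L2_norm_minus_commute[of M "\<Psi> \<phi>" "\<Psi> h"] by linarith
  then show "\<exists>h Z. elem h Z \<and> hn (\<lambda>u. \<phi> u - h u) < e \<and> L2_norm M (\<lambda>\<omega>. \<Psi> \<phi> \<omega> - Z \<omega>) < e"
    using h by auto
qed

end

theorem corollary5p11:
  fixes M :: "'a measure" and T :: real and X :: "real \<Rightarrow> 'a \<Rightarrow> real"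
    and \<mu> :: "(real \<times> real) set \<Rightarrow> real"
  assumes "prob_space M"
    and "T > 0"
    and cadlag: "cadlag_process M T X"
    and square_integrable: "\<And>t. t \<in> {0..T} \<Longrightarrow> X t \<in> L2_space M"
    and zero_mean: "\<And>t. t \<in> {0..T} \<Longrightarrow> (\<integral>\<omega>. X t \<omega> \<partial>M) = 0"
    and "L2_continuous M T X"
    and start: "AE \<omega> in M. X 0 \<omega> = 0"
    and "has_covariance_measure M T X \<mu>"
    and "non_atomic (borel_square T) \<mu>"
    and L_mu_vector_space: "is_function_space (L_mu T \<mu>)"
  shows
    "((\<forall>\<phi>\<in>L_mu T \<mu>. \<forall>\<psi>\<in>L_mu T \<mu>.
          integrable (total_variation (borel_square T) \<mu>) (\<lambda>(u, v). \<phi> u * \<psi> v)) \<and>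
      semiscalar_product (L_mu T \<mu>) (H_inner T \<mu>)) \<and>
     (BV T \<subseteq> L_mu T \<mu> \<and>
      (\<exists>\<Psi>. continuous_extension M T X \<mu> \<Psi>) \<and>
      (\<forall>\<Psi>. continuous_extension M T X \<mu> \<Psi> \<longrightarrow>
         (\<forall>\<phi>\<in>L_mu T \<mu>. (H_norm T \<mu> \<phi>)\<^sup>2 = (\<integral>\<omega>. (\<Psi> \<phi> \<omega>)\<^sup>2 \<partial>M))))"
proof -
  interpret covariance_measure_cadlag_process M T X \<mu>
    using assms
    by (simp add: covariance_measure_cadlag_process_def covariance_measure_process_def
        covariance_measure_process_axioms_def covariance_measure_cadlag_process_axioms_def)
  show ?thesis
  proof (intro conjI ballI allI impI)
    show "integrable \<Lambda> (\<lambda>(u, v). \<phi> u * \<psi> v)" if "\<phi> \<in> L_mu T \<mu>" "\<psi> \<in> L_mu T \<mu>" for \<phi> \<psi>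
      using that by (rule integrable_tensor)
    show "semiscalar_product (L_mu T \<mu>) ip" by (rule semiscalar_product_H_inner)
    show "BV T \<subseteq> L_mu T \<mu>" using BV_Bd Bd_L_mu by blast
    show "\<exists>\<Psi>. continuous_extension M T X \<mu> \<Psi>" using continuous_extension_exists by blast
    show "(hn \<phi>)\<^sup>2 = (\<integral>\<omega>. (\<Psi> \<phi> \<omega>)\<^sup>2 \<partial>M)" if "continuous_extension M T X \<mu> \<Psi>" "\<phi> \<in> L_mu T \<mu>" for \<Psi> \<phi>
      using represents_norm[OF continuous_extension_represents[OF that] that(2)] L2_norm_power2[of M "\<Psi> \<phi>"] by simp
  qed
qed

end
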